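(* Let $\Omega,\widetilde{\Omega}\subset\mathbb{R}^n$ be domains, let $n-1<q<n$ and $q<p<\infty$. Let $\varphi:\Omega\to\widetilde{\Omega}$ be a homeomorphism that generates a bounded composition operator $$\varphi^{\ast}: L^1_p(\widetilde{\Omega})\to L^1_q(\Omega),\qquad \varphi^{\ast}(f)=f\circ\varphi,$$ and let $\Phi_{p,q}$ be the set function on open bounded subsets of $\Omega$ associated with $\varphi^\ast$ (defined in the context). Then for every $\lambda>1$ there exists a constant $H_{p,q}^{\lambda}(\Phi_{p,q})<\infty$ such that $$\limsup_{r\to 0}\frac{L_{\varphi}^{p}(x_0,r)\,r^{n-p}}{|\varphi(B(x_0,\lambda r))|}\left(\frac{|B(x_0,r)|}{\Phi_{p,q}(B(x_0,\lambda r))}\right)^{\frac{p-q}{q}}\leq H_{p,q}^{\lambda}(\Phi_{p,q})\quad\text{for all } x_0\in\Omega,$$ where $L_{\varphi}(x_0,r)=\max_{|x_0-y|=r}|\varphi(x_0)-\varphi(y)|$.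
   Context: $|E|$ denotes the $n$-dimensional Lebesgue measure of $E\subset\mathbb{R}^n$ and $B(x,r)$ the ball with center $x$ and radius $r$; only $r$ small enough that the relevant balls lie in $\Omega$ are considered, and the dilatation quotient is understood as $+\infty$ if $\Phi_{p,q}$ of the ball is $0$. For $1\leq p\leq\infty$, $L^1_p(\Omega)$ is the homogeneous Sobolev space of locally integrable weakly differentiable functions $f:\Omega\to\mathbb{R}$ with finite seminorm $\|f\mid L^1_p(\Omega)\|=\|\nabla f\mid L_p(\Omega)\|$. Elements of Sobolev spaces with exponent $p$ are regarded as equivalence classes up to sets of $p$-capacity zero. A homeomorphism $\varphi:\Omega\to\widetilde{\Omega}$ generates a bounded composition operator $\varphi^{\ast}:L^1_p(\widetilde{\Omega})\to L^1_q(\Omega)$, $1\leq q\leq p\leq\infty$, by the rule $\varphi^\ast(f)=f\circ\varphi$, if for every $f\in L^1_p(\widetilde{\Omega})$ the composition $\varphi^{\ast}(f)\in L^1_q(\Omega)$ is defined quasi-everywhere in $\Omega$ (i.e. outside a set of capacity zero) and there is a constant $K_{p,q}(\varphi;\Omega)<\infty$ such that $\|\varphi^{\ast}(f)\mid L^1_q(\Omega)\|\leq K_{p,q}(\varphi;\Omega)\|f\mid L^1_p(\widetilde{\Omega})\|$ for all such $f$. Set function: for open bounded $\widetilde{A}\subset\widetilde{\Omega}$ put $$\widetilde{\Phi}_{p,q}(\widetilde{A})=\sup_{f\in L^1_p(\widetilde{A})\cap C_0(\widetilde{A})}\left(\frac{\|\varphi^{\ast}(f)\mid L^1_q(\Omega)\|}{\|f\mid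 L^1_p(\widetilde{A})\|}\right)^{\kappa},\qquad \frac1\kappa=\frac1q-\frac1p,$$ where $C_0(\widetilde A)$ denotes continuous functions with compact support in $\widetilde A$ (extended by zero to $\widetilde\Omega$) and the supremum is over $f$ with nonzero seminorm. Then for open bounded $A\subset\Omega$ put $\Phi_{p,q}(A)=\widetilde{\Phi}_{p,q}(\varphi(A))$. *)

theory Defs
  imports "HOL-Analysis.Analysis"
begin

primrec Ck :: "nat \<Rightarrow> ('a::euclidean_space \<Rightarrow> real) \<Rightarrow> bool" where
  "Ck 0 f \<longleftrightarrow> continuous_on UNIV f"
| "Ck (Suc k) f \<longleftrightarrow> (\<forall>x. f differentiable (at x)) \<and>
     (\<forall>b\<in>Basis. Ck k (\<lambda>x. frechet_derivative f (at x) b))"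

definition supp_in :: "('a::euclidean_space \<Rightarrow> real) \<Rightarrow> 'a set \<Rightarrow> bool" where
  "supp_in f A \<longleftrightarrow> compact (closure {x. f x \<noteq> 0}) \<and> closure {x. f x \<noteq> 0} \<subseteq> A"

definition test_function :: "'a::euclidean_space set \<Rightarrow> ('a \<Rightarrow> real) \<Rightarrow> bool" where
  "test_function \<Omega> \<eta> \<longleftrightarrow> (\<forall>k. Ck k \<eta>) \<and> supp_in \<eta> \<Omega>"

text \<open>Continuous functions with compact support in \<open>A\<close>, extended by zero to the whole space.\<close>

definition C0 :: "'a::euclidean_space set \<Rightarrow> ('a \<Rightarrow> real) set" where
  "C0 A = {f. continuous_on UNIV f \<and> supp_in f A}"

definition loc_integrable :: "'a::euclidean_space set \<Rightarrow> ('a \<Rightarrow> 'b::euclidean_space) \<Rightarrow> bool" where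
  "loc_integrable \<Omega> f \<longleftrightarrow> (\<forall>K. compact K \<and> K \<subseteq> \<Omega> \<longrightarrow> f absolutely_integrable_on K)"

definition has_weak_gradient ::
    "'a::euclidean_space set \<Rightarrow> ('a \<Rightarrow> real) \<Rightarrow> ('a \<Rightarrow> 'a) \<Rightarrow> bool" where
  "has_weak_gradient \<Omega> f G \<longleftrightarrow> loc_integrable \<Omega> f \<and> loc_integrable \<Omega> G \<and>
     (\<forall>\<eta>. test_function \<Omega> \<eta> \<longrightarrow> (\<forall>b\<in>Basis.
        (LINT x:\<Omega>|lebesgue. f x * frechet_derivative \<eta> (at x) b)
          = - (LINT x:\<Omega>|lebesgue. (G x \<bullet> b) * \<eta> x)))"

text \<open>The weak gradient is unique up to null sets, so the choice below does not affect
  integrals over \<open>\<Omega>\<close>.\<close>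

definition weak_gradient :: "'a::euclidean_space set \<Rightarrow> ('a \<Rightarrow> real) \<Rightarrow> 'a \<Rightarrow> 'a" where
  "weak_gradient \<Omega> f = (SOME G. has_weak_gradient \<Omega> f G)"

text \<open>The homogeneous Sobolev space \<open>L\<^sup>1\<^sub>p(\<Omega>)\<close> for finite \<open>p\<close>, as a set of
  functions, and its seminorm (meaningful on members of the space).\<close>

definition L1 :: "real \<Rightarrow> 'a::euclidean_space set \<Rightarrow> ('a \<Rightarrow> real) set" where
  "L1 p \<Omega> = {f. (\<exists>G. has_weak_gradient \<Omega> f G) \<and>
     (\<lambda>x. norm (weak_gradient \<Omega> f x) powr p) absolutely_integrable_on \<Omega>}"

definition L1_seminorm :: "real \<Rightarrow> 'a::euclidean_space set \<Rightarrow> ('a \<Rightarrow> real) \<Rightarrow> real" where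
  "L1_seminorm p \<Omega> f = (LINT x:\<Omega>|lebesgue. norm (weak_gradient \<Omega> f x) powr p) powr (1 / p)"

text \<open>The Sobolev \<open>p\<close>-capacity on the whole space. Unlike the condenser capacity relative to
  \<open>\<Omega>\<close>, which vanishes on all compact sets if for instance \<open>\<Omega>\<close> is the whole space and
  \<open>p\<close> is at least the dimension, it has the right null sets for every \<open>\<Omega>\<close>.\<close>

definition capacity :: "real \<Rightarrow> 'a::euclidean_space set \<Rightarrow> ennreal" where
  "capacity p E =
     (INF u \<in> {u. u \<in> L1 p UNIV \<and> (\<lambda>x. \<bar>u x\<bar> powr p) absolutely_integrable_on UNIV \<and>
                   (\<exists>U. open U \<and> E \<subseteq> U \<and> (\<forall>x\<in>U. 1 \<le> u x))}.
        ennreal ((LINT x|lebesgue. \<bar>u x\<bar> powr p) + L1_seminorm p UNIV u powr p))"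

text \<open>Elements of \<open>L\<^sup>1\<^sub>p(\<Omega>)\<close> are classes up to sets of \<open>p\<close>-capacity zero. A
  representative is a quasicontinuous function whose domain of definition \<open>D\<close> is quasi-all
  of \<open>\<Omega>\<close>; the values of \<open>f\<close> off \<open>D\<close> carry no information. Quasicontinuity singles out one
  class up to capacity zero among the functions that agree almost everywhere.\<close>

definition L1_representative ::
    "real \<Rightarrow> 'a::euclidean_space set \<Rightarrow> 'a set \<Rightarrow> ('a \<Rightarrow> real) \<Rightarrow> bool" where
  "L1_representative p \<Omega> D f \<longleftrightarrow> f \<in> L1 p \<Omega> \<and> D \<subseteq> \<Omega> \<and> capacity p (\<Omega> - D) = 0 \<and>
     (\<forall>\<epsilon>>0. \<exists>U. open U \<and> capacity p U < \<epsilon> \<and> continuous_on (D - U) f)"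

text \<open>The composition is defined on the preimage of \<open>D\<close>, which has to be quasi-all of
  \<open>\<Omega>\<close> with respect to the \<open>q\<close>-capacity.\<close>

definition bounded_composition_operator ::
    "real \<Rightarrow> real \<Rightarrow> 'a::euclidean_space set \<Rightarrow> 'a set \<Rightarrow> ('a \<Rightarrow> 'a) \<Rightarrow> bool" where
  "bounded_composition_operator p q \<Omega> \<Omega>' \<phi> \<longleftrightarrow>
     (\<exists>K::real. \<forall>D f. L1_representative p \<Omega>' D f \<longrightarrow>
        capacity q {x\<in>\<Omega>. \<phi> x \<notin> D} = 0 \<and> f \<circ> \<phi> \<in> L1 q \<Omega> \<and>
        L1_seminorm q \<Omega> (f \<circ> \<phi>) \<le> K * L1_seminorm p \<Omega>' f)"

definition Phi_tilde ::
    "real \<Rightarrow> real \<Rightarrow> 'a::euclidean_space set \<Rightarrow> ('a \<Rightarrow> 'a) \<Rightarrow> 'a set \<Rightarrow> ennreal" where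
  "Phi_tilde p q \<Omega> \<phi> A =
     (SUP f \<in> {f \<in> L1 p A \<inter> C0 A. L1_seminorm p A f \<noteq> 0}.
        ennreal ((L1_seminorm q \<Omega> (f \<circ> \<phi>) / L1_seminorm p A f) powr (1 / (1 / q - 1 / p))))"

definition Phi ::
    "real \<Rightarrow> real \<Rightarrow> 'a::euclidean_space set \<Rightarrow> ('a \<Rightarrow> 'a) \<Rightarrow> 'a set \<Rightarrow> ennreal" where
  "Phi p q \<Omega> \<phi> A = Phi_tilde p q \<Omega> \<phi> (\<phi> ` A)"

text \<open>Powers with positive exponent on the extended half-line.\<close>

definition ennpowr :: "ennreal \<Rightarrow> real \<Rightarrow> ennreal" where
  "ennpowr x a = (if x = \<infinity> then \<infinity> else ennreal (enn2real x powr a))"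

definition Lphi :: "('a::euclidean_space \<Rightarrow> 'a) \<Rightarrow> 'a \<Rightarrow> real \<Rightarrow> real" where
  "Lphi \<phi> x r = (SUP y \<in> sphere x r. norm (\<phi> x - \<phi> y))"

text \<open>If \<open>Phi\<close> of the ball is zero, the quotient is infinite, because a positive extended
  real divided by zero is infinite and the other factor is positive.\<close>

definition dilatation_quotient ::
    "real \<Rightarrow> real \<Rightarrow> 'a::euclidean_space set \<Rightarrow> ('a \<Rightarrow> 'a) \<Rightarrow> real \<Rightarrow> 'a \<Rightarrow> real \<Rightarrow> ennreal" where
  "dilatation_quotient p q \<Omega> \<phi> lam x r =
     ennreal (Lphi \<phi> x r powr p * r powr (real DIM('a) - p))
       / emeasure lebesgue (\<phi> ` ball x (lam * r))
     * ennpowr (emeasure lebesgue (ball x r) / Phi p q \<Omega> \<phi> (ball x (lam * r))) ((p - q) / q)"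

end

theory Submission
  imports Defs
begin

text \<open>Write \<open>n\<close> for the dimension, \<open>B = ball x0 (lam * r)\<close> and \<open>L = Lphi \<phi> x0 r\<close>. After cancelling the
  powers of \<open>r\<close>, a bound for the dilatation quotient is the inequality
  \<open>L\<^sup>p \<le> C r\<^sup>p\<^sup>(\<^sup>q\<^sup>-\<^sup>n\<^sup>)\<^sup>/\<^sup>q \<Phi>(B)\<^sup>(\<^sup>p\<^sup>-\<^sup>q\<^sup>)\<^sup>/\<^sup>q \<bar>\<phi>(B)\<bar>\<close>. Let \<open>y\<close> be the point of the sphere of radius \<open>r\<close> at which
  \<open>L\<close> is attained, \<open>e\<close> the direction of \<open>\<phi> x0 - \<phi> y\<close>, and \<open>u = \<phi> \<bullet> e\<close>. Both sides of the inequality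
  are compared with the energy \<open>J\<close>, the integral of \<open>\<bar>\<nabla>u\<bar>\<^sup>q\<close> over a ball about \<open>x0\<close> whose radius lies
  strictly between \<open>r\<close> and \<open>lam * r\<close>.

  Upper bound for \<open>J\<close> (\<open>energy_bound_by_Phi\<close>). A sawtooth function of \<open>z \<bullet> e\<close> with tiny teeth, cut
  off to have compact support in \<open>\<phi>(B)\<close>, has a gradient bounded by an absolute constant. It
  competes in the supremum that defines \<open>\<Phi>(B)\<close>, and its seminorm is at most a constant times
  \<open>\<bar>\<phi>(B)\<bar>\<^sup>1\<^sup>/\<^sup>p\<close>. On the slabs where the sawtooth has slope one, its composition with \<open>\<phi>\<close> differs from
  \<open>u\<close> by constants and therefore has the same weak gradient. Two sawtooth functions, shifted by
  half a period, have slabs that cover everything. Hence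
  \<open>J \<le> C \<Phi>(B)\<^sup>(\<^sup>p\<^sup>-\<^sup>q\<^sup>)\<^sup>/\<^sup>p \<bar>\<phi>(B)\<bar>\<^sup>q\<^sup>/\<^sup>p\<close>.

  Lower bound for \<open>J\<close> (\<open>oscillation_bound\<close>), where \<open>q > n - 1\<close> enters. Since \<open>\<phi>\<close> is a homeomorphism,
  a linear functional attains its extrema over \<open>\<phi>\<close> of a closed ball on \<open>\<phi>\<close> of the boundary
  (\<open>maximum_on_sphere\<close>). So for every \<open>t\<close> slightly above \<open>r\<close> the sphere of radius \<open>t\<close> contains points \<open>a\<close> and \<open>b\<close>
  with \<open>u(a) - u(b) \<ge> L\<close>. Averages of \<open>u\<close> over balls vary along paths of balls at a rate controlled
  by the weak gradient (\<open>average_path_derivative\<close>). Either the averages at scale \<open>r\<close> about \<open>a\<close> and \<open>b\<close>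
  are far apart, and \<open>J\<close> is large at once, or at one of the two points the averages over dyadic
  balls move far from the value of \<open>u\<close>. In the latter case some ball of radius \<open>\<rho>\<close> about a point of the
  sphere carries energy at least \<open>c L\<^sup>q r\<^sup>n\<^sup>-\<^sup>1\<^sup>-\<^sup>q \<rho>\<close>, and a covering argument in the radius \<open>t\<close> adds these
  contributions up (\<open>radial_covering\<close>). Hence \<open>J \<ge> c L\<^sup>q r\<^sup>n\<^sup>-\<^sup>q\<close>.

  The upper bound rests on the locality of weak gradients (\<open>weak_gradient_local\<close>), which makes the chosen
  representatives irrelevant, and on their agreement with classical gradients for test functions.\<close>

section \<open>Smooth functions\<close>

lemma Ck_imp_continuous: "Ck k f \<Longrightarrow> continuous_on UNIV f"
  by (cases k) (auto intro!: continuous_at_imp_continuous_on differentiable_imp_continuous_within)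

lemma Ck_Suc_imp_Ck: "Ck (Suc k) f \<Longrightarrow> Ck k f"
proof (induction k arbitrary: f)
  case 0
  then show ?case using Ck_imp_continuous[OF 0] by simp
next
  case (Suc k)
  then show ?case using Suc.IH by (auto simp del: Ck.simps(1))
qed

lemma Ck_SucI:
  assumes "\<And>x. (f has_derivative f' x) (at x)" "\<And>b. b \<in> Basis \<Longrightarrow> Ck k (\<lambda>x. f' x b)"
  shows "Ck (Suc k) f"
proof -
  have "frechet_derivative f (at x) = f' x" for x
    using frechet_derivative_at[OF assms(1)] by simp
  then show ?thesis using assms by (auto simp: differentiable_def)
qed

lemma Ck_Suc_has_derivative:
  "Ck (Suc k) f \<Longrightarrow> (f has_derivative frechet_derivative f (at x)) (at x)"
  by (simp add: frechet_derivative_works[symmetric])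

lemma Ck_const: "Ck k (\<lambda>x. c)"
proof (induction k arbitrary: c)
  case (Suc k)
  show ?case by (rule Ck_SucI[where f' = "\<lambda>x d. 0"]) (auto intro: Suc)
qed auto

lemma Ck_inner: "Ck k (\<lambda>x. x \<bullet> e)"
proof (cases k)
  case (Suc k)
  have "Ck (Suc k) (\<lambda>x. x \<bullet> e)"
    by (rule Ck_SucI[where f' = "\<lambda>x d. d \<bullet> e"]) (auto intro!: derivative_eq_intros Ck_const)
  then show ?thesis using Suc by simp
qed (auto intro: continuous_intros)

lemma Ck_add: "Ck k f \<Longrightarrow> Ck k g \<Longrightarrow> Ck k (\<lambda>x. f x + g x)"
proof (induction k arbitrary: f g)
  case (Suc k)
  show ?case
    by (rule Ck_SucI[where f' = "\<lambda>x d. frechet_derivative f (at x) d + frechet_derivative g (at x) d"])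
       (use Suc in \<open>auto intro!: has_derivative_add Ck_Suc_has_derivative[of k]\<close>)
qed (auto intro: continuous_intros)

lemma Ck_mult: "Ck k f \<Longrightarrow> Ck k g \<Longrightarrow> Ck k (\<lambda>x. f x * g x)"
proof (induction k arbitrary: f g)
  case (Suc k)
  show ?case
  proof (rule Ck_SucI[where f' = "\<lambda>x d. f x * frechet_derivative g (at x) d + frechet_derivative f (at x) d * g x"])
    show "((\<lambda>x. f x * g x) has_derivative (\<lambda>d. f x * frechet_derivative g (at x) d + frechet_derivative f (at x) d * g x)) (at x)" for x
      using Suc.prems by (intro has_derivative_mult Ck_Suc_has_derivative)
    have "Ck k f" "Ck k g" using Suc.prems Ck_Suc_imp_Ck by blast+
    then show "Ck k (\<lambda>x. f x * frechet_derivative g (at x) b + frechet_derivative f (at x) b * g x)"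
      if "b \<in> Basis" for b using Suc that by (auto intro!: Ck_add)
  qed
qed (auto intro: continuous_intros)

lemma Ck_sum: "(\<And>i. i \<in> I \<Longrightarrow> Ck k (f i)) \<Longrightarrow> Ck k (\<lambda>x. \<Sum>i\<in>I. f i x)"
  by (induction I rule: infinite_finite_induct) (auto intro: Ck_const Ck_add)

lemma Ck_prod: "(\<And>i. i \<in> I \<Longrightarrow> Ck k (f i)) \<Longrightarrow> Ck k (\<lambda>x. \<Prod>i\<in>I. f i x)"
  by (induction I rule: infinite_finite_induct) (auto intro: Ck_const Ck_mult)

lemma Ck_inverse: "Ck k f \<Longrightarrow> (\<And>x. f x \<noteq> 0) \<Longrightarrow> Ck k (\<lambda>x. inverse (f x))"
proof (induction k arbitrary: f)
  case (Suc k)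
  show ?case
  proof (rule Ck_SucI[where f' = "\<lambda>x d. - 1 * (inverse (f x) * frechet_derivative f (at x) d * inverse (f x))"])
    show "((\<lambda>x. inverse (f x)) has_derivative (\<lambda>d. - 1 * (inverse (f x) * frechet_derivative f (at x) d * inverse (f x)))) (at x)" for x
      using Deriv.has_derivative_inverse[OF Suc.prems(2) Ck_Suc_has_derivative[OF Suc.prems(1)]] by simp
    have "Ck k f" using Suc.prems Ck_Suc_imp_Ck by blast
    then show "Ck k (\<lambda>x. - 1 * (inverse (f x) * frechet_derivative f (at x) b * inverse (f x)))"
      if "b \<in> Basis" for b using Suc that by (intro Ck_mult Ck_const) auto
  qed
qed (auto intro!: continuous_intros)

definition smooth :: "('a::euclidean_space \<Rightarrow> real) \<Rightarrow> bool" where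
  "smooth f \<longleftrightarrow> (\<forall>k. Ck k f)"

named_theorems smooth_intros

lemma smooth_const [smooth_intros]: "smooth (\<lambda>x. c)"
  and smooth_inner [smooth_intros]: "smooth (\<lambda>x. x \<bullet> e)"
  and smooth_add [smooth_intros]: "smooth f \<Longrightarrow> smooth g \<Longrightarrow> smooth (\<lambda>x. f x + g x)"
  and smooth_mult [smooth_intros]: "smooth f \<Longrightarrow> smooth g \<Longrightarrow> smooth (\<lambda>x. f x * g x)"
  and smooth_sum [smooth_intros]: "(\<And>i. i \<in> I \<Longrightarrow> smooth (h i)) \<Longrightarrow> smooth (\<lambda>x. \<Sum>i\<in>I. h i x)"
  and smooth_prod [smooth_intros]: "(\<And>i. i \<in> I \<Longrightarrow> smooth (h i)) \<Longrightarrow> smooth (\<lambda>x. \<Prod>i\<in>I. h i x)"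
  and smooth_inverse [smooth_intros]: "smooth f \<Longrightarrow> (\<And>x. f x \<noteq> 0) \<Longrightarrow> smooth (\<lambda>x. inverse (f x))"
  by (simp_all add: smooth_def Ck_const Ck_inner Ck_add Ck_mult Ck_sum Ck_prod Ck_inverse)

lemma smooth_minus [smooth_intros]: "smooth f \<Longrightarrow> smooth (\<lambda>x. - f x)"
  using smooth_mult[OF smooth_const[of "-1"], of f] by simp

lemma smooth_diff [smooth_intros]: "smooth f \<Longrightarrow> smooth g \<Longrightarrow> smooth (\<lambda>x. f x - g x)"
  using smooth_add[OF _ smooth_minus, of f g] by simp

lemma smooth_divide [smooth_intros]:
  "smooth f \<Longrightarrow> smooth g \<Longrightarrow> (\<And>x. g x \<noteq> 0) \<Longrightarrow> smooth (\<lambda>x. f x / g x)"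
  unfolding divide_inverse by (intro smooth_intros)

lemma smooth_norm_power2 [smooth_intros]: "smooth (\<lambda>x::'a::euclidean_space. (norm (x - c))\<^sup>2)"
proof -
  have "(norm (x - c))\<^sup>2 = (\<Sum>b\<in>Basis. (x \<bullet> b - c \<bullet> b) * (x \<bullet> b - c \<bullet> b))" for x :: 'a
    unfolding power2_norm_eq_inner
    by (subst euclidean_inner) (simp add: inner_diff_left)
  then show ?thesis by (simp add: smooth_intros)
qed

lemma smooth_continuous: "smooth f \<Longrightarrow> continuous_on S f"
  using Ck_imp_continuous continuous_on_subset by (metis smooth_def subset_UNIV)

lemma smooth_has_derivative:
  "smooth f \<Longrightarrow> (f has_derivative frechet_derivative f (at x)) (at x)"
  using Ck_Suc_has_derivative smooth_def by blast

text \<open>The classes \<^const>\<open>Ck\<close> control derivatives along basis vectors; linearity of the derivative extends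
  this to every direction.\<close>

lemma smooth_frechet_derivative [smooth_intros]:
  fixes f :: "'a::euclidean_space \<Rightarrow> real"
  assumes "smooth f" shows "smooth (\<lambda>x. frechet_derivative f (at x) d)"
proof -
  have "smooth (\<lambda>x. frechet_derivative f (at x) b)" if "b \<in> Basis" for b
    using assms that unfolding smooth_def by (metis Ck.simps(2))
  moreover have "frechet_derivative f (at x) d = (\<Sum>b\<in>Basis. (d \<bullet> b) * frechet_derivative f (at x) b)" for x
  proof -
    interpret bounded_linear "frechet_derivative f (at x)"
      using smooth_has_derivative[OF assms] has_derivative_bounded_linear by blast
    have "frechet_derivative f (at x) d = frechet_derivative f (at x) (\<Sum>b\<in>Basis. (d \<bullet> b) *\<^sub>R b)"
      by (simp add: euclidean_representation)
    also have "\<dots> = (\<Sum>b\<in>Basis. (d \<bullet> b) * frechet_derivative f (at x) b)"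
      by (simp add: sum scaleR)
    finally show ?thesis .
  qed
  ultimately show ?thesis by (simp add: smooth_intros)
qed

text \<open>The powers of \<open>1/t\<close> make the family closed under differentiation up to linear combinations, so
  that the smoothness of all its members, in particular of \<open>exp (-1/t)\<close>, follows by one induction.\<close>

definition flat :: "nat \<Rightarrow> real \<Rightarrow> real" where
  "flat m t = (if t > 0 then exp (- inverse t) * inverse t ^ m else 0)"

lemma flat_tendsto_0: "(flat m \<longlongrightarrow> 0) (at_right 0)"
proof -
  have "((\<lambda>u::real. u ^ m / exp u) \<longlongrightarrow> 0) at_top"
    by (rule tendsto_power_div_exp_0)
  then have "((\<lambda>t::real. inverse t ^ m / exp (inverse t)) \<longlongrightarrow> 0) (at_right 0)"
    by (rule filterlim_compose) (rule filterlim_inverse_at_top_right)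
  then show ?thesis
    by (rule Lim_transform_eventually)
       (auto simp: eventually_at_filter flat_def exp_minus field_simps)
qed

text \<open>At the origin the difference quotient vanishes on the left and equals \<open>flat (Suc m)\<close> on the right.\<close>

lemma flat_has_derivative:
  "(flat m has_real_derivative (flat (m+2) t - real m * flat (Suc m) t)) (at t)"
proof -
  consider "t > 0" | "t < 0" | "t = 0" by linarith
  then show ?thesis
  proof cases
    case 1
    have "((\<lambda>t. exp (- inverse t) * inverse t ^ m) has_real_derivative (flat (m+2) t - real m * flat (Suc m) t)) (at t)"
    proof -
      define u where "u = inverse t"
      have "((\<lambda>t. exp (- inverse t) * inverse t ^ m) has_real_derivative
              (exp (- u) * (u * u)) * u ^ m + real m * (u ^ (m - Suc 0) * - (u * u)) * exp (- u)) (at t)"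
        using 1 by (auto intro!: derivative_eq_intros simp: u_def power2_eq_square)
      moreover have "real m * (u ^ (m - Suc 0) * (u * u)) = real m * u ^ Suc m"
        by (cases m) (simp_all add: mult.assoc mult.commute)
      then have "real m * (u ^ (m - Suc 0) * - (u * u)) * exp (- u) = - (real m * u ^ Suc m * exp (- u))"
        by simp
      ultimately have "((\<lambda>t. exp (- inverse t) * inverse t ^ m) has_real_derivative
          (exp (- u) * (u * u)) * u ^ m + - (real m * u ^ Suc m * exp (- u))) (at t)" by metis
      moreover have "(exp (- u) * (u * u)) * u ^ m + - (real m * u ^ Suc m * exp (- u))
          = flat (m+2) t - real m * flat (Suc m) t"
        using 1 by (simp add: flat_def u_def[symmetric])
      ultimately show ?thesis by metis
    qed
    moreover have "\<forall>\<^sub>F s in nhds t. flat m s = exp (- inverse s) * inverse s ^ m"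
      using eventually_nhds_in_open[of "{0<..}" t] 1 by (auto elim: eventually_mono simp: flat_def)
    ultimately show ?thesis by (simp add: DERIV_cong_ev)
  next
    case 2
    have "\<forall>\<^sub>F s in nhds t. flat m s = 0"
      using eventually_nhds_in_open[of "{..<0}" t] 2 by (auto elim: eventually_mono simp: flat_def)
    moreover have "flat (m+2) t - real m * flat (Suc m) t = 0" using 2 by (simp add: flat_def)
    moreover have "((\<lambda>t::real. 0::real) has_real_derivative 0) (at t)" by simp
    ultimately show ?thesis by (simp add: DERIV_cong_ev)
  next
    case 3
    have "((\<lambda>h. flat m h / h) \<longlongrightarrow> 0) (at_right 0)"
      using flat_tendsto_0[of "Suc m"]
      by (rule Lim_transform_eventually)
         (auto simp: eventually_at_filter flat_def field_simps)
    moreover have "((\<lambda>h. flat m h / h) \<longlongrightarrow> 0) (at_left 0)"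
      by (rule tendsto_eventually) (auto simp: eventually_at_filter flat_def)
    ultimately have "((\<lambda>h. flat m h / h) \<longlongrightarrow> 0) (at 0)"
      by (simp add: filterlim_split_at)
    then show ?thesis using 3 by (simp add: DERIV_def flat_def)
  qed
qed

lemma Ck_flat: "Ck k f \<Longrightarrow> Ck k (\<lambda>x. flat m (f x))"
proof (induction k arbitrary: f m)
  case 0
  have "continuous_on UNIV (flat m)"
    using flat_has_derivative by (meson DERIV_isCont continuous_at_imp_continuous_on)
  then show ?case using 0 by (auto intro: continuous_on_compose2)
next
  case (Suc k)
  have *: "(flat m has_derivative (\<lambda>d. d * (flat (m+2) t - real m * flat (Suc m) t))) (at t)" for t
    using flat_has_derivative[of m t] by (simp add: has_field_derivative_def mult_commute_abs)
  show ?case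
  proof (rule Ck_SucI[where f' = "\<lambda>x d. frechet_derivative f (at x) d * (flat (m+2) (f x) + - real m * flat (Suc m) (f x))"])
    show "((\<lambda>x. flat m (f x)) has_derivative (\<lambda>d. frechet_derivative f (at x) d * (flat (m+2) (f x) + - real m * flat (Suc m) (f x)))) (at x)" for x
      using has_derivative_compose[OF Ck_Suc_has_derivative[OF Suc.prems] *] by simp
    have "Ck k f" using Suc.prems Ck_Suc_imp_Ck by blast
    then show "Ck k (\<lambda>x. frechet_derivative f (at x) b * (flat (m+2) (f x) + - real m * flat (Suc m) (f x)))"
      if "b \<in> Basis" for b
      using that Suc.prems by (intro Ck_mult Ck_add Ck_const Suc.IH) auto
  qed
qed

lemma smooth_flat [smooth_intros]: "smooth f \<Longrightarrow> smooth (\<lambda>x. flat m (f x))"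
  by (simp add: smooth_def Ck_flat)

text \<open>A smooth passage from the value 0 on the negative axis to the value 1 beyond 1. The denominator
  is positive because \<open>t\<close> and \<open>1 - t\<close> cannot both be nonpositive.\<close>

definition step :: "real \<Rightarrow> real" where
  "step t = flat 0 t / (flat 0 t + flat 0 (1 - t))"

lemma flat_0_nonneg: "0 \<le> flat 0 t" and flat_0_le_1: "flat 0 t \<le> 1"
  and flat_0_pos_iff: "0 < flat 0 t \<longleftrightarrow> 0 < t" and flat_0_eq_0_iff: "flat 0 t = 0 \<longleftrightarrow> t \<le> 0"
  by (auto simp: flat_def)

lemma step_denominator_pos: "flat 0 t + flat 0 (1 - t) > 0"
  by (auto simp: flat_def add_pos_pos)

lemma step_eq_0: "t \<le> 0 \<Longrightarrow> step t = 0" and step_eq_1: "1 \<le> t \<Longrightarrow> step t = 1"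
  by (auto simp: step_def flat_def)

lemma step_nonneg: "0 \<le> step t" and step_le_1: "step t \<le> 1"
  using step_denominator_pos[of t] flat_0_nonneg[of t] flat_0_nonneg[of "1 - t"]
  by (auto simp: step_def)

lemma smooth_step [smooth_intros]: "smooth f \<Longrightarrow> smooth (\<lambda>x. step (f x))"
proof -
  assume "smooth f"
  moreover have "flat 0 (f x) + flat 0 (1 - f x) \<noteq> 0" for x
    using step_denominator_pos[of "f x"] by simp
  ultimately show ?thesis unfolding step_def by (intro smooth_intros)
qed

section \<open>Compactly supported functions and integration by parts\<close>

lemma set_integral_eq_UNIV:
  assumes "\<And>x. x \<notin> U \<Longrightarrow> h x = 0"
  shows "(LINT x:U|lebesgue. h x) = (LINT x|lebesgue. h x)"
proof -
  have "(\<lambda>x. indicator U x *\<^sub>R h x) = h" using assms by (auto simp: indicator_def fun_eq_iff)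
  then show ?thesis by (simp add: set_lebesgue_integral_def)
qed

lemma integrable_lebesgue_compact_support:
  fixes h :: "'a::euclidean_space \<Rightarrow> 'b::euclidean_space"
  assumes "compact K" "continuous_on UNIV h" "\<And>x. x \<notin> K \<Longrightarrow> h x = 0"
  shows "integrable lebesgue h"
proof -
  have "(\<lambda>x. indicator K x *\<^sub>R h x) = h" using assms by (auto simp: indicator_def fun_eq_iff)
  then have "integrable lborel h"
    using borel_integrable_compact[OF assms(1), of h] assms(2) continuous_on_subset by fastforce
  then show ?thesis by (simp add: integrable_completion)
qed

lemma supp_inI:
  assumes "compact K" "K \<subseteq> A" "\<And>x. x \<notin> K \<Longrightarrow> f x = 0"
  shows "supp_in f A"
proof -
  have "closure {x. f x \<noteq> 0} \<subseteq> K"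
    by (rule closure_minimal) (use assms compact_imp_closed in auto)
  then show ?thesis
    unfolding supp_in_def using assms
    using compact_Int_closed[OF assms(1) closed_closure, of "{x. f x \<noteq> 0}"]
    by (auto simp: Int_absorb1)
qed

lemma supp_in_mono: "supp_in f A \<Longrightarrow> A \<subseteq> B \<Longrightarrow> supp_in f B"
  by (auto simp: supp_in_def)

lemma frechet_derivative_eq_0_on_open:
  assumes "open V" "\<And>x. x \<in> V \<Longrightarrow> f x = 0" "x \<in> V"
  shows "frechet_derivative f (at x) d = 0"
proof -
  have "(f has_derivative (\<lambda>_. 0)) (at x)"
    by (rule has_derivative_transform_within_open[OF _ assms(1,3), of "\<lambda>_. 0"]) (use assms in auto)
  then show ?thesis using frechet_derivative_at by metis
qed

lemma test_functionE:
  assumes "test_function A f"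
  obtains K where "smooth f" "compact K" "K \<subseteq> A" "\<And>x. x \<notin> K \<Longrightarrow> f x = 0"
    "\<And>x d. x \<notin> K \<Longrightarrow> frechet_derivative f (at x) d = 0"
proof
  let ?K = "closure {x. f x \<noteq> 0}"
  show "smooth f" "compact ?K" "?K \<subseteq> A"
    using assms unfolding test_function_def supp_in_def smooth_def by blast+
  show 0: "f x = 0" if "x \<notin> ?K" for x using that closure_subset[of "{x. f x \<noteq> 0}"] by blast
  show "frechet_derivative f (at x) d = 0" if "x \<notin> ?K" for x d
    using frechet_derivative_eq_0_on_open[of "- ?K" f x d] that 0 by blast
qed

lemma test_functionI:
  assumes "smooth f" "compact K" "K \<subseteq> A" "\<And>x. x \<notin> K \<Longrightarrow> f x = 0"
  shows "test_function A f"
  using assms(1) supp_inI[OF assms(2-4)] by (simp add: test_function_def smooth_def)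

lemma test_function_mono: "test_function A f \<Longrightarrow> A \<subseteq> B \<Longrightarrow> test_function B f"
  by (auto simp: test_function_def intro: supp_in_mono)

text \<open>The common compact support lies in a box, and on a box the differentiation rule for
  parameter integrals with a jointly continuous derivative applies.\<close>

lemma leibniz_compact_support:
  fixes k k' :: "real \<Rightarrow> 'a::euclidean_space \<Rightarrow> real"
  assumes K: "compact K" "\<And>t x. t \<in> {0..1} \<Longrightarrow> x \<notin> K \<Longrightarrow> k t x = 0"
      "\<And>t x. t \<in> {0..1} \<Longrightarrow> x \<notin> K \<Longrightarrow> k' t x = 0"
    and deriv: "\<And>t x. t \<in> {0..1} \<Longrightarrow> ((\<lambda>t. k t x) has_real_derivative k' t x) (at t within {0..1})"
    and cont: "\<And>t. t \<in> {0..1} \<Longrightarrow> continuous_on UNIV (k t)"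
    and cont': "continuous_on ({0..1} \<times> UNIV) (\<lambda>(t, x). k' t x)"
    and t: "t \<in> {0..1}"
  shows "((\<lambda>t. LINT x|lebesgue. k t x) has_real_derivative (LINT x|lebesgue. k' t x)) (at t within {0..1})"
proof -
  obtain a b where ab: "K \<subseteq> cbox a b"
    using compact_imp_bounded[OF K(1)] bounded_subset_cbox_symmetric by blast
  have eq: "(LINT x|lebesgue. h x) = integral (cbox a b) h"
    if "\<And>x. x \<notin> K \<Longrightarrow> h x = 0" "continuous_on UNIV h" for h :: "'a \<Rightarrow> real"
  proof -
    have "(LINT x|lebesgue. h x) = integral UNIV h"
      using integrable_lebesgue_compact_support[OF K(1) that(2,1)] by (simp add: integral_lebesgue)
    also have "\<dots> = integral (cbox a b) h"
      using ab that by (intro integral_spike_set) (auto intro: negligible_subset[of "{}"])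
    finally show ?thesis .
  qed
  have c': "continuous_on UNIV (k' t)" if "t \<in> {0..1}" for t
  proof -
    have "continuous_on UNIV (\<lambda>x::'a. (t, x))" by (intro continuous_intros)
    then have "continuous_on UNIV (\<lambda>x::'a. (\<lambda>(t, x). k' t x) (t, x))"
      by (rule continuous_on_compose2[OF cont']) (use that in auto)
    then show ?thesis by simp
  qed
  have "((\<lambda>t. integral (cbox a b) (k t)) has_vector_derivative integral (cbox a b) (k' t)) (at t within {0..1})"
  proof (rule leibniz_rule_vector_derivative)
    show "k t integrable_on cbox a b" if "t \<in> {0..1}" for t
      using cont[OF that] by (intro integrable_continuous) (auto intro: continuous_on_subset)
    show "continuous_on ({0..1} \<times> cbox a b) (\<lambda>(t, x). k' t x)"
      using cont' by (rule continuous_on_subset) auto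
  qed (use deriv t in \<open>auto simp: has_real_derivative_iff_has_vector_derivative\<close>)
  then have "((\<lambda>t. integral (cbox a b) (k t)) has_vector_derivative (LINT x|lebesgue. k' t x)) (at t within {0..1})"
    using eq[OF K(3)[OF t] c'[OF t]] by simp
  then have "((\<lambda>t. LINT x|lebesgue. k t x) has_vector_derivative (LINT x|lebesgue. k' t x)) (at t within {0..1})"
    by (rule has_vector_derivative_transform[rotated 2]) (use eq K(2) cont t in auto)
  then show ?thesis by (simp add: has_real_derivative_iff_has_vector_derivative)
qed

lemma integral_translate:
  fixes h :: "'a::euclidean_space \<Rightarrow> real"
  assumes "continuous_on UNIV h"
  shows "(LINT x|lebesgue. h (x + d)) = (LINT x|lebesgue. h x)"
proof -
  have m: "h \<in> borel_measurable borel" using assms by (rule borel_measurable_continuous_onI)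
  have "(LINT x|lborel. h x) = (LINT x|distr lborel borel ((+) d). h x)" by (simp add: lborel_distr_plus)
  also have "\<dots> = (LINT x|lborel. h (d + x))" using m by (subst integral_distr) auto
  finally show ?thesis using m by (simp add: integral_completion add.commute)
qed

text \<open>Translations do not change the integral of \<open>g\<close>. Differentiating in the translation parameter at
  0 gives the claim.\<close>

lemma integral_derivative_eq_0:
  fixes g :: "'a::euclidean_space \<Rightarrow> real"
  assumes "test_function UNIV g"
  shows "(LINT x|lebesgue. frechet_derivative g (at x) d) = 0"
proof -
  obtain K where g: "smooth g" "compact K" "\<And>x. x \<notin> K \<Longrightarrow> g x = 0"
    "\<And>x d. x \<notin> K \<Longrightarrow> frechet_derivative g (at x) d = 0" using test_functionE[OF assms] by metis
  define K' where "K' = (\<lambda>(t, x). x - t *\<^sub>R d) ` ({0..1} \<times> K)"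
  have K': "compact K'" unfolding K'_def using g(2)
    by (intro compact_continuous_image compact_Times) (auto simp: split_beta intro!: continuous_intros)
  have *: "x + t *\<^sub>R d \<notin> K" if "t \<in> {0..1}" "x \<notin> K'" for t x
  proof
    assume "x + t *\<^sub>R d \<in> K"
    then have "(\<lambda>(t, x). x - t *\<^sub>R d) (t, x + t *\<^sub>R d) \<in> K'"
      unfolding K'_def using that(1) by (intro imageI) auto
    then show False using that(2) by simp
  qed
  have "((\<lambda>t. LINT x|lebesgue. g (x + t *\<^sub>R d)) has_real_derivative
      (LINT x|lebesgue. frechet_derivative g (at (x + 0 *\<^sub>R d)) d)) (at 0 within {0..1})"
  proof (rule leibniz_compact_support[OF K', where k' = "\<lambda>t x. frechet_derivative g (at (x + t *\<^sub>R d)) d"])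
    show "((\<lambda>t. g (x + t *\<^sub>R d)) has_real_derivative frechet_derivative g (at (x + t *\<^sub>R d)) d) (at t within {0..1})" for t x
    proof -
      have lin: "bounded_linear (frechet_derivative g (at (x + t *\<^sub>R d)))"
        using smooth_has_derivative[OF g(1)] has_derivative_bounded_linear by blast
      have "((\<lambda>t. g (x + t *\<^sub>R d)) has_derivative (\<lambda>s. frechet_derivative g (at (x + t *\<^sub>R d)) (s *\<^sub>R d))) (at t within {0..1})"
        by (rule has_derivative_compose[OF _ smooth_has_derivative[OF g(1)], where f="\<lambda>t. x + t *\<^sub>R d"])
           (auto intro!: derivative_eq_intros)
      then show ?thesis
        by (simp add: has_field_derivative_def linear_simps(5)[OF lin] mult_commute_abs)
    qed
    show "continuous_on UNIV (\<lambda>x. g (x + t *\<^sub>R d))" for t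
      using smooth_continuous[OF g(1), of UNIV]
      by (rule continuous_on_compose2) (auto intro!: continuous_intros)
    show "continuous_on ({0..1} \<times> UNIV) (\<lambda>(t, x). frechet_derivative g (at (x + t *\<^sub>R d)) d)"
      unfolding split_beta
      by (rule continuous_on_compose2[OF smooth_continuous[OF smooth_frechet_derivative[OF g(1)], of UNIV]])
         (auto intro!: continuous_intros)
  qed (use g * in auto)
  moreover have "(LINT x|lebesgue. g (x + t *\<^sub>R d)) = (LINT x|lebesgue. g x)" for t
    using smooth_continuous[OF g(1)] by (rule integral_translate)
  ultimately have 1: "((\<lambda>t::real. LINT x|lebesgue. g x) has_vector_derivative (LINT x|lebesgue. frechet_derivative g (at x) d)) (at 0 within cbox 0 1)"
    by (simp add: has_real_derivative_iff_has_vector_derivative)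
  have 2: "((\<lambda>t::real. LINT x|lebesgue. g x) has_vector_derivative 0) (at 0 within cbox 0 1)"
    by simp
  show ?thesis by (rule vector_derivative_unique_within_closed_interval[OF _ _ 1 2]) auto
qed

definition grad :: "('a::euclidean_space \<Rightarrow> real) \<Rightarrow> 'a \<Rightarrow> 'a" where
  "grad f x = (\<Sum>b\<in>Basis. frechet_derivative f (at x) b *\<^sub>R b)"

lemma grad_inner:
  assumes "smooth f" shows "grad f x \<bullet> d = frechet_derivative f (at x) d"
proof -
  interpret bounded_linear "frechet_derivative f (at x)"
    using smooth_has_derivative[OF assms] has_derivative_bounded_linear by blast
  have "frechet_derivative f (at x) d = frechet_derivative f (at x) (\<Sum>b\<in>Basis. (d \<bullet> b) *\<^sub>R b)"
    by (simp add: euclidean_representation)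
  also have "\<dots> = (\<Sum>b\<in>Basis. (d \<bullet> b) * frechet_derivative f (at x) b)"
    by (simp add: sum scaleR)
  finally show ?thesis
    by (simp add: grad_def inner_sum_left inner_commute[of d] mult.commute)
qed

text \<open>The derivative is evaluated at the gradient vector itself.\<close>

lemma norm_grad_le:
  assumes "smooth f" "\<And>d. \<bar>frechet_derivative f (at x) d\<bar> \<le> M * norm d"
  shows "norm (grad f x) \<le> M"
proof -
  have "norm (grad f x) * norm (grad f x) = grad f x \<bullet> grad f x"
    by (simp add: power2_norm_eq_inner flip: power2_eq_square)
  also have "\<dots> \<le> M * norm (grad f x)"
    using assms(2)[of "grad f x"] grad_inner[OF assms(1)] by simp
  finally have *: "norm (grad f x) * norm (grad f x) \<le> M * norm (grad f x)" .
  obtain b :: 'a where "b \<in> Basis" using nonempty_Basis by blast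
  then have "0 \<le> M" using assms(2)[of b] abs_ge_zero[of "frechet_derivative f (at x) b"] by simp
  then show ?thesis using * by (cases "norm (grad f x) = 0") (auto dest: mult_right_le_imp_le)
qed

lemma continuous_grad: "smooth f \<Longrightarrow> continuous_on S (grad f)"
  unfolding grad_def by (intro continuous_intros smooth_continuous smooth_frechet_derivative)

lemma test_function_mult_right:
  assumes "test_function U f" "smooth g" shows "test_function U (\<lambda>x. f x * g x)"
proof -
  obtain K where K: "smooth f" "compact K" "K \<subseteq> U" "\<And>x. x \<notin> K \<Longrightarrow> f x = 0"
    using test_functionE[OF assms(1)] by metis
  show ?thesis by (rule test_functionI[of _ K]) (use K assms in \<open>auto intro: smooth_intros\<close>)
qed

lemma loc_integrable_continuous:
  fixes f :: "'a::euclidean_space \<Rightarrow> 'b::euclidean_space"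
  assumes "continuous_on U f" shows "loc_integrable U f"
  unfolding loc_integrable_def
proof (intro allI impI, elim conjE)
  fix K assume K: "compact K" "K \<subseteq> U"
  have "integrable lborel (\<lambda>x. indicator K x *\<^sub>R f x)"
    using K assms by (intro borel_integrable_compact) (auto intro: continuous_on_subset)
  then show "f absolutely_integrable_on K"
    unfolding set_integrable_def by (simp add: integrable_completion)
qed

text \<open>Integration by parts: the derivatives of the product \<open>\<eta> f\<close> have integral zero.\<close>

lemma has_weak_gradient_grad:
  assumes f: "test_function U f"
  shows "has_weak_gradient U f (grad f)"
  unfolding has_weak_gradient_def
proof (intro conjI allI impI ballI)
  have sf: "smooth f" using test_functionE[OF f] by metis
  then show "loc_integrable U f" "loc_integrable U (grad f)"
    by (auto intro!: loc_integrable_continuous smooth_continuous continuous_grad)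
  fix \<eta> :: "'a \<Rightarrow> real" and b :: 'a assume \<eta>: "test_function U \<eta>" and "b \<in> Basis"
  obtain K where K: "smooth \<eta>" "compact K" "K \<subseteq> U" "\<And>x. x \<notin> K \<Longrightarrow> \<eta> x = 0"
    "\<And>x d. x \<notin> K \<Longrightarrow> frechet_derivative \<eta> (at x) d = 0"
    using test_functionE[OF \<eta>] by metis
  have "((\<lambda>x. \<eta> x * f x) has_derivative
      (\<lambda>d. \<eta> x * frechet_derivative f (at x) d + frechet_derivative \<eta> (at x) d * f x)) (at x)" for x
    using sf K(1) by (intro has_derivative_mult smooth_has_derivative)
  then have D: "frechet_derivative (\<lambda>x. \<eta> x * f x) (at x) =
      (\<lambda>d. \<eta> x * frechet_derivative f (at x) d + frechet_derivative \<eta> (at x) d * f x)" for x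
    by (rule frechet_derivative_at[symmetric])
  have "(LINT x|lebesgue. frechet_derivative (\<lambda>x. \<eta> x * f x) (at x) b) = 0"
    using test_function_mono[OF test_function_mult_right[OF \<eta> sf]] by (intro integral_derivative_eq_0) auto
  moreover have "integrable lebesgue (\<lambda>x. \<eta> x * frechet_derivative f (at x) b)"
    "integrable lebesgue (\<lambda>x. frechet_derivative \<eta> (at x) b * f x)"
    using K sf by (auto intro!: integrable_lebesgue_compact_support[of K] continuous_intros
        smooth_continuous smooth_intros)
  ultimately have "(LINT x|lebesgue. \<eta> x * frechet_derivative f (at x) b)
      + (LINT x|lebesgue. frechet_derivative \<eta> (at x) b * f x) = 0"
    unfolding D by simp
  moreover have "(LINT x:U|lebesgue. f x * frechet_derivative \<eta> (at x) b)
      = (LINT x|lebesgue. frechet_derivative \<eta> (at x) b * f x)"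
    by (subst set_integral_eq_UNIV) (use K in \<open>auto simp: mult.commute\<close>)
  moreover have "(LINT x:U|lebesgue. (grad f x \<bullet> b) * \<eta> x)
      = (LINT x|lebesgue. \<eta> x * frechet_derivative f (at x) b)"
    by (subst set_integral_eq_UNIV) (use K sf in \<open>auto simp: mult.commute grad_inner\<close>)
  ultimately show "(LINT x:U|lebesgue. f x * frechet_derivative \<eta> (at x) b)
          = - (LINT x:U|lebesgue. (grad f x \<bullet> b) * \<eta> x)" by linarith
qed

section \<open>Uniqueness and locality of weak gradients\<close>

lemma smooth_measurable: "smooth f \<Longrightarrow> f \<in> borel_measurable lebesgue"
  using borel_measurable_continuous_onI[OF smooth_continuous[of f UNIV]]
  by (intro measurable_completion) simp

text \<open>As \<open>k\<close> grows, each factor tends to the indicator function of an open half-space while vanishing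
  outside it, so the product approximates the indicator function of the open box with support in
  the closed box.\<close>

definition box_cutoff :: "'a::euclidean_space \<Rightarrow> 'a \<Rightarrow> nat \<Rightarrow> 'a \<Rightarrow> real" where
  "box_cutoff c d k x = (\<Prod>b\<in>Basis. step (real k * (x \<bullet> b - c \<bullet> b)) * step (real k * (d \<bullet> b - x \<bullet> b)))"

lemma box_cutoff_outside: "x \<notin> box c d \<Longrightarrow> box_cutoff c d k x = 0"
  unfolding box_cutoff_def
proof (rule prod_zero)
  assume "x \<notin> box c d"
  then obtain b where b: "b \<in> Basis" "x \<bullet> b \<le> c \<bullet> b \<or> d \<bullet> b \<le> x \<bullet> b"
    by (auto simp: mem_box not_less)
  then have "real k * (x \<bullet> b - c \<bullet> b) \<le> 0 \<or> real k * (d \<bullet> b - x \<bullet> b) \<le> 0"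
    by (auto intro: mult_nonneg_nonpos)
  then show "\<exists>b\<in>Basis. step (real k * (x \<bullet> b - c \<bullet> b)) * step (real k * (d \<bullet> b - x \<bullet> b)) = 0"
    using b(1) step_eq_0 by (metis mult_eq_0_iff)
qed simp

lemma box_cutoff_bounds: "0 \<le> box_cutoff c d k x" "box_cutoff c d k x \<le> 1"
  unfolding box_cutoff_def
  by (auto intro!: prod_nonneg prod_le_1 mult_nonneg_nonneg mult_le_one simp: step_nonneg step_le_1)

lemma box_cutoff_tendsto: "(\<lambda>k. box_cutoff c d k x) \<longlonglongrightarrow> indicator (box c d) x"
proof (cases "x \<in> box c d")
  case True
  have step1: "\<forall>\<^sub>F k in sequentially. step (real k * s) = 1" if "s > 0" for s
  proof -
    have "\<forall>\<^sub>F k in sequentially. 1 / s \<le> real k" by (rule eventually_sequentiallyI[of "nat \<lceil>1 / s\<rceil>"]) linarith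
    then show ?thesis by eventually_elim (use that in \<open>auto intro!: step_eq_1 simp: field_simps\<close>)
  qed
  have "\<forall>\<^sub>F k in sequentially. \<forall>b\<in>Basis. step (real k * (x \<bullet> b - c \<bullet> b)) = 1 \<and> step (real k * (d \<bullet> b - x \<bullet> b)) = 1"
    using True by (intro eventually_ball_finite ballI eventually_conj step1) (auto simp: mem_box)
  then have "\<forall>\<^sub>F k in sequentially. box_cutoff c d k x = 1"
    by eventually_elim (simp add: box_cutoff_def)
  then show ?thesis using True by (simp add: tendsto_eventually)
next
  case False
  then show ?thesis by (simp add: box_cutoff_outside)
qed

lemma test_function_box_cutoff:
  assumes "cbox c d \<subseteq> U" shows "test_function U (box_cutoff c d k)"
proof (rule test_functionI)
  show "smooth (box_cutoff c d k)" unfolding box_cutoff_def by (intro smooth_intros)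
  show "box_cutoff c d k x = 0" if "x \<notin> cbox c d" for x
    using that box_subset_cbox[of c d] by (auto intro: box_cutoff_outside)
qed (use assms in auto)

text \<open>The fundamental lemma of the calculus of variations. Approximating indicator functions of boxes
  by test functions shows that \<open>g\<close> has integral zero over every box in \<open>U\<close>. Almost every value of \<open>g\<close>
  is a limit of mean values over shrinking boxes, hence zero.\<close>

lemma AE_eq_0_if_integral_test_function_eq_0:
  fixes g :: "'a::euclidean_space \<Rightarrow> real"
  assumes U: "open U" and g: "loc_integrable U g"
    and zero: "\<And>\<eta>. test_function U \<eta> \<Longrightarrow> (LINT x|lebesgue. g x * \<eta> x) = 0"
  shows "AE x in lebesgue. x \<in> U \<longrightarrow> g x = 0"
proof -
  have box0: "integral (cbox c d) g = 0" and boxi: "g absolutely_integrable_on cbox c d"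
    if cd: "cbox c d \<subseteq> U" for c d
  proof -
    show gi: "g absolutely_integrable_on cbox c d"
      using g cd unfolding loc_integrable_def by auto
    \<comment> \<open>The dominating function \<open>\<bar>?g\<bar>\<close> is integrable because \<open>cbox c d\<close> is a compact subset of \<open>U\<close>.\<close>
    let ?g = "\<lambda>x. indicator (cbox c d) x * g x"
    have gi': "integrable lebesgue ?g" using gi by (simp add: set_integrable_def)
    have bm: "box_cutoff c d k \<in> borel_measurable lebesgue" for k
      using test_functionE[OF test_function_box_cutoff[OF cd]] by (metis smooth_measurable)
    have "(\<lambda>k. LINT x|lebesgue. ?g x * box_cutoff c d k x) \<longlonglongrightarrow> (LINT x|lebesgue. ?g x * indicator (box c d) x)"
    proof (rule integral_dominated_convergence[where w = "\<lambda>x. \<bar>?g x\<bar>"])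
      show "(\<lambda>x. ?g x * indicator (box c d) x) \<in> borel_measurable lebesgue"
        by (intro borel_measurable_times[OF borel_measurable_integrable[OF gi']] borel_measurable_indicator) simp
      show "(\<lambda>x. ?g x * box_cutoff c d k x) \<in> borel_measurable lebesgue" for k
        by (intro borel_measurable_times[OF borel_measurable_integrable[OF gi']] bm)
      show "integrable lebesgue (\<lambda>x. \<bar>?g x\<bar>)" using gi' by (rule integrable_abs)
      show "AE x in lebesgue. norm (?g x * box_cutoff c d k x) \<le> \<bar>?g x\<bar>" for k
        by (rule AE_I2) (auto simp: abs_mult box_cutoff_bounds intro!: mult_right_le_one_le)
      show "AE x in lebesgue. (\<lambda>k. ?g x * box_cutoff c d k x) \<longlonglongrightarrow> ?g x * indicator (box c d) x"
        by (intro AE_I2 tendsto_mult_left box_cutoff_tendsto)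
    qed
    moreover have "?g x * box_cutoff c d k x = g x * box_cutoff c d k x" for k x
      using box_cutoff_outside[of x c d k] box_subset_cbox[of c d] by (auto simp: indicator_def)
    moreover have "(LINT x|lebesgue. g x * box_cutoff c d k x) = 0" for k
      using zero test_function_box_cutoff[OF cd] by blast
    ultimately have "(LINT x|lebesgue. ?g x * indicator (box c d) x) = 0"
      using LIMSEQ_unique[OF _ tendsto_const] by simp
    moreover have "?g x * indicator (box c d) x = indicator (box c d) x *\<^sub>R g x" for x
      using box_subset_cbox[of c d] by (auto simp: indicator_def)
    moreover have "g absolutely_integrable_on box c d"
      using gi box_subset_cbox by (metis set_integrable_subset fmeasurableD lmeasurable_box sets_completionI_sets sets_lborel)
    ultimately have "integral (box c d) g = 0"
      by (simp add: set_lebesgue_integral_eq_integral(2)[symmetric] set_lebesgue_integral_def)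
    then show "integral (cbox c d) g = 0"
      by (metis integral_open_interval)
  qed
  \<comment> \<open>Restricted to a single box and extended by zero, \<open>g\<close> can be integrated over every box of the space.\<close>
  have box_AE: "AE x in lebesgue. x \<in> cbox c d \<longrightarrow> g x = 0" if cd: "cbox c d \<subseteq> U" for c d
  proof -
    let ?G = "\<lambda>x. if x \<in> cbox c d then g x else 0"
    have int0: "(?G has_integral 0) (cbox a b)" for a b
    proof -
      obtain c' d' where e: "cbox c d \<inter> cbox a b = cbox c' d'"
        using Int_interval[of c d a b] that by blast
      have "cbox c' d' \<subseteq> U" using e cd by blast
      then have "(g has_integral 0) (cbox c' d')"
        using integrable_integral[OF set_lebesgue_integral_eq_integral(1)[OF boxi]] box0 by simp
      then show ?thesis unfolding has_integral_restrict_Int e .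
    qed
    obtain N where N: "negligible N" and lim: "\<And>x e. \<lbrakk>x \<notin> N; 0 < e\<rbrakk> \<Longrightarrow>
        \<exists>\<delta>>0. \<forall>h. 0 < h \<and> h < \<delta> \<longrightarrow>
           norm (integral (cbox x (x + h *\<^sub>R One)) ?G /\<^sub>R h ^ DIM('a) - ?G x) < e"
      using integrable_ccontinuous_explicit[of ?G] has_integral_integrable[OF int0] by blast
    have "?G x = 0" if "x \<notin> N" for x
    proof (rule ccontr)
      assume "?G x \<noteq> 0"
      then obtain \<delta> where "\<delta> > 0" and *: "\<And>h. 0 < h \<and> h < \<delta> \<Longrightarrow>
           norm (integral (cbox x (x + h *\<^sub>R One)) ?G /\<^sub>R h ^ DIM('a) - ?G x) < norm (?G x)"
        using lim[OF \<open>x \<notin> N\<close>, of "norm (?G x)"] by auto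
      show False using *[of "\<delta>/2"] \<open>\<delta> > 0\<close> integral_unique[OF int0] by simp
    qed
    then have "{x \<in> space lebesgue. \<not> (x \<in> cbox c d \<longrightarrow> g x = 0)} \<subseteq> N"
      by (auto split: if_splits) meson
    then show ?thesis
      using N unfolding negligible_iff_null_sets by (intro AE_I'[of N])
  qed
  obtain \<D> where D: "countable \<D>" "\<D> \<subseteq> Pow U" "\<And>X. X \<in> \<D> \<Longrightarrow> \<exists>a b. X = cbox a b" "\<Union>\<D> = U"
    using open_countable_Union_open_cbox[OF U] by metis
  have "AE x in lebesgue. \<forall>X\<in>\<D>. x \<in> X \<longrightarrow> g x = 0"
    unfolding AE_ball_countable[OF D(1)]
  proof
    fix X assume X: "X \<in> \<D>"
    then obtain a b where "X = cbox a b" using D(3) by blast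
    then show "AE x in lebesgue. x \<in> X \<longrightarrow> g x = 0" using box_AE[of a b] X D(2) by blast
  qed
  then show ?thesis by (rule AE_mp) (use D(4) in \<open>blast intro: AE_I2\<close>)
qed

lemma integrable_times_compact_support:
  fixes h \<zeta> :: "'a::euclidean_space \<Rightarrow> real"
  assumes K: "compact K" "K \<subseteq> U" and h: "loc_integrable U h"
    and \<zeta>: "smooth \<zeta>" "\<And>x. x \<notin> K \<Longrightarrow> \<zeta> x = 0"
  shows "integrable lebesgue (\<lambda>x. h x * \<zeta> x)"
proof -
  have hi: "integrable lebesgue (\<lambda>x. indicator K x * h x)"
    using h K unfolding loc_integrable_def set_integrable_def by auto
  have "bounded (\<zeta> ` UNIV)"
  proof -
    have "compact (\<zeta> ` K)" using K(1) \<zeta>(1) by (intro compact_continuous_image smooth_continuous)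
    then have "bounded (insert 0 (\<zeta> ` K))" by (simp add: compact_imp_bounded)
    then show ?thesis by (rule bounded_subset) (use \<zeta>(2) in auto)
  qed
  then obtain M where M: "\<And>x. \<bar>\<zeta> x\<bar> \<le> M" unfolding bounded_iff by auto
  have "integrable lebesgue (\<lambda>x. indicator K x * h x * \<zeta> x)"
  proof (rule Bochner_Integration.integrable_bound)
    show "integrable lebesgue (\<lambda>x. (indicator K x * h x) * M)" using hi by simp
    show "(\<lambda>x. indicator K x * h x * \<zeta> x) \<in> borel_measurable lebesgue"
      by (intro borel_measurable_times[OF borel_measurable_integrable[OF hi]] smooth_measurable \<zeta>(1))
    show "AE x in lebesgue. norm (indicator K x * h x * \<zeta> x) \<le> norm (indicator K x * h x * M)"
      using order_trans[OF M abs_ge_self]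
      by (intro AE_I2) (simp add: abs_mult mult_left_mono)
  qed
  then show ?thesis
    by (rule Bochner_Integration.integrable_cong[THEN iffD1, rotated -1]) (use \<zeta> in \<open>auto simp: indicator_def\<close>)
qed

text \<open>Tested against functions supported in \<open>U\<close>, the two weak gradients give the same integrals: the
  constant \<open>c\<close> drops out because derivatives of test functions have integral zero. With \<open>f1 = f2\<close>
  this is uniqueness; with \<open>c\<close> varying from piece to piece it identifies the gradient of a function
  that is only piecewise a translate of another one.\<close>

lemma weak_gradient_local:
  fixes f1 f2 :: "'a::euclidean_space \<Rightarrow> real"
  assumes U: "open U" "U \<subseteq> \<Omega>1" "U \<subseteq> \<Omega>2"
    and w: "has_weak_gradient \<Omega>1 f1 G1" "has_weak_gradient \<Omega>2 f2 G2"
    and eq: "\<And>x. x \<in> U \<Longrightarrow> f1 x = f2 x + c"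
  shows "AE x in lebesgue. x \<in> U \<longrightarrow> G1 x = G2 x"
proof -
  have comp: "AE x in lebesgue. x \<in> U \<longrightarrow> G1 x \<bullet> b - G2 x \<bullet> b = 0" if b: "b \<in> Basis" for b
  proof (rule AE_eq_0_if_integral_test_function_eq_0[OF U(1)])
    have li: "loc_integrable U (\<lambda>x. G x \<bullet> b)" if "loc_integrable \<Omega> G" "U \<subseteq> \<Omega>" for \<Omega> and G :: "'a \<Rightarrow> 'a"
      using that b unfolding loc_integrable_def by (auto intro: absolutely_integrable_component)
    then have l1: "loc_integrable U (\<lambda>x. G1 x \<bullet> b)" and l2: "loc_integrable U (\<lambda>x. G2 x \<bullet> b)"
      using w U unfolding has_weak_gradient_def by blast+
    then show "loc_integrable U (\<lambda>x. G1 x \<bullet> b - G2 x \<bullet> b)"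
      unfolding loc_integrable_def by (auto intro: set_integral_diff)
    fix \<eta> :: "'a \<Rightarrow> real" assume \<eta>: "test_function U \<eta>"
    obtain K where K: "smooth \<eta>" "compact K" "K \<subseteq> U" "\<And>x. x \<notin> K \<Longrightarrow> \<eta> x = 0"
      "\<And>x d. x \<notin> K \<Longrightarrow> frechet_derivative \<eta> (at x) d = 0"
      using test_functionE[OF \<eta>] by metis
    note int = integrable_times_compact_support[OF K(2,3)]
    have wk: "(LINT x|lebesgue. f x * frechet_derivative \<eta> (at x) b) = - (LINT x|lebesgue. (G x \<bullet> b) * \<eta> x)"
      if "has_weak_gradient \<Omega> f G" "U \<subseteq> \<Omega>" for \<Omega> f G
    proof -
      have outK: "x \<notin> K" if "x \<notin> \<Omega>" for x using that K(3) \<open>U \<subseteq> \<Omega>\<close> by blast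
      have "(LINT x:\<Omega>|lebesgue. f x * frechet_derivative \<eta> (at x) b)
          = - (LINT x:\<Omega>|lebesgue. (G x \<bullet> b) * \<eta> x)"
        using that b test_function_mono[OF \<eta>] unfolding has_weak_gradient_def by auto
      moreover have "(LINT x:\<Omega>|lebesgue. f x * frechet_derivative \<eta> (at x) b)
          = (LINT x|lebesgue. f x * frechet_derivative \<eta> (at x) b)"
        by (rule set_integral_eq_UNIV) (use outK K(4,5) in simp)
      moreover have "(LINT x:\<Omega>|lebesgue. (G x \<bullet> b) * \<eta> x) = (LINT x|lebesgue. (G x \<bullet> b) * \<eta> x)"
        by (rule set_integral_eq_UNIV) (use outK K(4,5) in simp)
      ultimately show ?thesis by simp
    qed
    have "(LINT x|lebesgue. f1 x * frechet_derivative \<eta> (at x) b)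
        = (LINT x|lebesgue. f2 x * frechet_derivative \<eta> (at x) b + c * frechet_derivative \<eta> (at x) b)"
    proof (rule Bochner_Integration.integral_cong)
      show "f1 x * frechet_derivative \<eta> (at x) b
          = f2 x * frechet_derivative \<eta> (at x) b + c * frechet_derivative \<eta> (at x) b" for x
        using K(3) K(5)[of x] eq[of x] by (cases "x \<in> K") (auto simp: algebra_simps)
    qed simp
    also have "\<dots> = (LINT x|lebesgue. f2 x * frechet_derivative \<eta> (at x) b)
         + (LINT x|lebesgue. c * frechet_derivative \<eta> (at x) b)"
    proof (rule Bochner_Integration.integral_add)
      have "loc_integrable U f2" using w(2) U(3) unfolding has_weak_gradient_def loc_integrable_def by auto
      then show "integrable lebesgue (\<lambda>x. f2 x * frechet_derivative \<eta> (at x) b)"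
        using K by (intro int smooth_intros) auto
      show "integrable lebesgue (\<lambda>x. c * frechet_derivative \<eta> (at x) b)"
        using K by (intro integrable_lebesgue_compact_support[of K] continuous_intros smooth_continuous smooth_intros) auto
    qed
    also have "(LINT x|lebesgue. c * frechet_derivative \<eta> (at x) b) = 0"
      using integral_derivative_eq_0[of \<eta> b] test_function_mono[OF \<eta>] by simp
    finally have "(LINT x|lebesgue. (G1 x \<bullet> b) * \<eta> x) = (LINT x|lebesgue. (G2 x \<bullet> b) * \<eta> x)"
      using wk[OF w(1) U(2)] wk[OF w(2) U(3)] by simp
    moreover have "(LINT x|lebesgue. (G1 x \<bullet> b - G2 x \<bullet> b) * \<eta> x)
       = (LINT x|lebesgue. (G1 x \<bullet> b) * \<eta> x) - (LINT x|lebesgue. (G2 x \<bullet> b) * \<eta> x)"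
      using int[OF l1 K(1,4)] int[OF l2 K(1,4)]
      by (simp add: left_diff_distrib)
    ultimately show "(LINT x|lebesgue. (G1 x \<bullet> b - G2 x \<bullet> b) * \<eta> x) = 0" by simp
  qed
  have "AE x in lebesgue. \<forall>b\<in>Basis. x \<in> U \<longrightarrow> G1 x \<bullet> b - G2 x \<bullet> b = 0"
    using comp by (subst AE_ball_countable) (auto intro: countable_finite)
  then show ?thesis
  proof eventually_elim
    case (elim x)
    then have "G1 x \<bullet> b = G2 x \<bullet> b" if "x \<in> U" "b \<in> Basis" for b using that by force
    then show ?case by (blast intro: euclidean_eqI)
  qed
qed

lemma has_weak_gradient_weak_gradient:
  "has_weak_gradient \<Omega> f G \<Longrightarrow> has_weak_gradient \<Omega> f (weak_gradient \<Omega> f)"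
  unfolding weak_gradient_def by (rule someI[of "has_weak_gradient \<Omega> f"])

lemma L1_has_weak_gradient: "f \<in> L1 p \<Omega> \<Longrightarrow> has_weak_gradient \<Omega> f (weak_gradient \<Omega> f)"
  by (auto simp: L1_def dest: has_weak_gradient_weak_gradient)

text \<open>By uniqueness the chosen weak gradient is the classical one almost everywhere. The value of the
  seminorm does not involve \<open>A\<close>, so it is the same in every open set containing the support.\<close>

lemma test_function_L1:
  fixes f :: "'a::euclidean_space \<Rightarrow> real"
  assumes f: "test_function A f" and A: "open A" and p: "p > 0"
  shows "f \<in> L1 p A"
    and "(LINT x:A|lebesgue. norm (weak_gradient A f x) powr p) = (LINT x|lebesgue. norm (grad f x) powr p)"
    and "integrable lebesgue (\<lambda>x. norm (grad f x) powr p)"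
proof -
  obtain K where K: "smooth f" "compact K" "K \<subseteq> A" "\<And>x. x \<notin> K \<Longrightarrow> f x = 0"
    "\<And>x d. x \<notin> K \<Longrightarrow> frechet_derivative f (at x) d = 0"
    using test_functionE[OF f] by metis
  have g0: "grad f x = 0" if "x \<notin> K" for x using K that by (simp add: grad_def)
  have w: "has_weak_gradient A f (grad f)" using f by (rule has_weak_gradient_grad)
  have ae: "AE x in lebesgue. x \<in> A \<longrightarrow> weak_gradient A f x = grad f x"
    by (rule weak_gradient_local[OF A _ _ has_weak_gradient_weak_gradient[OF w] w, of 0]) auto
  show i: "integrable lebesgue (\<lambda>x. norm (grad f x) powr p)"
  proof (rule integrable_lebesgue_compact_support[OF K(2)])
    show "continuous_on UNIV (\<lambda>x. norm (grad f x) powr p)"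
      using p by (intro continuous_on_powr' continuous_intros continuous_grad K(1)) auto
  qed (use g0 in simp)
  have ae': "AE x in lebesgue. indicator A x *\<^sub>R norm (grad f x) powr p = indicator A x *\<^sub>R norm (weak_gradient A f x) powr p"
    using ae by eventually_elim (auto simp: indicator_def)
  have e: "indicator A x *\<^sub>R norm (grad f x) powr p = norm (grad f x) powr p" for x
    using g0[of x] K(3) by (auto simp: indicator_def)
  have m: "(\<lambda>x. indicator A x *\<^sub>R norm (weak_gradient A f x) powr p) \<in> borel_measurable lebesgue"
    by (rule borel_measurable_AE[OF _ ae']) (simp only: e borel_measurable_integrable[OF i])
  show "f \<in> L1 p A"
    unfolding L1_def set_integrable_def
    using w integrable_cong_AE_imp[OF i m ae'[unfolded e]] by blast
  show "(LINT x:A|lebesgue. norm (weak_gradient A f x) powr p) = (LINT x|lebesgue. norm (grad f x) powr p)"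
    unfolding set_lebesgue_integral_def
    using integral_cong_AE[OF borel_measurable_integrable[OF i] m ae'[unfolded e]] by simp
qed

section \<open>Smooth cutoffs and the competitors for \<open>Phi\<close>\<close>

text \<open>A finite sum of bumps supported in balls inside \<open>A\<close> is positive on \<open>K\<close>, hence at least some \<open>m > 0\<close>
  there. Dividing by \<open>m\<close> and applying \<^const>\<open>step\<close> makes it constant on \<open>K\<close>.\<close>

lemma smooth_cutoff_exists:
  fixes K :: "'a::euclidean_space set"
  assumes K: "compact K" and A: "open A" "K \<subseteq> A"
  obtains \<psi> where "test_function A \<psi>" "\<And>x. x \<in> K \<Longrightarrow> \<psi> x = 1" "\<And>x. 0 \<le> \<psi> x" "\<And>x. \<psi> x \<le> 1"
proof (cases "K = {}")
  case True
  have "test_function A (\<lambda>x. 0)" by (rule test_functionI[of _ "{}"]) (auto intro: smooth_intros)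
  then show ?thesis using that[of "\<lambda>x. 0"] True by auto
next
  case False
  have "\<exists>\<rho>>0. cball w \<rho> \<subseteq> A" if "w \<in> K" for w
    using that A open_contains_cball by blast
  then obtain \<rho> where \<rho>: "\<And>w. w \<in> K \<Longrightarrow> \<rho> w > 0 \<and> cball w (\<rho> w) \<subseteq> A" by metis
  obtain W where W: "W \<subseteq> K" "finite W" "K \<subseteq> (\<Union>w\<in>W. ball w (\<rho> w))"
    by (rule compactE_image[OF K, of K "\<lambda>w. ball w (\<rho> w)"]) (use \<rho> in \<open>auto intro: centre_in_ball[THEN iffD2]\<close>)
  define g where "g x = (\<Sum>w\<in>W. flat 0 ((\<rho> w)\<^sup>2 - (norm (x - w))\<^sup>2))" for x
  have sg: "smooth g" unfolding g_def by (intro smooth_intros)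
  have pos: "g x > 0" if x: "x \<in> K" for x
  proof -
    obtain w where w: "w \<in> W" "x \<in> ball w (\<rho> w)" using W(3) x by blast
    have "flat 0 ((\<rho> w)\<^sup>2 - (norm (x - w))\<^sup>2) > 0"
      using w(2) by (simp add: flat_0_pos_iff dist_norm norm_minus_commute power_strict_mono)
    then show ?thesis unfolding g_def
      using W(2) w(1) by (intro sum_pos2) (auto simp: flat_0_nonneg)
  qed
  obtain x0 where x0: "x0 \<in> K" "\<And>x. x \<in> K \<Longrightarrow> g x0 \<le> g x"
    using continuous_attains_inf[OF K False smooth_continuous[OF sg]] by blast
  define m where "m = g x0"
  have m: "m > 0" "\<And>x. x \<in> K \<Longrightarrow> m \<le> g x" using pos x0 by (auto simp: m_def)
  let ?L = "\<Union>w\<in>W. cball w (\<rho> w)"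
  have out: "g x = 0" if "x \<notin> ?L" for x
  proof -
    have "(\<rho> w)\<^sup>2 \<le> (norm (x - w))\<^sup>2" if "w \<in> W" for w
      using \<open>x \<notin> ?L\<close> that \<rho>[of w] W(1)
      by (intro power_mono) (auto simp: dist_norm norm_minus_commute not_le intro: less_imp_le)
    then show ?thesis unfolding g_def by (intro sum.neutral) (simp add: flat_0_eq_0_iff)
  qed
  show ?thesis
  proof (rule that[of "\<lambda>x. step (g x / m)"])
    show "test_function A (\<lambda>x. step (g x / m))"
    proof (rule test_functionI)
      show "smooth (\<lambda>x. step (g x / m))" using m(1) by (intro smooth_intros sg) auto
      show "compact ?L" using W(2) by (intro compact_UN) auto
      show "?L \<subseteq> A" using \<rho> W(1) by blast
      show "step (g x / m) = 0" if "x \<notin> ?L" for x using out[OF that] by (simp add: step_eq_0)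
    qed
    show "step (g x / m) = 1" if "x \<in> K" for x
      using m(1) m(2)[OF that] by (intro step_eq_1) (simp add: field_simps)
  qed (auto simp: step_nonneg step_le_1)
qed

lemma bounded_grad_test_function:
  fixes f :: "'a::euclidean_space \<Rightarrow> real"
  assumes "test_function A f"
  obtains M where "M \<ge> 0" "\<And>x. norm (grad f x) \<le> M"
proof -
  obtain K where K: "smooth f" "compact K" "\<And>x d. x \<notin> K \<Longrightarrow> frechet_derivative f (at x) d = 0"
    using test_functionE[OF assms] by metis
  have "compact (grad f ` K)" using K by (intro compact_continuous_image continuous_grad)
  then obtain M where M: "\<And>x. x \<in> K \<Longrightarrow> norm (grad f x) \<le> M"
    using compact_imp_bounded bounded_iff by (metis image_eqI)
  have "norm (grad f x) \<le> max M 0" for x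
    using M[of x] K(3)[of x] by (cases "x \<in> K") (auto simp: grad_def)
  then show ?thesis using that[of "max M 0"] by simp
qed

lemma capacity_empty:
  assumes "p > 0" shows "capacity p ({} :: 'a::euclidean_space set) = 0"
proof -
  have t: "test_function UNIV (\<lambda>x::'a. 0)" by (rule test_functionI[of _ "{}"]) (auto intro: smooth_intros)
  have g: "grad (\<lambda>x::'a. 0) = (\<lambda>x. 0)" by (simp add: grad_def fun_eq_iff)
  have s: "L1_seminorm p UNIV (\<lambda>x::'a. 0) = 0"
    unfolding L1_seminorm_def test_function_L1(2)[OF t open_UNIV assms] g by simp
  have "capacity p ({} :: 'a set) \<le> ennreal ((LINT x|lebesgue. \<bar>0::real\<bar> powr p) + L1_seminorm p UNIV (\<lambda>x::'a. 0) powr p)"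
    unfolding capacity_def
    by (rule INF_lower2[of "\<lambda>x. 0"]) (use test_function_L1(1)[OF t open_UNIV assms] in auto)
  then show ?thesis by (simp add: s)
qed

text \<open>Continuity allows the domain of definition to be all of \<open>A\<close> and the exceptional sets to be empty.\<close>

lemma L1_representative_test_function:
  assumes "test_function A f" "open A" "p > 0"
  shows "L1_representative p A A f"
proof -
  have "smooth f" using test_functionE[OF assms(1)] by metis
  then show ?thesis
    unfolding L1_representative_def using test_function_L1(1)[OF assms] capacity_empty[OF assms(3)]
    by (auto intro!: exI[of _ "{}"] smooth_continuous)
qed

lemma composition_in_L1:
  assumes "bounded_composition_operator p q \<Omega> \<Omega>' \<phi>" "open \<Omega>'" "p > 0" "test_function \<Omega>' f"
  shows "f \<circ> \<phi> \<in> L1 q \<Omega>"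
  using assms L1_representative_test_function unfolding bounded_composition_operator_def by blast

text \<open>This is the definition of \<^const>\<open>Phi_tilde\<close>, solved for the gradient of the composition. Functions
  with vanishing seminorm are excluded from the supremum; for them the boundedness of the
  composition operator makes the left-hand side zero.\<close>

lemma gradient_bound_by_Phi_tilde:
  fixes f :: "'a::euclidean_space \<Rightarrow> real"
  assumes bco: "bounded_composition_operator p q \<Omega> \<Omega>' \<phi>" and \<Omega>': "open \<Omega>'"
    and pq: "0 < q" "q < p"
    and A: "open A" "A \<subseteq> \<Omega>'" and f: "test_function A f"
    and fin: "Phi_tilde p q \<Omega> \<phi> A < \<infinity>"
  shows "(LINT x:\<Omega>|lebesgue. norm (weak_gradient \<Omega> (f \<circ> \<phi>) x) powr q)
      \<le> enn2real (Phi_tilde p q \<Omega> \<phi> A) powr ((p - q) / p)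
         * (LINT x|lebesgue. norm (grad f x) powr p) powr (q / p)" (is "?I \<le> ?P powr _ * ?J powr _")
proof -
  have p: "p > 0" using pq by simp
  have f': "test_function \<Omega>' f" using f A(2) by (rule test_function_mono)
  have I: "?I \<ge> 0" unfolding set_lebesgue_integral_def by (rule integral_nonneg_AE) auto
  have J: "?J \<ge> 0" by (rule integral_nonneg_AE) auto
  define S N where "S = L1_seminorm q \<Omega> (f \<circ> \<phi>)" and "N = L1_seminorm p A f"
  have S: "S = ?I powr (1 / q)" unfolding S_def L1_seminorm_def ..
  have N: "N = ?J powr (1 / p)" "L1_seminorm p \<Omega>' f = N"
    unfolding N_def L1_seminorm_def test_function_L1(2)[OF f A(1) p] test_function_L1(2)[OF f' \<Omega>' p]
    by simp_all
  have "?I = S powr q" using I pq by (simp add: S powr_powr)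
  also have "S powr q \<le> ?P powr ((p - q) / p) * N powr q"
  proof (cases "N = 0")
    case True
    obtain K where "L1_seminorm q \<Omega> (f \<circ> \<phi>) \<le> K * L1_seminorm p \<Omega>' f"
      using bco L1_representative_test_function[OF f' \<Omega>' p] unfolding bounded_composition_operator_def by blast
    then have "S \<le> 0" using True N(2) by (simp add: S_def)
    then have "S = 0" unfolding S using powr_ge_zero[of ?I "1/q"] by linarith
    then show ?thesis using True by simp
  next
    case False
    then have Npos: "N > 0" unfolding N using powr_ge_zero[of ?J "1/p"] by linarith
    define \<kappa> where "\<kappa> = 1 / (1 / q - 1 / p)"
    have \<kappa>: "\<kappa> > 0" "1 / \<kappa> * q = (p - q) / p" using pq p by (auto simp: \<kappa>_def field_simps)
    have mem: "f \<in> {f \<in> L1 p A \<inter> C0 A. L1_seminorm p A f \<noteq> 0}"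
      using False test_function_L1(1)[OF f A(1) p] f test_functionE[OF f]
      unfolding N_def C0_def test_function_def
      by (auto intro: Ck_imp_continuous)
    have "ennreal ((S / N) powr \<kappa>) \<le> Phi_tilde p q \<Omega> \<phi> A"
      unfolding Phi_tilde_def S_def N_def \<kappa>_def by (rule SUP_upper[OF mem])
    then have "enn2real (ennreal ((S / N) powr \<kappa>)) \<le> ?P"
      using fin by (intro enn2real_mono) auto
    then have "(S / N) powr \<kappa> \<le> ?P" by simp
    then have "((S / N) powr \<kappa>) powr (1 / \<kappa> * q) \<le> ?P powr (1 / \<kappa> * q)"
      using \<kappa> pq by (intro powr_mono2) (auto intro: mult_nonneg_nonneg)
    moreover have "S \<ge> 0" unfolding S by simp
    then have "((S / N) powr \<kappa>) powr (1 / \<kappa> * q) = S powr q / N powr q"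
      using \<kappa>(1) Npos by (simp add: powr_powr powr_divide)
    ultimately have "S powr q / N powr q \<le> ?P powr ((p - q) / p)" unfolding \<kappa>(2) by simp
    then show ?thesis using Npos by (simp add: divide_le_eq)
  qed
  also have "N powr q = ?J powr (q / p)" using J p by (simp add: N powr_powr)
  finally show ?thesis .
qed

section \<open>Sawtooth functions\<close>

text \<open>One tooth: the identity for \<open>\<bar>t\<bar> \<le> 1/3\<close>, switched off at \<open>\<bar>t\<bar> = 5/12\<close> so that the translates by
  integers have disjoint supports.\<close>

definition tooth :: "real \<Rightarrow> real" where
  "tooth t = t * (step (5 - 12 * t) * step (5 + 12 * t))"

lemma smooth_tooth: "smooth f \<Longrightarrow> smooth (\<lambda>x. tooth (f x))"
  unfolding tooth_def by (intro smooth_intros)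

lemma tooth_eq_id: "\<bar>t\<bar> \<le> 1/3 \<Longrightarrow> tooth t = t"
  by (simp add: tooth_def step_eq_1 abs_le_iff)

lemma tooth_eq_0: "5/12 \<le> \<bar>t\<bar> \<Longrightarrow> tooth t = 0"
  using step_eq_0[of "5 - 12 * t"] step_eq_0[of "5 + 12 * t"] by (auto simp: tooth_def abs_if split: if_splits)

lemma abs_tooth_le: "\<bar>tooth t\<bar> \<le> 1/2"
proof (cases "5/12 \<le> \<bar>t\<bar>")
  case False
  have "\<bar>tooth t\<bar> \<le> \<bar>t\<bar> * (1 * 1)"
    unfolding tooth_def abs_mult
    by (intro mult_left_mono mult_mono) (auto simp: step_nonneg step_le_1)
  then show ?thesis using False by simp
qed (simp add: tooth_eq_0)

definition tooth' :: "real \<Rightarrow> real" where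
  "tooth' t = frechet_derivative tooth (at t) 1"

lemma test_function_tooth: "test_function UNIV tooth"
proof (rule test_functionI)
  show "smooth tooth" using smooth_tooth[of "\<lambda>x. x"] smooth_inner[of "1::real"] by simp
  show "tooth x = 0" if "x \<notin> {-5/12..5/12}" for x using that by (intro tooth_eq_0) auto
qed auto

lemma tooth_has_derivative: "(tooth has_real_derivative tooth' t) (at t)"
proof -
  have s: "smooth tooth" using test_functionE[OF test_function_tooth] by metis
  have D: "(tooth has_derivative frechet_derivative tooth (at t)) (at t)"
    using s by (rule smooth_has_derivative)
  then interpret bounded_linear "frechet_derivative tooth (at t)" by (rule has_derivative_bounded_linear)
  have "frechet_derivative tooth (at t) = (*) (tooth' t)"
  proof
    show "frechet_derivative tooth (at t) s = tooth' t * s" for s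
      using scaleR[of s 1] by (simp add: tooth'_def mult.commute)
  qed
  then show ?thesis using D by (simp add: has_field_derivative_def)
qed

lemma tooth'_eq_0: "1/2 \<le> \<bar>t\<bar> \<Longrightarrow> tooth' t = 0"
  unfolding tooth'_def
  by (rule frechet_derivative_eq_0_on_open[of "- {-5/12..5/12}"]) (auto intro: tooth_eq_0)

lemma tooth'_bounded: obtains M where "M \<ge> 0" "\<And>t. \<bar>tooth' t\<bar> \<le> M"
proof -
  obtain M where M: "M \<ge> 0" "\<And>x. norm (grad tooth x) \<le> M"
    using bounded_grad_test_function[OF test_function_tooth] by metis
  then show ?thesis using that[of M] by (simp add: grad_def tooth'_def)
qed

text \<open>At every point only the translate by the nearest integer can be nonzero.\<close>

lemma sum_integer_shifts:
  fixes g :: "real \<Rightarrow> real"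
  assumes g0: "\<And>t. 1/2 \<le> \<bar>t\<bar> \<Longrightarrow> g t = 0" and I: "finite I" and j: "\<bar>t - of_int j\<bar> \<le> 1/2"
  shows "(\<Sum>k\<in>I. g (t - of_int k)) = (if j \<in> I then g (t - of_int j) else 0)"
proof -
  have "g (t - of_int k) = (if k = j then g (t - of_int j) else 0)" for k
  proof (cases "k = j")
    case False
    then have "1 \<le> \<bar>real_of_int k - of_int j\<bar>" by linarith
    then have "1/2 \<le> \<bar>t - of_int k\<bar>" using j by linarith
    then show ?thesis using g0 False by simp
  qed simp
  then show ?thesis using I by (simp add: sum.delta)
qed

lemma abs_sum_integer_shifts_le:
  fixes g :: "real \<Rightarrow> real"
  assumes "\<And>t. 1/2 \<le> \<bar>t\<bar> \<Longrightarrow> g t = 0" "finite I" "\<And>t. \<bar>g t\<bar> \<le> M"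
  shows "\<bar>\<Sum>k\<in>I. g (t - of_int k)\<bar> \<le> M"
proof -
  have "\<bar>t - of_int (round t)\<bar> \<le> 1/2" using of_int_round_abs_le[of t] by (simp add: abs_minus_commute)
  from sum_integer_shifts[of g I t "round t", OF assms(1,2) this] show ?thesis
    using assms(3) abs_ge_zero[of "g t"] by (auto intro: order_trans[OF abs_ge_zero])
qed

text \<open>Teeth of width and height of order \<open>h\<close> in direction \<open>e\<close>, displaced by the fraction \<open>\<sigma>\<close> of a period.
  A finite set \<open>I\<close> of teeth suffices on a bounded set and keeps the function a finite sum.\<close>

definition sawtooth :: "int set \<Rightarrow> real \<Rightarrow> real \<Rightarrow> 'a::euclidean_space \<Rightarrow> 'a \<Rightarrow> real" where
  "sawtooth I \<sigma> h e z = h * (\<Sum>k\<in>I. tooth ((z \<bullet> e) / h + \<sigma> - of_int k))"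

lemma smooth_sawtooth: "smooth (sawtooth I \<sigma> h e)"
  unfolding sawtooth_def divide_inverse by (intro smooth_intros smooth_tooth)

text \<open>As \<open>h\<close> shrinks the function becomes small while the bound on its slope stays the same.\<close>

lemma sawtooth_bounds:
  assumes I: "finite I" and h: "h > 0" and e: "norm e \<le> 1" and M: "\<And>t. \<bar>tooth' t\<bar> \<le> M"
  shows "\<bar>sawtooth I \<sigma> h e z\<bar> \<le> h"
    and "\<bar>frechet_derivative (sawtooth I \<sigma> h e) (at z) d\<bar> \<le> M * norm d"
proof -
  have "\<bar>\<Sum>k\<in>I. tooth ((z \<bullet> e) / h + \<sigma> - of_int k)\<bar> \<le> 1/2"
    by (rule abs_sum_integer_shifts_le) (simp_all only: I tooth_eq_0 abs_tooth_le)
  then have "h * \<bar>\<Sum>k\<in>I. tooth ((z \<bullet> e) / h + \<sigma> - of_int k)\<bar> \<le> h * 1"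
    using h by (intro mult_left_mono) auto
  then show "\<bar>sawtooth I \<sigma> h e z\<bar> \<le> h" using h by (simp add: sawtooth_def abs_mult)
  let ?T = "\<Sum>k\<in>I. tooth' ((z \<bullet> e) / h + \<sigma> - of_int k)"
  have T: "((\<lambda>z. tooth ((z \<bullet> e) / h + \<sigma> - of_int k)) has_derivative
      (\<lambda>d. tooth' ((z \<bullet> e) / h + \<sigma> - of_int k) * ((d \<bullet> e) / h))) (at z)" for k
    by (rule has_derivative_compose[OF _ tooth_has_derivative[unfolded has_field_derivative_def],
          where f = "\<lambda>z. (z \<bullet> e) / h + \<sigma> - of_int k"])
       (use h in \<open>auto intro!: derivative_eq_intros\<close>)
  have "(sawtooth I \<sigma> h e has_derivative (\<lambda>d. h * (\<Sum>k\<in>I. tooth' ((z \<bullet> e) / h + \<sigma> - of_int k) * ((d \<bullet> e) / h)))) (at z)"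
    unfolding sawtooth_def by (intro has_derivative_mult_right has_derivative_sum T)
  moreover have "(\<lambda>d. h * (\<Sum>k\<in>I. tooth' ((z \<bullet> e) / h + \<sigma> - of_int k) * ((d \<bullet> e) / h))) = (\<lambda>d. ?T * (d \<bullet> e))"
    using h by (simp add: sum_distrib_left sum_distrib_right fun_eq_iff)
  ultimately have "(sawtooth I \<sigma> h e has_derivative (\<lambda>d. ?T * (d \<bullet> e))) (at z)"
    by simp
  then have "frechet_derivative (sawtooth I \<sigma> h e) (at z) d = ?T * (d \<bullet> e)"
    by (simp add: frechet_derivative_at[symmetric])
  moreover have "\<bar>?T\<bar> \<le> M"
    by (rule abs_sum_integer_shifts_le) (auto simp: I tooth'_eq_0 M)
  moreover have "\<bar>d \<bullet> e\<bar> \<le> norm d"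
    using Cauchy_Schwarz_ineq2[of d e] mult_left_mono[OF e norm_ge_zero[of d]] by linarith
  ultimately show "\<bar>frechet_derivative (sawtooth I \<sigma> h e) (at z) d\<bar> \<le> M * norm d"
    by (simp add: abs_mult mult_mono')
qed

lemma sawtooth_eq_affine:
  assumes "finite I" "h > 0" "j \<in> I" "\<bar>(z \<bullet> e) / h + \<sigma> - of_int j\<bar> \<le> 1/3"
  shows "sawtooth I \<sigma> h e z = z \<bullet> e + h * (\<sigma> - of_int j)"
  using assms sum_integer_shifts[of tooth I "(z \<bullet> e) / h + \<sigma>" j]
  by (simp add: sawtooth_def tooth_eq_0 tooth_eq_id field_simps)

text \<open>The points at distance less than \<open>1/3\<close> from the integers fill two thirds of each period; the
  remaining points come within \<open>1/6\<close> of an integer after a shift by half a period.\<close>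

lemma two_shifts_cover:
  fixes t :: real
  obtains \<sigma> where "\<sigma> \<in> {0, 1/2}" "\<bar>t + \<sigma> - of_int (round (t + \<sigma>))\<bar> < 1/3"
proof (cases "\<bar>t - of_int (round t)\<bar> < 1/3")
  case True
  then show ?thesis using that[of 0] by simp
next
  case False
  have "\<bar>t - of_int (round t)\<bar> \<le> 1/2" using of_int_round_abs_le[of t] by (simp add: abs_minus_commute)
  then consider "\<bar>t + 1/2 - of_int (round t)\<bar> < 1/3" | "\<bar>t + 1/2 - of_int (round t + 1)\<bar> < 1/3"
  proof -
    have "\<bar>t + 1/2 - of_int (round t)\<bar> < 1/3 \<or> \<bar>t + 1/2 - (of_int (round t) + 1)\<bar> < 1/3"
      using False \<open>\<bar>t - of_int (round t)\<bar> \<le> 1/2\<close> by linarith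
    then show ?thesis using that by force
  qed
  then have "\<bar>t + 1/2 - of_int (round (t + 1/2))\<bar> < 1/3"
  proof cases
    case 1
    then have "round (t + 1/2) = round t" by (intro round_unique') simp
    then show ?thesis using 1 by simp
  next
    case 2
    then have "round (t + 1/2) = round t + 1" by (intro round_unique') simp
    then show ?thesis using 2 by simp
  qed
  then show ?thesis using that[of "1/2"] by simp
qed

section \<open>Upper bound for the energy\<close>

lemma homeomorphism_open_image:
  assumes "homeomorphism \<Omega> \<Omega>' \<phi> \<psi>" "open \<Omega>'" "open B" "B \<subseteq> \<Omega>"
  shows "open (\<phi> ` B)" "\<phi> ` B \<subseteq> \<Omega>'"
proof -
  have "openin (top_of_set \<Omega>') (\<phi> ` B)"
    using assms by (intro homeomorphism_imp_open_map[OF assms(1)]) (auto simp: openin_open)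
  then show "open (\<phi> ` B)" "\<phi> ` B \<subseteq> \<Omega>'"
    using assms(2) by (auto simp: openin_open_eq)
qed

lemma integral_norm_grad_powr_le:
  fixes f :: "'a::euclidean_space \<Rightarrow> real"
  assumes f: "test_function A f" and A: "open A" "bounded A" and p: "p > 0" and M: "\<And>x. norm (grad f x) \<le> M"
  shows "(LINT x|lebesgue. norm (grad f x) powr p) \<le> M powr p * measure lebesgue A"
proof -
  obtain K where K: "K \<subseteq> A" "\<And>x d. x \<notin> K \<Longrightarrow> frechet_derivative f (at x) d = 0"
    using test_functionE[OF f] by metis
  have Am: "A \<in> lmeasurable" using A by (simp add: lmeasurable_open)
  have "(LINT x|lebesgue. norm (grad f x) powr p) \<le> (LINT x|lebesgue. M powr p * indicator A x)"
  proof (rule integral_mono)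
    show "integrable lebesgue (\<lambda>x. norm (grad f x) powr p)" by (rule test_function_L1(3)[OF f A(1) p])
    show "integrable lebesgue (\<lambda>x. M powr p * indicat_real A x)"
      using Am by (auto simp: fmeasurable_def)
    show "norm (grad f x) powr p \<le> M powr p * indicator A x" for x
    proof (cases "x \<in> A")
      case True
      then show ?thesis using M[of x] p by (auto intro: powr_mono2)
    next
      case False
      then have "grad f x = 0" using K unfolding grad_def by (intro sum.neutral) auto
      then show ?thesis using False by simp
    qed
  qed
  then show ?thesis using Am by (simp add: fmeasurable_def)
qed

lemma set_integral_mono_of_AE_le_sum:
  fixes g g1 g2 :: "'a::euclidean_space \<Rightarrow> real"
  assumes "set_integrable lebesgue \<Omega> g" "set_integrable lebesgue \<Omega> g1" "set_integrable lebesgue \<Omega> g2"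
    and E: "E \<subseteq> \<Omega>" "E \<in> sets lebesgue"
    and nn: "\<And>x. 0 \<le> g1 x" "\<And>x. 0 \<le> g2 x"
    and le: "AE x in lebesgue. x \<in> E \<longrightarrow> g x \<le> g1 x \<or> g x \<le> g2 x"
  shows "(LINT x:E|lebesgue. g x) \<le> (LINT x:\<Omega>|lebesgue. g1 x) + (LINT x:\<Omega>|lebesgue. g2 x)"
proof -
  have "(LINT x:E|lebesgue. g x) \<le> (LINT x:\<Omega>|lebesgue. g1 x + g2 x)"
    unfolding set_lebesgue_integral_def
  proof (rule integral_mono_AE)
    show "integrable lebesgue (\<lambda>x. indicator E x *\<^sub>R g x)"
      using set_integrable_subset[OF assms(1) E(2,1)] by (simp add: set_integrable_def)
    show "integrable lebesgue (\<lambda>x. indicator \<Omega> x *\<^sub>R (g1 x + g2 x))"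
      using set_integral_add(1)[OF assms(2,3)] by (simp add: set_integrable_def)
    show "AE x in lebesgue. indicator E x *\<^sub>R g x \<le> indicator \<Omega> x *\<^sub>R (g1 x + g2 x)"
      using le
    proof eventually_elim
      case (elim x)
      then show ?case using nn[of x] E(1) by (auto simp: indicator_def)
    qed
  qed
  then show ?thesis using set_integral_add(2)[OF assms(2,3)] by simp
qed

text \<open>The function \<open>f0\<close> stands for the linear functional \<open>z \<bullet> e\<close>, cut off away from \<open>\<phi> ` E\<close>, and \<open>f0 \<circ> \<phi>\<close>
  for the component of \<open>\<phi>\<close> in direction \<open>e\<close>. For \<open>\<sigma> = 0\<close> and \<open>\<sigma> = 1/2\<close> the cut-off sawtooth function
  \<open>f \<sigma>\<close> has gradient at most \<open>M + 1\<close> and support in \<open>\<phi> ` B\<close>, so that \<open>gradient_bound_by_Phi_tilde\<close>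
  bounds the energy of \<open>f \<sigma> \<circ> \<phi>\<close>. On the preimage of each slab of slope one, \<open>f \<sigma> \<circ> \<phi>\<close> and \<open>f0 \<circ> \<phi>\<close>
  differ by a constant, so their weak gradients agree there.\<close>

lemma energy_bound_by_Phi:
  fixes \<phi> \<psi> :: "'a::euclidean_space \<Rightarrow> 'a"
  assumes hom: "homeomorphism \<Omega> \<Omega>' \<phi> \<psi>" and op: "open \<Omega>" "open \<Omega>'"
    and bco: "bounded_composition_operator p q \<Omega> \<Omega>' \<phi>" and pq: "0 < q" "q < p"
    and B: "open B" "B \<subseteq> \<Omega>" "bounded (\<phi> ` B)"
    and K: "compact K" "K \<subseteq> B" and E: "open E" "E \<subseteq> K"
    and e: "norm e \<le> 1" and f0: "test_function \<Omega>' f0" "\<And>x. x \<in> E \<Longrightarrow> f0 (\<phi> x) = \<phi> x \<bullet> e"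
    and fin: "Phi p q \<Omega> \<phi> B < \<infinity>"
    and M: "\<And>t. \<bar>tooth' t\<bar> \<le> M"
  shows "(LINT x:E|lebesgue. norm (weak_gradient \<Omega> (f0 \<circ> \<phi>) x) powr q)
      \<le> 2 * (enn2real (Phi p q \<Omega> \<phi> B) powr ((p - q) / p)
            * ((M + 1) powr p * measure lebesgue (\<phi> ` B)) powr (q / p))"
proof -
  have p: "p > 0" using pq by simp
  define A where "A = \<phi> ` B"
  have A: "open A" "A \<subseteq> \<Omega>'" "bounded A"
    using homeomorphism_open_image[OF hom op(2) B(1,2)] B(3) by (auto simp: A_def)
  have cont: "continuous_on \<Omega> \<phi>" using hom by (simp add: homeomorphism_def)
  have "compact (\<phi> ` K)" "\<phi> ` K \<subseteq> A"
    using K B cont by (auto simp: A_def intro!: compact_continuous_image intro: continuous_on_subset)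
  then obtain \<zeta> where chi: "test_function A \<zeta>" "\<And>z. z \<in> \<phi> ` K \<Longrightarrow> \<zeta> z = 1" "\<And>z. 0 \<le> \<zeta> z" "\<And>z. \<zeta> z \<le> 1"
    using smooth_cutoff_exists[OF _ A(1)] by metis
  have schi: "smooth \<zeta>" using test_functionE[OF chi(1)] by metis
  obtain M' where M': "M' \<ge> 0" "\<And>z. norm (grad \<zeta> z) \<le> M'" using bounded_grad_test_function[OF chi(1)] by metis
  \<comment> \<open>The teeth are so small that the gradient of the cutoff contributes at most 1 to the slope.\<close>
  define h where "h = 1 / (M' + 1)"
  have h: "h > 0" "M' * h \<le> 1" using M'(1) by (auto simp: h_def field_simps)
  have M0: "M \<ge> 0" using M[of 0] by linarith
  obtain R where R: "R > 0" "\<And>z. z \<in> A \<Longrightarrow> norm z \<le> R" using A(3) bounded_pos by metis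
  \<comment> \<open>On a set where \<open>\<bar>z \<bullet> e\<bar> \<le> R\<close>, these are all the teeth that can be met, for either shift.\<close>
  define I where "I = {-(\<lceil>R / h\<rceil> + 2)..\<lceil>R / h\<rceil> + 2}"
  have I: "finite I" by (simp add: I_def)
  define f where "f \<sigma> z = \<zeta> z * sawtooth I \<sigma> h e z" for \<sigma> z
  have tf: "test_function A (f \<sigma>)" for \<sigma>
    unfolding f_def using chi(1) smooth_sawtooth by (rule test_function_mult_right)
  have gradf: "norm (grad (f \<sigma>) z) \<le> M + 1" for \<sigma> z
  proof (rule norm_grad_le)
    show "smooth (f \<sigma>)" using test_functionE[OF tf] by metis
    fix d
    have "(f \<sigma> has_derivative (\<lambda>d. \<zeta> z * frechet_derivative (sawtooth I \<sigma> h e) (at z) d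
        + frechet_derivative \<zeta> (at z) d * sawtooth I \<sigma> h e z)) (at z)"
      unfolding f_def by (intro has_derivative_mult smooth_has_derivative schi smooth_sawtooth)
    then have "frechet_derivative (f \<sigma>) (at z) d = \<zeta> z * frechet_derivative (sawtooth I \<sigma> h e) (at z) d
        + (grad \<zeta> z \<bullet> d) * sawtooth I \<sigma> h e z"
      by (simp add: frechet_derivative_at[symmetric] grad_inner[OF schi])
    moreover have "\<bar>\<zeta> z * frechet_derivative (sawtooth I \<sigma> h e) (at z) d\<bar> \<le> 1 * (M * norm d)"
      unfolding abs_mult using chi(3,4)[of z] sawtooth_bounds(2)[OF I h(1) e M]
      by (intro mult_mono) auto
    moreover have "\<bar>(grad \<zeta> z \<bullet> d) * sawtooth I \<sigma> h e z\<bar> \<le> (M' * norm d) * h"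
      unfolding abs_mult
    proof (intro mult_mono)
      show "\<bar>grad \<zeta> z \<bullet> d\<bar> \<le> M' * norm d"
        using Cauchy_Schwarz_ineq2[of "grad \<zeta> z" d] mult_right_mono[OF M'(2)[of z], of "norm d"] by simp
    qed (use sawtooth_bounds(1)[OF I h(1) e M] M'(1) in auto)
    moreover have "(M' * norm d) * h \<le> norm d"
      using mult_right_mono[OF h(2), of "norm d"] by (simp add: mult_ac)
    ultimately show "\<bar>frechet_derivative (f \<sigma>) (at z) d\<bar> \<le> (M + 1) * norm d"
      by (simp add: distrib_right)
  qed
  define G where "G \<sigma> = weak_gradient \<Omega> (f \<sigma> \<circ> \<phi>)" for \<sigma>
  define G0 where "G0 = weak_gradient \<Omega> (f0 \<circ> \<phi>)"
  have mem: "f \<sigma> \<circ> \<phi> \<in> L1 q \<Omega>" for \<sigma>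
    using composition_in_L1[OF bco op(2) p] test_function_mono[OF tf A(2)] by blast
  have mem0: "f0 \<circ> \<phi> \<in> L1 q \<Omega>"
    using composition_in_L1[OF bco op(2) p] f0(1) by blast
  have bound: "(LINT x:\<Omega>|lebesgue. norm (G \<sigma> x) powr q)
     \<le> enn2real (Phi p q \<Omega> \<phi> B) powr ((p - q) / p) * ((M + 1) powr p * measure lebesgue A) powr (q / p)" for \<sigma>
  proof -
    have "(LINT x:\<Omega>|lebesgue. norm (G \<sigma> x) powr q)
      \<le> enn2real (Phi p q \<Omega> \<phi> B) powr ((p - q) / p) * (LINT x|lebesgue. norm (grad (f \<sigma>) x) powr p) powr (q / p)"
      unfolding G_def Phi_def A_def[symmetric]
      using gradient_bound_by_Phi_tilde[OF bco op(2) pq A(1,2) tf] fin by (simp add: Phi_def A_def)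
    also have "\<dots> \<le> enn2real (Phi p q \<Omega> \<phi> B) powr ((p - q) / p) * ((M + 1) powr p * measure lebesgue A) powr (q / p)"
      using integral_norm_grad_powr_le[OF tf A(1,3) p gradf] pq
      by (intro mult_left_mono powr_mono2) (auto intro: integral_nonneg_AE)
    finally show ?thesis .
  qed
  have loc: "AE x in lebesgue. x \<in> E \<and> \<bar>(\<phi> x \<bullet> e) / h + \<sigma> - of_int k\<bar> < 1/3 \<longrightarrow> G0 x = G \<sigma> x"
    if k: "k \<in> I" for k \<sigma>
  proof -
    let ?V = "{x \<in> E. \<bar>(\<phi> x \<bullet> e) / h + \<sigma> - of_int k\<bar> < 1/3}"
    have EO: "E \<subseteq> \<Omega>" using E K B by blast
    have "continuous_on E (\<lambda>x. \<bar>(\<phi> x \<bullet> e) / h + \<sigma> - of_int k\<bar>)"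
      using h(1) by (intro continuous_intros continuous_on_subset[OF cont EO]) auto
    from continuous_open_preimage[OF this E(1) open_lessThan[of "1/3"]]
    have "open ?V" by (simp add: vimage_def Int_def)
    then have "AE x in lebesgue. x \<in> ?V \<longrightarrow> G0 x = G \<sigma> x"
      unfolding G0_def G_def
    proof (rule weak_gradient_local[OF _ _ _ L1_has_weak_gradient[OF mem0] L1_has_weak_gradient[OF mem], where c = "- h * (\<sigma> - of_int k)"])
      show "(f0 \<circ> \<phi>) x = (f \<sigma> \<circ> \<phi>) x + - h * (\<sigma> - of_int k)" if "x \<in> ?V" for x
        using that E f0(2) chi(2)[of "\<phi> x"] sawtooth_eq_affine[OF I h(1) k, of "\<phi> x" e \<sigma>]
        by (auto simp: f_def)
    qed (use EO in auto)
    then show ?thesis by simp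
  qed
  have "AE x in lebesgue. \<forall>\<sigma>\<in>{0, 1/2}. \<forall>k\<in>I. x \<in> E \<and> \<bar>(\<phi> x \<bullet> e) / h + \<sigma> - of_int k\<bar> < 1/3 \<longrightarrow> G0 x = G \<sigma> x"
    using loc I by (intro AE_finite_allI) auto
  then have cover: "AE x in lebesgue. x \<in> E \<longrightarrow> norm (G0 x) powr q \<le> norm (G 0 x) powr q \<or> norm (G0 x) powr q \<le> norm (G (1/2) x) powr q"
  proof eventually_elim
    case (elim x)
    show ?case
    proof
      assume x: "x \<in> E"
      define t where "t = (\<phi> x \<bullet> e) / h"
      obtain \<sigma> where s: "\<sigma> \<in> {0, 1/2}" "\<bar>t + \<sigma> - of_int (round (t + \<sigma>))\<bar> < 1/3"
        using two_shifts_cover by metis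
      have "\<phi> x \<in> A" using x E K by (auto simp: A_def)
      then have "\<bar>\<phi> x \<bullet> e\<bar> \<le> R"
        using R(2) Cauchy_Schwarz_ineq2[of "\<phi> x" e] mult_left_mono[OF e norm_ge_zero[of "\<phi> x"]] by force
      then have "\<bar>t\<bar> \<le> R / h" using h(1) by (simp add: t_def divide_right_mono)
      moreover have "0 \<le> \<sigma>" "\<sigma> \<le> 1/2" using s(1) by auto
      moreover have "R / h \<le> of_int \<lceil>R / h\<rceil>" by simp
      ultimately have "real_of_int (round (t + \<sigma>)) \<le> of_int (\<lceil>R / h\<rceil> + 2)"
          "real_of_int (- (\<lceil>R / h\<rceil> + 2)) \<le> of_int (round (t + \<sigma>))"
        using s(2) unfolding of_int_add of_int_minus of_int_numeral by linarith+
      then have "round (t + \<sigma>) \<in> I" unfolding I_def atLeastAtMost_iff of_int_le_iff by blast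
      then have "G0 x = G \<sigma> x" using elim s x unfolding t_def by blast
      then show "norm (G0 x) powr q \<le> norm (G 0 x) powr q \<or> norm (G0 x) powr q \<le> norm (G (1/2) x) powr q"
        using s(1) by (elim insertE emptyE) (simp_all only: order_refl simp_thms)
    qed
  qed
  have "(LINT x:E|lebesgue. norm (G0 x) powr q)
     \<le> (LINT x:\<Omega>|lebesgue. norm (G 0 x) powr q) + (LINT x:\<Omega>|lebesgue. norm (G (1/2) x) powr q)"
    by (rule set_integral_mono_of_AE_le_sum[OF _ _ _ _ _ _ _ cover])
       (use mem mem0 E K B in \<open>auto simp: L1_def G_def G0_def\<close>)
  then show ?thesis using bound[of 0] bound[of "1/2"] unfolding G0_def A_def by linarith
qed

section \<open>Averages over moving balls\<close>

text \<open>The standard mollifier of radius \<open>s\<close> about \<open>c\<close>, up to the normalising constant \<open>bump_mass\<close>, which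
  does not depend on \<open>c\<close> and \<open>s\<close>.\<close>

definition bump_kernel :: "'a::euclidean_space \<Rightarrow> real \<Rightarrow> 'a \<Rightarrow> real" where
  "bump_kernel c s x = flat 0 (1 - (norm (x - c))\<^sup>2 / s\<^sup>2) / s ^ DIM('a)"

definition bump_mass :: "'a::euclidean_space itself \<Rightarrow> real" where
  "bump_mass _ = (LINT x|lebesgue. bump_kernel (0::'a) 1 x)"

text \<open>Not normalised: for continuous \<open>F\<close> the limit as \<open>s\<close> tends to 0 is \<open>bump_mass\<close> times \<open>F c\<close>.\<close>

definition average :: "('a::euclidean_space \<Rightarrow> real) \<Rightarrow> 'a \<Rightarrow> real \<Rightarrow> real" where
  "average F c s = (LINT x|lebesgue. F x * bump_kernel c s x)"

lemma smooth_bump_kernel: "smooth (bump_kernel c s)"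
  unfolding bump_kernel_def divide_inverse by (intro smooth_intros)

lemma bump_kernel_outside: "s > 0 \<Longrightarrow> x \<notin> cball c s \<Longrightarrow> bump_kernel c s x = 0"
  by (simp add: bump_kernel_def flat_0_eq_0_iff dist_norm norm_minus_commute power_mono)

lemma bump_kernel_bounds:
  fixes c x :: "'a::euclidean_space"
  assumes "s > 0" shows "0 \<le> bump_kernel c s x" "bump_kernel c s x \<le> 1 / s ^ DIM('a)"
  using assms flat_0_nonneg flat_0_le_1 by (auto simp: bump_kernel_def divide_right_mono)

lemma integral_bump_kernel:
  fixes c :: "'a::euclidean_space"
  assumes "s > 0"
  shows "(LINT x|lebesgue. bump_kernel c s x) = bump_mass TYPE('a)"
proof -
  have m: "bump_kernel c s \<in> borel_measurable borel" for c :: 'a and s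
    by (intro borel_measurable_continuous_onI smooth_continuous smooth_bump_kernel)
  have "(LINT x|lborel. bump_kernel c s x)
      = (LINT x|density (distr lborel borel (\<lambda>x. c + s *\<^sub>R x)) (\<lambda>_. ennreal (\<bar>s\<bar> ^ DIM('a))). bump_kernel c s x)"
    using assms by (subst lborel_affine[of s c]) auto
  also have "\<dots> = (LINT x|lborel. \<bar>s\<bar> ^ DIM('a) * bump_kernel c s (c + s *\<^sub>R x))"
    using m by (subst integral_density) (auto simp: integral_distr)
  also have "\<dots> = (LINT x|lborel. bump_kernel (0::'a) 1 x)"
    using assms by (intro Bochner_Integration.integral_cong) (auto simp: bump_kernel_def power_mult_distrib)
  finally show ?thesis using m by (simp add: bump_mass_def integral_completion)
qed

text \<open>On the ball of radius \<open>1/2\<close> the kernel is at least \<open>flat 0 (3/4)\<close>.\<close>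

lemma bump_mass_pos: "bump_mass TYPE('a::euclidean_space) > 0"
proof -
  have "0 < flat 0 (3/4) * measure lebesgue (ball (0::'a) (1/2))"
    using content_ball_pos[of "1/2" "0::'a"] by (intro mult_pos_pos) (simp_all add: flat_0_pos_iff)
  also have "\<dots> = (LINT x|lebesgue. flat 0 (3/4) * indicator (ball (0::'a) (1/2)) x)"
    using fmeasurableD2[OF lmeasurable_ball] by simp
  also have "\<dots> \<le> bump_mass TYPE('a)"
    unfolding bump_mass_def
  proof (rule integral_mono)
    show "integrable lebesgue (\<lambda>x::'a. flat 0 (3/4) * indicat_real (ball 0 (1/2)) x)"
      using lmeasurable_ball[of "0::'a" "1/2"] by (auto simp: fmeasurable_def)
    show "integrable lebesgue (bump_kernel (0::'a) 1)"
      by (rule integrable_lebesgue_compact_support[of "cball 0 1"])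
         (auto intro: smooth_continuous smooth_bump_kernel bump_kernel_outside)
    show "flat 0 (3/4) * indicat_real (ball 0 (1/2)) x \<le> bump_kernel (0::'a) 1 x" for x :: 'a
    proof (cases "x \<in> ball 0 (1/2)")
      case True
      then have "(norm x)\<^sup>2 \<le> (1/2)\<^sup>2" by (intro power_mono) auto
      then have "inverse (1 - (norm x)\<^sup>2) \<le> inverse (3/4)"
        by (intro le_imp_inverse_le) (auto simp: power2_eq_square)
      then show ?thesis using True \<open>(norm x)\<^sup>2 \<le> (1/2)\<^sup>2\<close>
        by (auto simp: bump_kernel_def flat_def power2_eq_square)
    next
      case False
      then show ?thesis using bump_kernel_bounds(1)[of 1 0 x] by simp
    qed
  qed
  finally show ?thesis .
qed

lemma integrable_times_bump_kernel:
  assumes "continuous_on UNIV F" "s > 0"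
  shows "integrable lebesgue (\<lambda>x. F x * bump_kernel c s x)"
  using assms
  by (intro integrable_lebesgue_compact_support[of "cball c s"])
     (auto intro!: continuous_on_mult smooth_continuous[OF smooth_bump_kernel] simp: bump_kernel_outside)

lemma average_near:
  fixes F :: "'a::euclidean_space \<Rightarrow> real"
  assumes F: "continuous_on UNIV F" and s: "s > 0" and close: "\<And>x. x \<in> cball c s \<Longrightarrow> \<bar>F x - F c\<bar> \<le> \<epsilon>"
  shows "\<bar>average F c s - bump_mass TYPE('a) * F c\<bar> \<le> \<epsilon> * bump_mass TYPE('a)"
proof -
  have i: "integrable lebesgue (\<lambda>x. F x * bump_kernel c s x)" "integrable lebesgue (\<lambda>x. F c * bump_kernel c s x)"
    using integrable_times_bump_kernel[OF F s] integrable_times_bump_kernel[OF continuous_on_const s] by blast+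
  have "average F c s - bump_mass TYPE('a) * F c = (LINT x|lebesgue. F x * bump_kernel c s x) - (LINT x|lebesgue. F c * bump_kernel c s x)"
    using integral_bump_kernel[OF s, of c] by (simp add: average_def)
  also have "\<dots> = (LINT x|lebesgue. F x * bump_kernel c s x - F c * bump_kernel c s x)"
    using i by simp
  also have "\<bar>\<dots>\<bar> \<le> (LINT x|lebesgue. \<epsilon> * bump_kernel c s x)"
  proof (rule order_trans[OF integral_abs_bound integral_mono])
    show "integrable lebesgue (\<lambda>x. \<bar>F x * bump_kernel c s x - F c * bump_kernel c s x\<bar>)"
      using i by (intro integrable_abs Bochner_Integration.integrable_diff)
    show "integrable lebesgue (\<lambda>x. \<epsilon> * bump_kernel c s x)"
      by (rule integrable_times_bump_kernel[OF continuous_on_const s])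
    show "\<bar>F x * bump_kernel c s x - F c * bump_kernel c s x\<bar> \<le> \<epsilon> * bump_kernel c s x" for x
      using close[of x] bump_kernel_bounds(1)[OF s, of c x] bump_kernel_outside[OF s, of x c]
      by (cases "x \<in> cball c s") (auto simp: abs_mult mult_right_mono simp flip: left_diff_distrib)
  qed
  also have "\<dots> = \<epsilon> * bump_mass TYPE('a)" using integral_bump_kernel[OF s, of c] by simp
  finally show ?thesis .
qed

lemma average_tendsto:
  fixes F :: "'a::euclidean_space \<Rightarrow> real"
  assumes F: "continuous_on UNIV F" and s: "\<And>k. s k > 0" "s \<longlonglongrightarrow> 0"
  shows "(\<lambda>k. average F c (s k)) \<longlonglongrightarrow> bump_mass TYPE('a) * F c"
proof (rule tendstoI)
  fix e :: real assume e: "e > 0"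
  let ?m = "bump_mass TYPE('a)"
  have m: "?m > 0" by (rule bump_mass_pos)
  have "isCont F c" using F by (simp add: continuous_on_eq_continuous_at)
  then obtain d where d: "d > 0" "\<And>x. dist x c < d \<Longrightarrow> dist (F x) (F c) < e / (2 * ?m)"
    unfolding continuous_at_eps_delta using e m by (metis divide_pos_pos mult_pos_pos zero_less_numeral)
  have "\<forall>\<^sub>F k in sequentially. s k < d" using s(2) d(1) by (rule order_tendstoD)
  then show "\<forall>\<^sub>F k in sequentially. dist (average F c (s k)) (?m * F c) < e"
  proof eventually_elim
    case (elim k)
    have "\<bar>average F c (s k) - ?m * F c\<bar> \<le> e / (2 * ?m) * ?m"
    proof (rule average_near[OF F s(1)])
      fix x assume "x \<in> cball c (s k)"
      then have "dist x c < d" using elim by (simp add: dist_commute)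
      from d(2)[OF this] show "\<bar>F x - F c\<bar> \<le> e / (2 * ?m)" by (simp add: dist_real_def)
    qed
    also have "\<dots> < e" using e m by simp
    finally show ?case by (simp add: dist_real_def)
  qed
qed

text \<open>The derivative is made explicit so that its joint continuity in \<open>t\<close> and \<open>x\<close> can be read off and
  so that it can be recognised as a divergence.\<close>

lemma bump_kernel_path_derivative:
  fixes c c' x :: "'a::euclidean_space" and s s' t :: real
  defines "u \<equiv> x - (c + t *\<^sub>R c')" and "r \<equiv> s + t * s'"
  assumes r: "r > 0"
  shows "((\<lambda>t. bump_kernel (c + t *\<^sub>R c') (s + t * s') x) has_real_derivative
      flat 2 (1 - (norm u)\<^sup>2 / r\<^sup>2) * (2 * (u \<bullet> c') / r\<^sup>2 + 2 * (norm u)\<^sup>2 * s' / r ^ 3) / r ^ DIM('a)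
       - flat 0 (1 - (norm u)\<^sup>2 / r\<^sup>2) * (DIM('a) * s' / r) / r ^ DIM('a)) (at t within S)"
proof -
  have N: "((\<lambda>t. (norm (x - (c + t *\<^sub>R c')))\<^sup>2) has_real_derivative - 2 * (u \<bullet> c')) (at t within S)"
    unfolding power2_norm_eq_inner u_def has_field_derivative_def
    by (auto intro!: derivative_eq_intros simp: inner_commute algebra_simps fun_eq_iff)
  have g: "((\<lambda>t. 1 - (norm (x - (c + t *\<^sub>R c')))\<^sup>2 / (s + t * s')\<^sup>2) has_real_derivative
      (2 * (u \<bullet> c') / r\<^sup>2 + 2 * (norm u)\<^sup>2 * s' / r ^ 3)) (at t within S)"
  proof -
    have Q: "((\<lambda>t. (s + t * s')\<^sup>2) has_real_derivative 2 * r * s') (at t within S)"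
      unfolding r_def by (auto intro!: derivative_eq_intros)
    have "((\<lambda>t. 1 - (norm (x - (c + t *\<^sub>R c')))\<^sup>2 / (s + t * s')\<^sup>2) has_real_derivative
        0 - (- 2 * (u \<bullet> c') * r\<^sup>2 - (norm u)\<^sup>2 * (2 * r * s')) / (r\<^sup>2 * r\<^sup>2)) (at t within S)"
      using DERIV_diff[OF DERIV_const DERIV_divide[OF N Q]] r by (simp add: r_def u_def)
    moreover have "0 - (- 2 * (u \<bullet> c') * r\<^sup>2 - (norm u)\<^sup>2 * (2 * r * s')) / (r\<^sup>2 * r\<^sup>2)
        = 2 * (u \<bullet> c') / r\<^sup>2 + 2 * (norm u)\<^sup>2 * s' / r ^ 3"
      using r by (simp add: field_simps power2_eq_square power3_eq_cube)
    ultimately show ?thesis by simp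
  qed
  have "((\<lambda>t. flat 0 (1 - (norm (x - (c + t *\<^sub>R c')))\<^sup>2 / (s + t * s')\<^sup>2)) has_real_derivative
      flat 2 (1 - (norm u)\<^sup>2 / r\<^sup>2) * (2 * (u \<bullet> c') / r\<^sup>2 + 2 * (norm u)\<^sup>2 * s' / r ^ 3)) (at t within S)"
    using DERIV_chain2[OF flat_has_derivative[of 0] g] by (simp add: u_def r_def numeral_2_eq_2)
  note 1 = this
  have 2: "((\<lambda>t. (s + t * s') ^ DIM('a)) has_real_derivative DIM('a) * s' / r * r ^ DIM('a)) (at t within S)"
  proof -
    have "((\<lambda>t. s + t * s') has_real_derivative s') (at t within S)"
      by (auto intro!: derivative_eq_intros)
    from DERIV_power[OF this, of "DIM('a)"]
    have "((\<lambda>t. (s + t * s') ^ DIM('a)) has_real_derivative DIM('a) * (s' * r ^ (DIM('a) - Suc 0))) (at t within S)"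
      by (simp add: r_def)
    moreover have "r ^ (DIM('a) - Suc 0) = r ^ DIM('a) / r"
      using power_minus_mult[of "DIM('a)" r] r by (simp add: field_simps)
    ultimately show ?thesis by (simp add: mult.assoc)
  qed
  have eq: "(a * r ^ m - f * (b * r ^ m)) / (r ^ m * r ^ m) = a / r ^ m - f * b / r ^ m" for a b f m
    using r by (simp add: field_simps)
  have nz: "(s + t * s') ^ DIM('a) \<noteq> 0" using r by (simp add: r_def)
  show ?thesis
    using DERIV_divide[OF 1 2 nz] unfolding bump_kernel_def u_def[symmetric] r_def[symmetric] eq .
qed

lemma bump_kernel_has_derivative:
  assumes "s > 0"
  shows "(bump_kernel c s has_derivative
     (\<lambda>d. flat 2 (1 - (norm (x - c))\<^sup>2 / s\<^sup>2) * (- 2 * ((x - c) \<bullet> d) / s\<^sup>2) / s ^ DIM('a))) (at (x :: 'a::euclidean_space))"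
proof -
  have N: "((\<lambda>x. 1 - (norm (x - c))\<^sup>2 / s\<^sup>2) has_derivative (\<lambda>d. - 2 * ((x - c) \<bullet> d) / s\<^sup>2)) (at x)"
    unfolding power2_norm_eq_inner divide_inverse
    by (auto intro!: derivative_eq_intros simp: inner_commute algebra_simps fun_eq_iff)
  have "((\<lambda>x. flat 0 (1 - (norm (x - c))\<^sup>2 / s\<^sup>2)) has_derivative
     (\<lambda>d. flat 2 (1 - (norm (x - c))\<^sup>2 / s\<^sup>2) * (- 2 * ((x - c) \<bullet> d) / s\<^sup>2))) (at x)"
    using has_derivative_compose[OF N flat_has_derivative[of 0, unfolded has_field_derivative_def]]
    by (simp add: numeral_2_eq_2)
  then show ?thesis unfolding bump_kernel_def divide_inverse by (intro has_derivative_mult_left)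
qed

text \<open>While center and radius move linearly, the kernel \<open>k\<close> satisfies the continuity equation
  \<open>\<partial>\<^sub>t k + div (k X) = 0\<close>, where \<open>X\<close> is the velocity field of the moving ball. The components of \<open>k X\<close>
  are test functions, so the integral of \<open>F\<close> against the divergence turns into one of its weak gradient against \<open>k X\<close>.\<close>

lemma average_path_derivative:
  fixes F :: "'a::euclidean_space \<Rightarrow> real" and c c' :: 'a and s s' t :: real
  assumes F: "continuous_on UNIV F" "has_weak_gradient \<Omega> F G"
    and t: "t \<in> {0..1}" and s: "s > 0" "s + s' > 0"
    and ball: "cball (c + t *\<^sub>R c') (s + t * s') \<subseteq> \<Omega>"
  shows "((\<lambda>t. average F (c + t *\<^sub>R c') (s + t * s')) has_real_derivative
     (LINT x|lebesgue. (G x \<bullet> (c' + (s' / (s + t * s')) *\<^sub>R (x - (c + t *\<^sub>R c')))) * bump_kernel (c + t *\<^sub>R c') (s + t * s') x))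
     (at t within {0..1})"
proof -
  have rpos: "s + t * s' > 0" if "t \<in> {0..1}" for t
  proof (cases "s' \<ge> 0")
    case True then show ?thesis using s that by (simp add: add_pos_nonneg)
  next
    case False
    then have "t * s' \<ge> 1 * s'" using that by (intro mult_right_mono_neg) auto
    then show ?thesis using s by simp
  qed
  define K' where "K' t x =
      flat 2 (1 - (norm (x - (c + t *\<^sub>R c')))\<^sup>2 / (s + t * s')\<^sup>2) * (2 * ((x - (c + t *\<^sub>R c')) \<bullet> c') / (s + t * s')\<^sup>2
        + 2 * (norm (x - (c + t *\<^sub>R c')))\<^sup>2 * s' / (s + t * s') ^ 3) / (s + t * s') ^ DIM('a)
       - flat 0 (1 - (norm (x - (c + t *\<^sub>R c')))\<^sup>2 / (s + t * s')\<^sup>2) * (DIM('a) * s' / (s + t * s')) / (s + t * s') ^ DIM('a)"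
    for t x
  have flat_cont: "continuous_on S (\<lambda>z. flat m (f z))" if "continuous_on S f" for S :: "(real \<times> 'a) set" and f m
  proof (rule continuous_on_compose2[OF _ that])
    show "continuous_on UNIV (flat m)"
      using flat_has_derivative by (meson DERIV_isCont continuous_at_imp_continuous_on)
  qed auto
  let ?K = "cball c (norm c' + \<bar>s\<bar> + \<bar>s'\<bar>)"
  have out: "(s + t * s')\<^sup>2 \<le> (norm (x - (c + t *\<^sub>R c')))\<^sup>2" if x: "x \<notin> ?K" and t: "t \<in> {0..1}" for t x
  proof -
    have "s + t * s' \<le> \<bar>s\<bar> + 1 * \<bar>s'\<bar>"
    proof -
      have "t * s' \<le> \<bar>t * s'\<bar>" by (rule abs_ge_self)
      also have "\<dots> \<le> 1 * \<bar>s'\<bar>" unfolding abs_mult using t by (intro mult_right_mono) auto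
      finally show ?thesis by simp
    qed
    moreover have "norm (t *\<^sub>R c') \<le> norm c'" using t by (simp add: mult_left_le_one_le)
    moreover have "norm (x - c) \<le> norm (x - (c + t *\<^sub>R c')) + norm (t *\<^sub>R c')"
      using norm_triangle_ineq[of "x - (c + t *\<^sub>R c')" "t *\<^sub>R c'"] by (simp add: algebra_simps)
    ultimately have "s + t * s' \<le> norm (x - (c + t *\<^sub>R c'))"
      using x by (simp add: dist_norm norm_minus_commute)
    then show ?thesis using rpos[OF t] by (intro power_mono) auto
  qed
  have out': "flat m (1 - (norm (x - (c + t *\<^sub>R c')))\<^sup>2 / (s + t * s')\<^sup>2) = 0"
    if "x \<notin> ?K" "t \<in> {0..1}" for t x m
  proof -
    have "1 \<le> (norm (x - (c + t *\<^sub>R c')))\<^sup>2 / (s + t * s')\<^sup>2"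
      using out[OF that] rpos[OF that(2)] by (simp add: field_simps)
    then show ?thesis by (simp add: flat_def)
  qed
  have D: "((\<lambda>t. LINT x|lebesgue. F x * bump_kernel (c + t *\<^sub>R c') (s + t * s') x) has_real_derivative
      (LINT x|lebesgue. F x * K' t x)) (at t within {0..1})"
  proof (rule leibniz_compact_support[of ?K])
    show "((\<lambda>t. F x * bump_kernel (c + t *\<^sub>R c') (s + t * s') x) has_real_derivative F x * K' t x) (at t within {0..1})"
      if "t \<in> {0..1}" for t x
      unfolding K'_def by (intro DERIV_cmult bump_kernel_path_derivative rpos that)
    show "continuous_on UNIV (\<lambda>x. F x * bump_kernel (c + t *\<^sub>R c') (s + t * s') x)" for t
      by (intro continuous_on_mult F(1) smooth_continuous smooth_bump_kernel)
    have "continuous_on ({0..1} \<times> UNIV) (\<lambda>z. F (snd z))"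
      by (rule continuous_on_compose2[OF F(1)]) (auto intro!: continuous_intros)
    moreover have "s + fst z * s' \<noteq> 0" if "z \<in> {0..1} \<times> (UNIV :: 'a set)" for z
      using rpos[of "fst z"] that by auto
    ultimately show "continuous_on ({0..1} \<times> UNIV) (\<lambda>(t, x). F x * K' t x)"
      unfolding K'_def split_beta by (intro continuous_intros flat_cont) auto
  qed (use t out' in \<open>auto simp: bump_kernel_def K'_def\<close>)
  define C r where "C = c + t *\<^sub>R c'" and "r = s + t * s'"
  have r: "r > 0" using rpos[OF t] by (simp add: r_def)
  \<comment> \<open>\<open>X\<close> is the velocity field of the ball, and \<open>\<eta> b\<close> the component of the flux in direction \<open>b\<close>.\<close>
  define X where "X x = c' + (s' / r) *\<^sub>R (x - C)" for x
  define \<eta> where "\<eta> b x = bump_kernel C r x * (X x \<bullet> b)" for b x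
  have sX: "smooth (\<lambda>x. X x \<bullet> b)" for b
    unfolding X_def inner_add_left inner_scaleR_left inner_diff_left by (intro smooth_intros)
  have s\<eta>: "smooth (\<eta> b)" for b unfolding \<eta>_def by (intro smooth_intros smooth_bump_kernel sX)
  have \<eta>0: "\<eta> b x = 0" if "x \<notin> cball C r" for b x using bump_kernel_outside[OF r that] by (simp add: \<eta>_def)
  have K: "cball C r \<subseteq> \<Omega>" using ball by (simp add: C_def r_def)
  have t\<eta>: "test_function \<Omega> (\<eta> b)" for b
    by (rule test_functionI[OF s\<eta> compact_cball K]) (rule \<eta>0)
  have D\<eta>: "frechet_derivative (\<eta> b) (at x) b = flat 2 (1 - (norm (x - C))\<^sup>2 / r\<^sup>2) * (- 2 * ((x - C) \<bullet> b) / r\<^sup>2) / r ^ DIM('a) * (X x \<bullet> b)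
       + bump_kernel C r x * (s' / r)" if b: "b \<in> Basis" for b x
  proof -
    have "((\<lambda>x. X x \<bullet> b) has_derivative (\<lambda>d. (s' / r) * (d \<bullet> b))) (at x)"
      unfolding X_def inner_add_left inner_scaleR_left inner_diff_left
      using r by (auto intro!: derivative_eq_intros simp: algebra_simps)
    from has_derivative_mult[OF bump_kernel_has_derivative[OF r, of C x] this]
    have "frechet_derivative (\<eta> b) (at x) = (\<lambda>d. bump_kernel C r x * ((s' / r) * (d \<bullet> b)) +
       flat 2 (1 - (norm (x - C))\<^sup>2 / r\<^sup>2) * (- 2 * ((x - C) \<bullet> d) / r\<^sup>2) / r ^ DIM('a) * (X x \<bullet> b))"
      unfolding \<eta>_def by (rule frechet_derivative_at[symmetric])
    then show ?thesis using b by simp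
  qed
  \<comment> \<open>This is the continuity equation: the field \<open>X\<close> transports the mass of the kernel.\<close>
  have div: "K' t x = - (\<Sum>b\<in>Basis. frechet_derivative (\<eta> b) (at x) b)" for x
  proof -
    define u f2 where "u = x - C" and "f2 = flat 2 (1 - (norm u)\<^sup>2 / r\<^sup>2)"
    have "(\<Sum>b\<in>Basis. frechet_derivative (\<eta> b) (at x) b)
       = (\<Sum>b\<in>Basis. (- 2 * f2 / r\<^sup>2 / r ^ DIM('a)) * ((u \<bullet> b) * (X x \<bullet> b)) + bump_kernel C r x * (s' / r))"
      by (intro sum.cong) (simp_all add: D\<eta> u_def f2_def)
    also have "\<dots> = (- 2 * f2 / r\<^sup>2 / r ^ DIM('a)) * (u \<bullet> X x) + DIM('a) * (bump_kernel C r x * (s' / r))"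
      unfolding sum.distrib sum_distrib_left[symmetric] euclidean_inner[of u "X x"] sum_constant
      by (simp only: mult.left_commute)
    also have "u \<bullet> X x = u \<bullet> c' + (s' / r) * (norm u)\<^sup>2"
      by (simp add: X_def u_def inner_add_right power2_norm_eq_inner)
    finally have Z: "(\<Sum>b\<in>Basis. frechet_derivative (\<eta> b) (at x) b)
       = - 2 * f2 / r\<^sup>2 / r ^ DIM('a) * (u \<bullet> c' + s' / r * (norm u)\<^sup>2)
         + DIM('a) * (bump_kernel C r x * (s' / r))" .
    have alg: "f2 * (2 * i / r\<^sup>2 + 2 * N * s' / r ^ 3) / P - g * (d * s' / r) / P
        = - (- 2 * f2 / r\<^sup>2 / P * (i + s' / r * N) + d * (g / P * (s' / r)))"
      if "P \<noteq> 0" for i N P g d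
      using r that by (simp add: field_simps power2_eq_square power3_eq_cube)
    show ?thesis
      unfolding Z K'_def C_def[symmetric] r_def[symmetric] u_def[symmetric] bump_kernel_def f2_def[symmetric]
      by (rule alg) (use r in simp)
  qed
  have int1: "integrable lebesgue (\<lambda>x. F x * frechet_derivative (\<eta> b) (at x) b)" for b
  proof (rule integrable_lebesgue_compact_support[OF compact_cball])
    show "continuous_on UNIV (\<lambda>x. F x * frechet_derivative (\<eta> b) (at x) b)"
      by (intro continuous_on_mult F(1) smooth_continuous smooth_frechet_derivative s\<eta>)
    show "F x * frechet_derivative (\<eta> b) (at x) b = 0" if "x \<notin> cball C r" for x
      using frechet_derivative_eq_0_on_open[of "- cball C r" "\<eta> b" x b] that \<eta>0 by auto
  qed
  have int2: "integrable lebesgue (\<lambda>x. (G x \<bullet> b) * \<eta> b x)" if b: "b \<in> Basis" for b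
  proof (rule integrable_times_compact_support[OF compact_cball K])
    show "loc_integrable \<Omega> (\<lambda>x. G x \<bullet> b)"
      using F(2) b unfolding has_weak_gradient_def loc_integrable_def by (auto intro: absolutely_integrable_component)
  qed (use s\<eta> \<eta>0 in auto)
  have wk: "(LINT x|lebesgue. F x * frechet_derivative (\<eta> b) (at x) b) = - (LINT x|lebesgue. (G x \<bullet> b) * \<eta> b x)"
    if b: "b \<in> Basis" for b
  proof -
    have outO: "x \<notin> cball C r" if "x \<notin> \<Omega>" for x using that K by blast
    have "(LINT x:\<Omega>|lebesgue. F x * frechet_derivative (\<eta> b) (at x) b) = - (LINT x:\<Omega>|lebesgue. (G x \<bullet> b) * \<eta> b x)"
      using F(2) b t\<eta> unfolding has_weak_gradient_def by blast
    moreover have "(LINT x:\<Omega>|lebesgue. F x * frechet_derivative (\<eta> b) (at x) b) = (LINT x|lebesgue. F x * frechet_derivative (\<eta> b) (at x) b)"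
    proof (rule set_integral_eq_UNIV)
      show "F x * frechet_derivative (\<eta> b) (at x) b = 0" if "x \<notin> \<Omega>" for x
        using frechet_derivative_eq_0_on_open[of "- cball C r" "\<eta> b" x b] outO[OF that] \<eta>0 by auto
    qed
    moreover have "(LINT x:\<Omega>|lebesgue. (G x \<bullet> b) * \<eta> b x) = (LINT x|lebesgue. (G x \<bullet> b) * \<eta> b x)"
      using \<eta>0 outO by (intro set_integral_eq_UNIV) simp
    ultimately show ?thesis by simp
  qed
  have "(LINT x|lebesgue. F x * K' t x) = (LINT x|lebesgue. - (\<Sum>b\<in>Basis. F x * frechet_derivative (\<eta> b) (at x) b))"
    by (simp add: div sum_distrib_left)
  also have "\<dots> = - (\<Sum>b\<in>Basis. LINT x|lebesgue. F x * frechet_derivative (\<eta> b) (at x) b)"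
    using int1 by (subst Bochner_Integration.integral_minus, subst Bochner_Integration.integral_sum) auto
  also have "\<dots> = (\<Sum>b\<in>Basis. LINT x|lebesgue. (G x \<bullet> b) * \<eta> b x)"
    using wk by (simp add: sum_negf)
  also have "\<dots> = (LINT x|lebesgue. (\<Sum>b\<in>Basis. (G x \<bullet> b) * \<eta> b x))"
    using int2 by (subst Bochner_Integration.integral_sum) auto
  also have "\<dots> = (LINT x|lebesgue. (G x \<bullet> X x) * bump_kernel C r x)"
    unfolding \<eta>_def euclidean_inner[of "G _" "X _"] sum_distrib_right by (simp add: mult_ac)
  finally show ?thesis
    using D unfolding average_def X_def C_def[symmetric] r_def[symmetric] by simp
qed

text \<open>On the moving ball the velocity field is bounded by \<open>norm c' + \<bar>s'\<bar>\<close> and the kernel by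
  \<open>1 / \<sigma> ^ n\<close>; the mean value theorem does the rest. Both translations and changes of radius are
  instances.\<close>

lemma average_diff_le:
  fixes F :: "'a::euclidean_space \<Rightarrow> real" and c c' :: 'a
  assumes F: "continuous_on UNIV F" "has_weak_gradient \<Omega> F G"
    and \<sigma>: "\<sigma> > 0" "\<sigma> \<le> s" "\<sigma> \<le> s + s'"
    and W: "\<And>t. t \<in> {0..1} \<Longrightarrow> cball (c + t *\<^sub>R c') (s + t * s') \<subseteq> W" "W \<subseteq> \<Omega>"
    and G: "set_integrable lebesgue W (\<lambda>x. norm (G x))"
  shows "\<bar>average F (c + c') (s + s') - average F c s\<bar>
    \<le> (norm c' + \<bar>s'\<bar>) / \<sigma> ^ DIM('a) * (LINT x:W|lebesgue. norm (G x))"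
proof -
  define B where "B = (norm c' + \<bar>s'\<bar>) / \<sigma> ^ DIM('a) * (LINT x:W|lebesgue. norm (G x))"
  define D where "D t = (LINT x|lebesgue. (G x \<bullet> (c' + (s' / (s + t * s')) *\<^sub>R (x - (c + t *\<^sub>R c')))) * bump_kernel (c + t *\<^sub>R c') (s + t * s') x)" for t
  have r: "\<sigma> \<le> s + t * s'" if "t \<in> {0..1}" for t
  proof -
    have "(1 - t) * \<sigma> + t * \<sigma> \<le> (1 - t) * s + t * (s + s')"
      using that \<sigma> by (intro add_mono mult_left_mono) auto
    then show ?thesis by (simp add: algebra_simps)
  qed
  have "norm (average F (c + 1 *\<^sub>R c') (s + 1 * s') - average F (c + 0 *\<^sub>R c') (s + 0 * s')) \<le> B * norm (1 - 0 :: real)"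
  proof (rule field_differentiable_bound[where S = "{0..1}" and f' = D])
    show "((\<lambda>t. average F (c + t *\<^sub>R c') (s + t * s')) has_real_derivative D t) (at t within {0..1})"
      if "t \<in> {0..1}" for t
      unfolding D_def using \<sigma> W that
      by (intro average_path_derivative[OF F]) auto
    show "norm (D t) \<le> B" if t: "t \<in> {0..1}" for t
    proof -
      define C \<rho> where "C = c + t *\<^sub>R c'" and "\<rho> = s + t * s'"
      have \<rho>: "\<rho> > 0" "\<sigma> \<le> \<rho>" using r[OF t] \<sigma> by (auto simp: \<rho>_def)
      have "\<bar>D t\<bar> \<le> (LINT x|lebesgue. \<bar>(G x \<bullet> (c' + (s' / \<rho>) *\<^sub>R (x - C))) * bump_kernel C \<rho> x\<bar>)"
        unfolding D_def C_def \<rho>_def by (rule integral_abs_bound)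
      also have "\<dots> \<le> (LINT x|lebesgue. (norm c' + \<bar>s'\<bar>) / \<sigma> ^ DIM('a) * (indicator W x *\<^sub>R norm (G x)))"
      proof (rule integral_mono')
        show "integrable lebesgue (\<lambda>x. (norm c' + \<bar>s'\<bar>) / \<sigma> ^ DIM('a) * (indicator W x *\<^sub>R norm (G x)))"
          using G by (simp add: set_integrable_def)
        fix x
        show "0 \<le> (norm c' + \<bar>s'\<bar>) / \<sigma> ^ DIM('a) * (indicator W x *\<^sub>R norm (G x))"
          using \<sigma> by (intro mult_nonneg_nonneg divide_nonneg_nonneg) auto
        show "\<bar>(G x \<bullet> (c' + (s' / \<rho>) *\<^sub>R (x - C))) * bump_kernel C \<rho> x\<bar>
            \<le> (norm c' + \<bar>s'\<bar>) / \<sigma> ^ DIM('a) * (indicator W x *\<^sub>R norm (G x))"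
        proof (cases "x \<in> cball C \<rho>")
          case False
          then show ?thesis using bump_kernel_outside[OF \<rho>(1) False] \<sigma>
            by (auto intro!: mult_nonneg_nonneg divide_nonneg_nonneg)
        next
          case True
          then have "norm (x - C) \<le> \<rho>" by (simp add: dist_norm norm_minus_commute)
          then have "norm ((s' / \<rho>) *\<^sub>R (x - C)) \<le> \<bar>s'\<bar> / \<rho> * \<rho>"
            using \<rho> mult_left_mono[of "norm (x - C)" \<rho> "\<bar>s'\<bar> / \<rho>"] by simp
          then have "norm (c' + (s' / \<rho>) *\<^sub>R (x - C)) \<le> norm c' + \<bar>s'\<bar>"
            using norm_triangle_ineq[of c' "(s' / \<rho>) *\<^sub>R (x - C)"] \<rho> by simp
          then have 1: "\<bar>G x \<bullet> (c' + (s' / \<rho>) *\<^sub>R (x - C))\<bar> \<le> norm (G x) * (norm c' + \<bar>s'\<bar>)"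
            using Cauchy_Schwarz_ineq2 mult_left_mono norm_ge_zero order_trans by metis
          have 2: "\<bar>bump_kernel C \<rho> x\<bar> \<le> 1 / \<sigma> ^ DIM('a)"
          proof -
            have "1 / \<rho> ^ DIM('a) \<le> 1 / \<sigma> ^ DIM('a)"
              using \<rho> \<sigma> by (intro divide_left_mono power_mono mult_pos_pos) auto
            then show ?thesis using bump_kernel_bounds[OF \<rho>(1), of C x] by simp
          qed
          have "x \<in> W" using True W(1)[OF t] by (auto simp: C_def \<rho>_def)
          then show ?thesis
            using mult_mono[OF 1 2] by (simp add: abs_mult mult_ac)
        qed
      qed
      also have "\<dots> = B" by (simp add: B_def set_lebesgue_integral_def)
      finally show ?thesis by simp
    qed
  qed auto
  then show ?thesis by (simp add: B_def)
qed

section \<open>Lower bound for the energy\<close>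

text \<open>Hoelder's inequality solved for the higher norm, up to the factor \<open>2\<^sup>-\<^sup>q\<close>. It follows from
  \<open>\<bar>G\<bar> \<le> \<epsilon> + \<epsilon>\<^sup>1\<^sup>-\<^sup>q \<bar>G\<bar>\<^sup>q\<close>, with \<open>\<epsilon>\<close> such that the first term accounts for at most half of \<open>m\<close>.\<close>

lemma reverse_Hoelder:
  fixes G :: "'a::euclidean_space \<Rightarrow> 'b::euclidean_space"
  assumes q: "1 \<le> q" and S: "S \<in> lmeasurable" "measure lebesgue S \<le> V"
    and G: "set_integrable lebesgue S (\<lambda>x. norm (G x))" "set_integrable lebesgue S (\<lambda>x. norm (G x) powr q)"
    and m: "0 < m" "m \<le> (LINT x:S|lebesgue. norm (G x))" and V: "0 < V"
  shows "(m / 2) powr q * V powr (1 - q) \<le> (LINT x:S|lebesgue. norm (G x) powr q)"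
proof -
  define \<epsilon> where "\<epsilon> = m / (2 * V)"
  have \<epsilon>: "\<epsilon> > 0" using m V by (simp add: \<epsilon>_def)
  have pw: "g \<le> \<epsilon> + \<epsilon> powr (1 - q) * g powr q" if "g \<ge> 0" for g
  proof (cases "g \<le> \<epsilon>")
    case True
    then show ?thesis by (simp add: add_increasing2)
  next
    case False
    then have "g powr (1 - q) \<le> \<epsilon> powr (1 - q)" using q \<epsilon> by (intro powr_mono2') auto
    then have "g powr (1 - q) * g powr q \<le> \<epsilon> powr (1 - q) * g powr q" by (rule mult_right_mono) simp
    moreover have "g powr (1 - q) * g powr q = g" using False \<epsilon> by (simp flip: powr_add)
    ultimately show ?thesis using \<epsilon> by simp
  qed
  let ?J = "LINT x:S|lebesgue. norm (G x) powr q"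
  have c: "set_integrable lebesgue S (\<lambda>x. \<epsilon>)"
    using S(1) by (auto simp: set_integrable_def fmeasurable_def intro!: integrable_mult_left integrable_real_indicator)
  have "m \<le> (LINT x:S|lebesgue. norm (G x))" by (rule m(2))
  also have "\<dots> \<le> (LINT x:S|lebesgue. \<epsilon> + \<epsilon> powr (1 - q) * norm (G x) powr q)"
    using G c by (intro set_integral_mono set_integral_add set_integrable_mult_right) (simp_all add: pw)
  also have "\<dots> = \<epsilon> * measure lebesgue S + \<epsilon> powr (1 - q) * ?J"
  proof -
    have "(LINT x:S|lebesgue. \<epsilon>) = \<epsilon> * measure lebesgue S"
      by (simp add: set_lebesgue_integral_def mult.commute)
    then show ?thesis
      using set_integral_add(2)[OF c set_integrable_mult_right[of "\<epsilon> powr (1 - q)", OF G(2)]] by simp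
  qed
  also have "\<dots> \<le> m / 2 + \<epsilon> powr (1 - q) * ?J"
    using mult_left_mono[OF S(2), of \<epsilon>] \<epsilon> V by (simp add: \<epsilon>_def)
  finally have "m / 2 \<le> \<epsilon> powr (1 - q) * ?J" by simp
  then have "\<epsilon> powr (q - 1) * (m / 2) \<le> \<epsilon> powr (q - 1) * (\<epsilon> powr (1 - q) * ?J)"
    by (rule mult_left_mono) simp
  also have "\<dots> = ?J" using \<epsilon> by (simp add: mult.assoc[symmetric] powr_add[symmetric])
  also have "\<epsilon> powr (q - 1) * (m / 2) = (m / 2) powr q * V powr (1 - q)"
  proof -
    have "\<epsilon> powr (q - 1) = (m / 2) powr (q - 1) * V powr (1 - q)"
    proof -
      have "\<epsilon> = (m / 2) / V" by (simp add: \<epsilon>_def)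
      then have "\<epsilon> powr (q - 1) = (m / 2) powr (q - 1) / V powr (q - 1)"
        using m V by (simp only: powr_divide)
      also have "\<dots> = (m / 2) powr (q - 1) * V powr (- (q - 1))"
        by (simp only: powr_minus divide_inverse)
      finally show ?thesis by simp
    qed
    moreover have "(m / 2) powr (q - 1) * (m / 2) = (m / 2) powr q"
      using m by (simp add: powr_diff)
    ultimately show ?thesis by (simp add: mult_ac)
  qed
  finally show ?thesis .
qed

text \<open>If every step obeyed the reverse inequality, the geometric series would bound the distance from
  \<open>a 0\<close> to the limit by \<open>\<gamma> / (1 - \<theta>)\<close>.\<close>

lemma geometric_jump:
  fixes a :: "nat \<Rightarrow> real"
  assumes lim: "a \<longlonglongrightarrow> l" and th: "0 < \<theta>" "\<theta> < 1" and far: "\<gamma> / (1 - \<theta>) < \<bar>a 0 - l\<bar>" and "\<gamma> \<ge> 0"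
  obtains k where "\<gamma> * \<theta> ^ k < \<bar>a (Suc k) - a k\<bar>"
proof (rule ccontr)
  assume "\<not> thesis"
  then have small: "\<bar>a (Suc k) - a k\<bar> \<le> \<gamma> * \<theta> ^ k" for k using that not_less by blast
  have "\<bar>a k - a 0\<bar> \<le> \<gamma> * (1 - \<theta> ^ k) / (1 - \<theta>)" for k
  proof (induction k)
    case (Suc k)
    have "\<gamma> * (1 - \<theta> ^ k) / (1 - \<theta>) + \<gamma> * \<theta> ^ k = \<gamma> * (1 - \<theta> ^ Suc k) / (1 - \<theta>)"
      using th by (simp add: field_simps)
    then show ?case using Suc small[of k] by linarith
  qed simp
  moreover have "\<gamma> * (1 - \<theta> ^ k) / (1 - \<theta>) \<le> \<gamma> / (1 - \<theta>)" for k
    using th \<open>\<gamma> \<ge> 0\<close> by (intro divide_right_mono mult_left_le) auto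
  ultimately have "\<bar>a k - a 0\<bar> \<le> \<gamma> / (1 - \<theta>)" for k by (meson order_trans)
  moreover have "(\<lambda>k. \<bar>a k - a 0\<bar>) \<longlonglongrightarrow> \<bar>l - a 0\<bar>" by (intro tendsto_intros lim)
  ultimately have "\<bar>l - a 0\<bar> \<le> \<gamma> / (1 - \<theta>)" by (intro LIMSEQ_le_const2) auto
  then show False using far by linarith
qed

text \<open>The Vitali covering lemma on the line selects disjoint intervals \<open>[t - \<rho>, t + \<rho>]\<close> of total length
  at least \<open>(\<beta> - \<alpha>) / 5\<close>. The distance to \<open>x0\<close> maps each ball into its interval, so the selected balls
  are disjoint and their integrals add up.\<close>

lemma radial_covering:
  fixes g :: "'a::euclidean_space \<Rightarrow> real"
  assumes g: "set_integrable lebesgue W g" "\<And>x. 0 \<le> g x" and \<kappa>: "\<kappa> \<ge> 0" and ab: "\<alpha> \<le> \<beta>"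
    and balls: "\<And>t. t \<in> {\<alpha>..\<beta>} \<Longrightarrow> \<exists>a \<rho>. 0 < \<rho> \<and> \<rho> \<le> s \<and> dist x0 a = t \<and> cball a \<rho> \<subseteq> W \<and>
        \<kappa> * \<rho> \<le> (LINT x:cball a \<rho>|lebesgue. g x)"
  shows "\<kappa> * (\<beta> - \<alpha>) / 10 \<le> (LINT x:W|lebesgue. g x)"
proof -
  obtain a \<rho> where a: "\<And>t. t \<in> {\<alpha>..\<beta>} \<Longrightarrow> 0 < \<rho> t \<and> \<rho> t \<le> s \<and> dist x0 (a t) = t \<and> cball (a t) (\<rho> t) \<subseteq> W \<and>
        \<kappa> * \<rho> t \<le> (LINT x:cball (a t) (\<rho> t)|lebesgue. g x)"
    using balls by metis
  obtain T where T: "T \<subseteq> {\<alpha>..\<beta>}" "finite T" "{\<alpha>..\<beta>} \<subseteq> (\<Union>t\<in>T. ball t (\<rho> t))"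
  proof (rule compactE_image)
    show "compact {\<alpha>..\<beta>}" by simp
    show "open (ball t (\<rho> t))" if "t \<in> {\<alpha>..\<beta>}" for t by simp
    show "{\<alpha>..\<beta>} \<subseteq> (\<Union>t\<in>{\<alpha>..\<beta>}. ball t (\<rho> t))" using a centre_in_ball by blast
  qed
  have cov: "{\<alpha>..\<beta>} \<subseteq> (\<Union>t\<in>T. cball t (\<rho> t))" using T(3) by force
  obtain C where C: "C \<subseteq> T" "pairwise (\<lambda>i j. disjnt (cball i (\<rho> i)) (cball j (\<rho> j))) C"
    "{\<alpha>..\<beta>} \<subseteq> (\<Union>i\<in>C. cball i (5 * \<rho> i))"
  proof (rule Vitali_covering_lemma_cballs[OF cov])
    show "0 < \<rho> t \<and> \<rho> t \<le> s" if "t \<in> T" for t using a[of t] that T(1) by blast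
  qed
  have fC: "finite C" using C(1) T(2) finite_subset by blast
  have aC: "0 < \<rho> i" "dist x0 (a i) = i" "cball (a i) (\<rho> i) \<subseteq> W" "\<kappa> * \<rho> i \<le> (LINT x:cball (a i) (\<rho> i)|lebesgue. g x)"
    if "i \<in> C" for i using a[of i] that C(1) T(1) by blast+
  have "\<beta> - \<alpha> = measure lborel {\<alpha>..\<beta>}" using ab by simp
  also have "\<dots> \<le> measure lborel (\<Union>i\<in>C. cball i (5 * \<rho> i))"
    using C(3) fC by (intro measure_mono_fmeasurable fmeasurable.finite_UN) (auto intro!: fmeasurableI emeasure_bounded_finite)
  also have "\<dots> \<le> (\<Sum>i\<in>C. measure lborel (cball i (5 * \<rho> i)))"
    using fC by (intro measure_UNION_le) auto
  also have "\<dots> = (\<Sum>i\<in>C. 10 * \<rho> i)"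
    using aC(1) by (intro sum.cong) (auto simp: cball_eq_atLeastAtMost less_imp_le)
  finally have len: "\<beta> - \<alpha> \<le> 10 * (\<Sum>i\<in>C. \<rho> i)" by (simp add: sum_distrib_left)
  have disj: "disjoint_family_on (\<lambda>i. cball (a i) (\<rho> i)) C"
    unfolding disjoint_family_on_def
  proof (intro ballI impI)
    fix i j assume ij: "i \<in> C" "j \<in> C" "i \<noteq> j"
    show "cball (a i) (\<rho> i) \<inter> cball (a j) (\<rho> j) = {}"
    proof (rule ccontr)
      assume "cball (a i) (\<rho> i) \<inter> cball (a j) (\<rho> j) \<noteq> {}"
      then obtain x where x: "dist (a i) x \<le> \<rho> i" "dist (a j) x \<le> \<rho> j" by auto
      have "dist x0 x \<in> cball i (\<rho> i)" "dist x0 x \<in> cball j (\<rho> j)"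
        using x aC(2)[OF ij(1)] aC(2)[OF ij(2)] dist_triangle[of x0 x "a i"] dist_triangle[of x0 x "a j"]
          dist_triangle[of x0 "a i" x] dist_triangle[of x0 "a j" x]
        by (auto simp: dist_real_def dist_commute)
      then show False using C(2) ij unfolding pairwise_def disjnt_def by blast
    qed
  qed
  have gi: "set_integrable lebesgue (cball (a i) (\<rho> i)) g" if "i \<in> C" for i
    using set_integrable_subset[OF g(1) _ aC(3)[OF that]] by simp
  have "\<kappa> * (\<beta> - \<alpha>) / 10 \<le> \<kappa> * (\<Sum>i\<in>C. \<rho> i)"
    using mult_left_mono[OF len \<kappa>] by simp
  also have "\<dots> \<le> (\<Sum>i\<in>C. LINT x:cball (a i) (\<rho> i)|lebesgue. g x)"
    unfolding sum_distrib_left using aC(4) by (rule sum_mono)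
  also have "\<dots> = (LINT x:(\<Union>i\<in>C. cball (a i) (\<rho> i))|lebesgue. g x)"
    using set_integral_finite_Union[OF fC disj gi] by simp
  also have "\<dots> \<le> (LINT x:W|lebesgue. g x)"
    unfolding set_lebesgue_integral_def
  proof (rule integral_mono')
    have "(\<Union>i\<in>C. cball (a i) (\<rho> i)) \<subseteq> W" using aC(3) by blast
    then show "indicator (\<Union>i\<in>C. cball (a i) (\<rho> i)) x *\<^sub>R g x \<le> indicator W x *\<^sub>R g x" for x
      using g(2)[of x] by (intro scaleR_right_mono indicator_leI) blast+
  qed (use g in \<open>auto simp: set_integrable_def\<close>)
  finally show ?thesis .
qed

lemma powr_scaling:
  fixes a b L r :: real
  assumes "a > 0" "b > 0" "L > 0" "r > 0"
  shows "(a * L * r powr u) powr q * (b * r powr v) powr (1 - q)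
     = a powr q * b powr (1 - q) * L powr q * r powr (u * q + v * (1 - q))"
  using assms by (simp add: powr_mult powr_powr powr_add)

lemma measure_lebesgue_cball:
  fixes c :: "'a::euclidean_space"
  assumes "r > 0"
  shows "measure lebesgue (cball c r) = unit_ball_vol (real DIM('a)) * r powr real DIM('a)"
  using content_cball[of r c] assms by (simp add: powr_realpow)

text \<open>This takes the place of the Sobolev embedding on spheres. If the claim fails, averages of \<open>F\<close> at
  scale \<open>s = \<delta> r\<close> about any two points of the spheres in question differ by less than half of \<open>I L\<close>,
  where \<open>I\<close> is the mass of the kernel (\<open>middle\<close>). So on each sphere there is a point \<open>a\<close> at which the
  average differs from \<open>I F(a)\<close> by more than a quarter of \<open>I L\<close>. Passing to dyadic radii, one of
  the steps exceeds the corresponding term of a geometric sequence with ratio \<open>\<theta>\<close>, which concentrates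
  energy proportional to \<open>\<rho>\<close> in a ball of radius \<open>\<rho>\<close> (\<open>concentrate\<close>). Proportionality to \<open>\<rho>\<close>, the
  right power for a covering of radii, dictates the exponent \<open>\<beta>\<close>, and \<open>\<beta> > 0\<close> is the condition
  \<open>q > n - 1\<close>.\<close>

lemma oscillation_bound:
  fixes q \<delta> :: real
  assumes q: "1 \<le> q" "real DIM('a::euclidean_space) - 1 < q" and \<delta>: "\<delta> > 0"
  shows "\<exists>c>0. \<forall>(\<Omega>::'a set) F G x0 r L.
     continuous_on UNIV F \<longrightarrow> has_weak_gradient \<Omega> F G \<longrightarrow> 0 < r \<longrightarrow> 0 < L \<longrightarrow>
     cball x0 ((1 + 2 * \<delta>) * r) \<subseteq> \<Omega> \<longrightarrow>
     set_integrable lebesgue (ball x0 ((1 + 2 * \<delta>) * r)) (\<lambda>x. norm (G x) powr q) \<longrightarrow>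
     (\<forall>t. r < t \<and> t < (1 + \<delta>) * r \<longrightarrow> (\<exists>a b. dist x0 a = t \<and> dist x0 b = t \<and> L \<le> F a - F b)) \<longrightarrow>
     c * L powr q * r powr (real DIM('a) - q) \<le> (LINT x:ball x0 ((1 + 2 * \<delta>) * r)|lebesgue. norm (G x) powr q)"
proof -
  define n where "n = real DIM('a)"
  define I where "I = bump_mass TYPE('a)"
  define \<omega> where "\<omega> = unit_ball_vol n"
  have n: "n \<ge> 1" by (simp add: n_def Suc_leI)
  have I: "I > 0" unfolding I_def by (rule bump_mass_pos)
  have \<omega>: "\<omega> > 0" unfolding \<omega>_def using n by (intro unit_ball_vol_pos) simp
  \<comment> \<open>The step at radius \<open>\<rho>\<close> is compared with a multiple of \<open>(\<rho> / s)\<close> to the power \<open>\<beta>\<close>.\<close>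
  define \<beta> where "\<beta> = (q - (n - 1)) / q"
  have \<beta>: "\<beta> > 0" "\<beta> * q = q - n + 1" using q by (auto simp: \<beta>_def n_def)
  define \<theta> where "\<theta> = (1/2) powr \<beta>"
  have \<theta>: "0 < \<theta>" "\<theta> < 1" unfolding \<theta>_def using \<beta>(1) powr_less_mono2[of \<beta> "1/2" 1] by auto
  define b1 where "b1 = I * \<delta> ^ DIM('a) / (4 * (1 + \<delta>))"
  define b2 where "b2 = \<omega> * (1 + 2 * \<delta>) powr n"
  define b3 where "b3 = (1 - \<theta>) * I / 4"
  define b4 where "b4 = (b3 * (1/2) powr (n - 1)) powr q * \<omega> powr (1 - q)"
  define c1 where "c1 = (b1 / 2) powr q * b2 powr (1 - q)"
  define b5 where "b5 = (1/2) powr q * b4"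
  define c2 where "c2 = b5 / 20 * \<delta> powr (n - q)"
  have pos: "b1 > 0" "b2 > 0" "b3 > 0" using I \<omega> \<delta> \<theta> by (auto simp: b1_def b2_def b3_def)
  then have pos': "b4 > 0" "b5 > 0" "c1 > 0" "c2 > 0" using \<omega> \<delta> by (auto simp: b4_def b5_def c1_def c2_def)
  show ?thesis
  proof (intro exI[of _ "min c1 c2"] conjI allI impI)
    show "min c1 c2 > 0" using pos' by simp
    fix \<Omega> :: "'a set" and F G x0 r L
    assume F: "continuous_on UNIV F" "has_weak_gradient \<Omega> F G" and r: "0 < r" and L: "0 < L"
      and sub: "cball x0 ((1 + 2 * \<delta>) * r) \<subseteq> \<Omega>"
      and Gq: "set_integrable lebesgue (ball x0 ((1 + 2 * \<delta>) * r)) (\<lambda>x. norm (G x) powr q)"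
      and osc: "\<forall>t. r < t \<and> t < (1 + \<delta>) * r \<longrightarrow> (\<exists>a b. dist x0 a = t \<and> dist x0 b = t \<and> L \<le> F a - F b)"
    define W where "W = ball x0 ((1 + 2 * \<delta>) * r)"
    define J where "J = (LINT x:W|lebesgue. norm (G x) powr q)"
    define s where "s = \<delta> * r"
    have s: "s > 0" using r \<delta> by (simp add: s_def)
    have Rpos: "(1 + 2 * \<delta>) * r > 0" using r \<delta> by simp
    have WO: "W \<subseteq> \<Omega>" unfolding W_def using sub ball_subset_cball by blast
    have GW: "set_integrable lebesgue W (\<lambda>x. norm (G x))"
    proof -
      have "G absolutely_integrable_on cball x0 ((1 + 2 * \<delta>) * r)"
        using F(2) sub unfolding has_weak_gradient_def loc_integrable_def by auto
      then have "set_integrable lebesgue (cball x0 ((1 + 2 * \<delta>) * r)) (\<lambda>x. norm (G x))"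
        by (rule set_integrable_norm)
      then show ?thesis unfolding W_def by (rule set_integrable_subset) (auto simp: ball_subset_cball)
    qed
    have GqW: "set_integrable lebesgue W (\<lambda>x. norm (G x) powr q)" using Gq by (simp add: W_def)
    have ballW: "cball a \<rho> \<subseteq> W" if "dist x0 a < (1 + \<delta>) * r" "\<rho> \<le> s" for a \<rho>
    proof
      fix x assume "x \<in> cball a \<rho>"
      then have "dist x0 x < (1 + \<delta>) * r + s" using that dist_triangle[of x0 x a] by simp
      then show "x \<in> W" by (simp add: W_def s_def algebra_simps)
    qed
    have "c1 * L powr q * r powr (n - q) \<le> J \<or> c2 * L powr q * r powr (n - q) \<le> J"
    proof (rule disjCI)
      assume no: "\<not> c2 * L powr q * r powr (n - q) \<le> J"
      show "c1 * L powr q * r powr (n - q) \<le> J"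
      proof (rule ccontr)
        assume no1: "\<not> c1 * L powr q * r powr (n - q) \<le> J"
        have middle: "\<bar>average F a s - average F b s\<bar> < I * L / 2"
          if ab: "dist x0 a < (1 + \<delta>) * r" "dist x0 b < (1 + \<delta>) * r" for a b
        proof (rule ccontr)
          assume "\<not> \<bar>average F a s - average F b s\<bar> < I * L / 2"
          then have "I * L / 2 \<le> \<bar>average F (b + (a - b)) (s + 0) - average F b s\<bar>" by simp
          also have "\<dots> \<le> (norm (a - b) + \<bar>0\<bar>) / s ^ DIM('a) * (LINT x:W|lebesgue. norm (G x))"
          proof (rule average_diff_le[OF F s])
            show "cball (b + t *\<^sub>R (a - b)) (s + t * 0) \<subseteq> W" if t: "t \<in> {0..1}" for t
            proof -
              have "b + t *\<^sub>R (a - b) = (1 - t) *\<^sub>R b + t *\<^sub>R a" by (simp add: algebra_simps)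
              also have "\<dots> \<in> ball x0 ((1 + \<delta>) * r)"
                using convexD[OF convex_ball, of b x0 "(1 + \<delta>) * r" a "1 - t" t] ab t by auto
              finally show ?thesis by (intro ballW) auto
            qed
          qed (use WO GW in auto)
          also have "\<dots> \<le> (2 * (1 + \<delta>) * r) / s ^ DIM('a) * (LINT x:W|lebesgue. norm (G x))"
          proof (intro mult_right_mono divide_right_mono)
            have "dist a b \<le> 2 * (1 + \<delta>) * r" using ab dist_triangle3[of a b x0]
              by (simp add: dist_commute algebra_simps)
            then show "norm (a - b) + \<bar>0\<bar> \<le> 2 * (1 + \<delta>) * r" by (simp add: dist_norm)
            show "0 \<le> (LINT x:W|lebesgue. norm (G x))"
              unfolding set_lebesgue_integral_def by (rule integral_nonneg_AE) auto
          qed (use s in auto)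
          finally have *: "I * L / 2 \<le> (2 * (1 + \<delta>) * r) / s ^ DIM('a) * (LINT x:W|lebesgue. norm (G x))" .
          have rn: "r ^ DIM('a) = r * r powr (n - 1)"
            using r by (simp add: powr_realpow[symmetric] n_def powr_diff)
          have "b1 * L * r powr (n - 1) = I * L / 2 * (s ^ DIM('a) / (2 * (1 + \<delta>) * r))"
          proof -
            have "I * D / (4 * e) * L * P = I * L / 2 * (D * (r * P) / (2 * e * r))" if "e \<noteq> 0" for D e P :: real
              using r that by (simp add: field_simps)
            then show ?thesis using \<delta> by (simp only: b1_def s_def power_mult_distrib rn)
          qed
          also have "\<dots> \<le> ((2 * (1 + \<delta>) * r) / s ^ DIM('a) * (LINT x:W|lebesgue. norm (G x))) * (s ^ DIM('a) / (2 * (1 + \<delta>) * r))"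
            using * r \<delta> s by (intro mult_right_mono) auto
          also have "\<dots> = (LINT x:W|lebesgue. norm (G x))"
            using r \<delta> s by simp
          finally have m: "b1 * L * r powr (n - 1) \<le> (LINT x:W|lebesgue. norm (G x))" .
          have "measure lebesgue W \<le> b2 * r powr n"
            using measure_lebesgue_cball[OF Rpos, of x0] content_cball_conv_ball[of x0 "(1 + 2 * \<delta>) * r"] r \<delta>
            by (simp add: W_def b2_def \<omega>_def n_def powr_mult)
          then have "(b1 * L * r powr (n - 1) / 2) powr q * (b2 * r powr n) powr (1 - q) \<le> J"
            unfolding J_def using m pos r L q(1) GW GqW
            by (intro reverse_Hoelder) (auto simp: W_def)
          also have "b1 * L * r powr (n - 1) / 2 = (b1 / 2) * L * r powr (n - 1)" by simp
          also have "((b1 / 2) * L * r powr (n - 1)) powr q * (b2 * r powr n) powr (1 - q)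
              = c1 * L powr q * r powr ((n - 1) * q + n * (1 - q))"
            unfolding c1_def using pos L r by (intro powr_scaling) auto
          also have "(n - 1) * q + n * (1 - q) = n - q" by (simp add: algebra_simps)
          finally show False using no1 by simp
        qed
        \<comment> \<open>the energy guaranteed per unit of radius\<close>
        define \<kappa> where "\<kappa> = b5 * L powr q * s powr (n - 1 - q)"
        have concentrate: "\<exists>\<rho>. 0 < \<rho> \<and> \<rho> \<le> s \<and> cball a \<rho> \<subseteq> W \<and> \<kappa> * \<rho> \<le> (LINT x:cball a \<rho>|lebesgue. norm (G x) powr q)"
          if far: "I * L / 4 < \<bar>average F a s - I * F a\<bar>" and a: "dist x0 a < (1 + \<delta>) * r" for a
        proof -
          have "(\<lambda>k. average F a (s / 2 ^ k)) \<longlonglongrightarrow> I * F a"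
            unfolding I_def
          proof (rule average_tendsto[OF F(1)])
            show "(\<lambda>k. s / 2 ^ k) \<longlonglongrightarrow> 0"
              using tendsto_mult_right_zero[OF LIMSEQ_realpow_zero[of "1/2 :: real"], of s] by (simp add: power_divide)
          qed (use s in simp)
          note lim = this
          have "b3 * L / (1 - \<theta>) = I * L / 4" using \<theta> by (simp add: b3_def field_simps)
          with far have far': "b3 * L / (1 - \<theta>) < \<bar>average F a (s / 2 ^ 0) - I * F a\<bar>"
            by (simp only: power_0 div_by_1)
          obtain k where k: "b3 * L * \<theta> ^ k < \<bar>average F a (s / 2 ^ Suc k) - average F a (s / 2 ^ k)\<bar>"
            using geometric_jump[OF lim \<theta> far'] pos L by (metis less_eq_real_def mult_pos_pos)
          define \<rho> where "\<rho> = s / 2 ^ k"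
          have \<rho>: "\<rho> > 0" "\<rho> \<le> s"
            using s by (auto simp: \<rho>_def divide_le_eq mult_le_cancel_left1)
          have SW: "cball a \<rho> \<subseteq> W" using a \<rho> by (intro ballW)
          have G1: "set_integrable lebesgue (cball a \<rho>) (\<lambda>x. norm (G x))"
            "set_integrable lebesgue (cball a \<rho>) (\<lambda>x. norm (G x) powr q)"
            using set_integrable_subset[OF GW _ SW] set_integrable_subset[OF GqW _ SW] by auto
          have half: "\<rho> + (- \<rho> / 2) = s / 2 ^ Suc k" "s / 2 ^ k = \<rho>" by (simp_all add: \<rho>_def)
          have "\<bar>average F (a + 0) (\<rho> + (- \<rho> / 2)) - average F a \<rho>\<bar>
              \<le> (norm (0::'a) + \<bar>- \<rho> / 2\<bar>) / (\<rho> / 2) ^ DIM('a) * (LINT x:cball a \<rho>|lebesgue. norm (G x))"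
          proof (rule average_diff_le[OF F])
            show "cball (a + t *\<^sub>R 0) (\<rho> + t * (- \<rho> / 2)) \<subseteq> cball a \<rho>" if "t \<in> {0..1}" for t
              using that \<rho> by (simp add: subset_cball)
          qed (use \<rho> SW WO G1 in auto)
          then have "b3 * L * \<theta> ^ k \<le> (\<rho> / 2) / (\<rho> / 2) ^ DIM('a) * (LINT x:cball a \<rho>|lebesgue. norm (G x))"
            using k \<rho> unfolding half by simp
          also have "(\<rho> / 2) / (\<rho> / 2) ^ DIM('a) = 1 / (\<rho> / 2) powr (n - 1)"
            using \<rho> by (simp add: powr_realpow[symmetric] n_def powr_diff)
          finally have "b3 * L * \<theta> ^ k * (\<rho> / 2) powr (n - 1) \<le> (LINT x:cball a \<rho>|lebesgue. norm (G x))"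
            using \<rho> by (simp add: field_simps)
          moreover have "b3 * L * \<theta> ^ k * (\<rho> / 2) powr (n - 1)
              = (b3 * (1/2) powr (n - 1) * s powr (- \<beta>)) * L * \<rho> powr (\<beta> + n - 1)"
          proof -
            have "\<theta> ^ k = ((1/2) ^ k) powr \<beta>"
              unfolding \<theta>_def by (simp add: powr_realpow[symmetric] powr_powr mult.commute)
            also have "(1/2) ^ k = \<rho> / s" using s by (simp add: \<rho>_def power_divide)
            also have "(\<rho> / s) powr \<beta> = \<rho> powr \<beta> * s powr (- \<beta>)"
              using \<rho> s by (simp add: powr_divide powr_minus_divide)
            finally have "\<theta> ^ k = \<rho> powr \<beta> * s powr (- \<beta>)" .
            moreover have "(\<rho> / 2) powr (n - 1) = \<rho> powr (n - 1) * (1/2) powr (n - 1)"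
              using \<rho> powr_mult[of \<rho> "1/2" "n - 1"] by simp
            moreover have "\<rho> powr (\<beta> + n - 1) = \<rho> powr \<beta> * \<rho> powr (n - 1)"
              by (simp only: powr_add[symmetric] add_diff_eq)
            ultimately show ?thesis by simp
          qed
          ultimately have m: "(b3 * (1/2) powr (n - 1) * s powr (- \<beta>)) * L * \<rho> powr (\<beta> + n - 1) \<le> (LINT x:cball a \<rho>|lebesgue. norm (G x))"
            by simp
          have "((b3 * (1/2) powr (n - 1) * s powr (- \<beta>)) * L * \<rho> powr (\<beta> + n - 1) / 2) powr q * (\<omega> * \<rho> powr n) powr (1 - q)
             \<le> (LINT x:cball a \<rho>|lebesgue. norm (G x) powr q)"
            using m pos \<rho> s L \<omega> q(1) G1 measure_lebesgue_cball[OF \<rho>(1), of a]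
            by (intro reverse_Hoelder) (auto simp: \<omega>_def n_def)
          also have "(b3 * (1/2) powr (n - 1) * s powr (- \<beta>)) * L * \<rho> powr (\<beta> + n - 1) / 2
             = ((1/2) * (b3 * (1/2) powr (n - 1)) * s powr (- \<beta>)) * L * \<rho> powr (\<beta> + n - 1)" by simp
          also have "\<dots> powr q * (\<omega> * \<rho> powr n) powr (1 - q)
             = ((1/2) * (b3 * (1/2) powr (n - 1)) * s powr (- \<beta>)) powr q * \<omega> powr (1 - q) * L powr q * \<rho> powr ((\<beta> + n - 1) * q + n * (1 - q))"
            using pos \<omega> L \<rho> s by (intro powr_scaling) auto
          also have "(\<beta> + n - 1) * q + n * (1 - q) = 1" using \<beta>(2) by (simp add: algebra_simps)
          also have "((1/2) * (b3 * (1/2) powr (n - 1)) * s powr (- \<beta>)) powr q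
             = (1/2) powr q * (b3 * (1/2) powr (n - 1)) powr q * s powr (n - 1 - q)"
          proof -
            have "- \<beta> * q = n - 1 - q" using \<beta>(2) by simp
            then have "(s powr (- \<beta>)) powr q = s powr (n - 1 - q)" by (simp only: powr_powr)
            then show ?thesis using pos by (simp only: powr_mult)
          qed
          finally have "\<kappa> * \<rho> \<le> (LINT x:cball a \<rho>|lebesgue. norm (G x) powr q)"
            using \<rho> by (simp add: \<kappa>_def b5_def b4_def mult_ac)
          then show ?thesis using \<rho> SW by blast
        qed
        \<comment> \<open>A compact range of radii strictly between \<open>r\<close> and \<open>(1 + \<delta>) r\<close>, of length \<open>s / 2\<close>.\<close>
        have "\<kappa> * ((r + 3/4 * s) - (r + 1/4 * s)) / 10 \<le> J"
          unfolding J_def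
        proof (rule radial_covering[OF GqW])
          show "\<kappa> \<ge> 0" using pos' by (simp add: \<kappa>_def)
          show "\<exists>a \<rho>. 0 < \<rho> \<and> \<rho> \<le> s \<and> dist x0 a = t \<and> cball a \<rho> \<subseteq> W \<and> \<kappa> * \<rho> \<le> (LINT x:cball a \<rho>|lebesgue. norm (G x) powr q)"
            if t: "t \<in> {r + 1/4 * s..r + 3/4 * s}" for t
          proof -
            have t': "r < t" "t < (1 + \<delta>) * r" using t s by (auto simp: s_def algebra_simps)
            then obtain a b where ab: "dist x0 a = t" "dist x0 b = t" "L \<le> F a - F b" using osc by blast
            have "I * L \<le> I * F a - I * F b" using mult_left_mono[OF ab(3), of I] I by (simp add: algebra_simps)
            moreover have "\<bar>average F a s - average F b s\<bar> < I * L / 2" using ab t' by (intro middle) auto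
            ultimately have "I * L / 4 < \<bar>average F a s - I * F a\<bar> \<or> I * L / 4 < \<bar>average F b s - I * F b\<bar>"
              by linarith
            then show ?thesis using concentrate[of a] concentrate[of b] ab t' by metis
          qed
        qed (use s in auto)
        also have "(r + 3/4 * s) - (r + 1/4 * s) = s / 2" by simp
        also have "\<kappa> * (s / 2) / 10 = b5 / 20 * L powr q * (s powr (n - 1 - q) * s powr 1)"
          using s by (simp add: \<kappa>_def)
        also have "s powr (n - 1 - q) * s powr 1 = s powr (n - q)" by (simp only: powr_add[symmetric]) simp
        also have "s powr (n - q) = \<delta> powr (n - q) * r powr (n - q)" using \<delta> r by (simp add: s_def powr_mult)
        finally show False using no by (simp add: c2_def mult_ac)
      qed
    qed
    moreover have "min c1 c2 * L powr q * r powr (n - q) \<le> c1 * L powr q * r powr (n - q)"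
       "min c1 c2 * L powr q * r powr (n - q) \<le> c2 * L powr q * r powr (n - q)"
      by (intro mult_right_mono; simp)+
    ultimately show "min c1 c2 * L powr q * r powr (real DIM('a) - q)
       \<le> (LINT x:ball x0 ((1 + 2 * \<delta>) * r)|lebesgue. norm (G x) powr q)"
      unfolding J_def W_def n_def by linarith
  qed
qed

section \<open>The dilatation estimate\<close>

lemma has_weak_gradient_cong:
  assumes "has_weak_gradient \<Omega> f G" "\<And>x. x \<in> \<Omega> \<Longrightarrow> f x = g x"
  shows "has_weak_gradient \<Omega> g G"
proof -
  have "(LINT x:\<Omega>|lebesgue. f x * h x) = (LINT x:\<Omega>|lebesgue. g x * h x)" for h
    unfolding set_lebesgue_integral_def
    by (rule Bochner_Integration.integral_cong) (auto simp: indicator_def assms(2))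
  moreover have "loc_integrable \<Omega> g"
    unfolding loc_integrable_def
  proof (intro allI impI, elim conjE)
    fix K assume K: "compact K" "K \<subseteq> \<Omega>"
    then have "set_integrable lebesgue K f" using assms(1) unfolding has_weak_gradient_def loc_integrable_def by auto
    moreover have "(\<lambda>x. indicator K x *\<^sub>R f x) = (\<lambda>x. indicator K x *\<^sub>R g x)"
      using K(2) assms(2) by (auto simp: indicator_def fun_eq_iff)
    ultimately show "set_integrable lebesgue K g" by (simp add: set_integrable_def)
  qed
  ultimately show ?thesis using assms(1) unfolding has_weak_gradient_def by simp
qed

text \<open>Off \<open>\<Omega>\<close> the values of \<open>\<phi>\<close> are arbitrary. Since the support of \<open>f\<close> pulls back to a compact subset of
  \<open>\<Omega>\<close>, extension by zero is continuous.\<close>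

lemma continuous_composition_extended_by_0:
  fixes f :: "'a::euclidean_space \<Rightarrow> real"
  assumes hom: "homeomorphism \<Omega> \<Omega>' \<phi> \<psi>" and \<Omega>: "open (\<Omega> :: 'a set)" and f: "test_function \<Omega>' f"
  shows "continuous_on UNIV (\<lambda>x. if x \<in> \<Omega> then f (\<phi> x) else 0)"
proof -
  obtain S where S: "smooth f" "compact S" "S \<subseteq> \<Omega>'" "\<And>x. x \<notin> S \<Longrightarrow> f x = 0"
    using test_functionE[OF f] by metis
  let ?F = "\<lambda>x. if x \<in> \<Omega> then f (\<phi> x) else 0"
  have c: "compact (\<psi> ` S)"
    using hom S by (intro compact_continuous_image) (auto simp: homeomorphism_def intro: continuous_on_subset)
  have "continuous_on \<Omega> (\<lambda>x. f (\<phi> x))"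
    by (rule continuous_on_compose2[OF smooth_continuous[OF S(1), of UNIV]]) (use hom in \<open>auto simp: homeomorphism_def\<close>)
  then have 1: "continuous_on \<Omega> ?F" by (rule continuous_on_eq) simp
  have "?F x = 0" if "x \<in> - (\<psi> ` S)" for x
  proof (cases "x \<in> \<Omega>")
    case True
    then have "\<phi> x \<notin> S" using that hom by (metis ComplD homeomorphism_apply1 imageI)
    then show ?thesis using S(4) by simp
  qed simp
  then have 2: "continuous_on (- (\<psi> ` S)) ?F"
    by (intro continuous_on_eq[OF continuous_on_const[of _ 0]]) metis
  have "\<psi> ` S \<subseteq> \<Omega>" using hom S(3) by (auto simp: homeomorphism_def)
  then have "\<Omega> \<union> - (\<psi> ` S) = UNIV" by blast
  then show ?thesis
    using continuous_on_open_Un[OF \<Omega> _ 1 2] c by (simp add: compact_imp_closed open_Compl)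
qed

text \<open>The image of the open ball is open, and a nonzero linear functional has no maximum on an open
  set.\<close>

lemma maximum_on_sphere:
  fixes \<phi> :: "'a::euclidean_space \<Rightarrow> 'a"
  assumes hom: "homeomorphism \<Omega> \<Omega>' \<phi> \<psi>" and op: "open \<Omega>'" and t: "0 < t" "cball x0 t \<subseteq> \<Omega>" and e: "e \<noteq> 0"
  obtains a where "dist x0 a = t" "\<And>x. x \<in> cball x0 t \<Longrightarrow> \<phi> x \<bullet> e \<le> \<phi> a \<bullet> e"
proof -
  have "continuous_on (cball x0 t) (\<lambda>x. \<phi> x \<bullet> e)"
    using hom t(2) by (intro continuous_intros) (auto simp: homeomorphism_def intro: continuous_on_subset)
  moreover have "cball x0 t \<noteq> {}" using t by simp
  ultimately obtain a where a: "a \<in> cball x0 t" "\<And>x. x \<in> cball x0 t \<Longrightarrow> \<phi> x \<bullet> e \<le> \<phi> a \<bullet> e"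
    using continuous_attains_sup[OF compact_cball] by blast
  have "\<not> dist x0 a < t"
  proof
    assume "dist x0 a < t"
    then have "\<phi> a \<in> \<phi> ` ball x0 t" by simp
    moreover have "open (\<phi> ` ball x0 t)"
      using t ball_subset_cball by (intro homeomorphism_open_image[OF hom op]) auto
    ultimately obtain \<epsilon> where \<epsilon>: "\<epsilon> > 0" "cball (\<phi> a) \<epsilon> \<subseteq> \<phi> ` ball x0 t" using open_contains_cball by metis
    have "\<phi> a + (\<epsilon> / norm e) *\<^sub>R e \<in> cball (\<phi> a) \<epsilon>" using \<epsilon>(1) e by (simp add: dist_norm)
    then obtain x where x: "x \<in> ball x0 t" "\<phi> x = \<phi> a + (\<epsilon> / norm e) *\<^sub>R e" using \<epsilon>(2) by force
    then have "\<phi> x \<bullet> e > \<phi> a \<bullet> e" using \<epsilon>(1) e by (simp add: inner_add_left)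
    then show False using a(2)[of x] x(1) by auto
  qed
  then have "dist x0 a = t" using a(1) by simp
  then show ?thesis using a(2) that by blast
qed

lemma Lphi_attained:
  fixes \<phi> :: "'a::euclidean_space \<Rightarrow> 'a"
  assumes "continuous_on (sphere x r) \<phi>" "r > 0"
  obtains y where "dist x y = r" "Lphi \<phi> x r = norm (\<phi> x - \<phi> y)"
proof -
  have "continuous_on (sphere x r) (\<lambda>y. norm (\<phi> x - \<phi> y))" using assms(1) by (intro continuous_intros)
  moreover have "sphere x r \<noteq> {}" using assms(2) by simp
  ultimately obtain y where y: "y \<in> sphere x r" "\<And>z. z \<in> sphere x r \<Longrightarrow> norm (\<phi> x - \<phi> z) \<le> norm (\<phi> x - \<phi> y)"
    using continuous_attains_sup[OF compact_sphere] by blast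
  have "Lphi \<phi> x r = norm (\<phi> x - \<phi> y)"
    unfolding Lphi_def using y by (intro cSup_eq_maximum) auto
  then show ?thesis using y(1) that by simp
qed

text \<open>The two bounds for the energy \<open>J\<close> of the component of \<open>\<phi>\<close> in the direction \<open>e\<close> in which \<open>L\<close> is
  attained, combined and raised to the power \<open>p / q\<close>. The three radii \<open>(1 + \<delta>) r\<close>, \<open>(1 + 2 \<delta>) r\<close> and
  \<open>(1 + 4 \<delta>) r\<close> leave room for the balls about points of the spheres and for the cutoff in the image.\<close>

lemma Lphi_bound:
  fixes \<Omega> \<Omega>' :: "'a::euclidean_space set" and \<phi> \<psi> :: "'a \<Rightarrow> 'a" and p q \<delta> :: real
  assumes op: "open \<Omega>" "open \<Omega>'" and q: "1 \<le> q" "real DIM('a) - 1 < q" "q < p"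
    and hom: "homeomorphism \<Omega> \<Omega>' \<phi> \<psi>" and bco: "bounded_composition_operator p q \<Omega> \<Omega>' \<phi>"
    and \<delta>: "\<delta> > 0"
  shows "\<exists>C>0. \<forall>x0 r. 0 < r \<longrightarrow> cball x0 ((1 + 4 * \<delta>) * r) \<subseteq> \<Omega> \<longrightarrow>
     Phi p q \<Omega> \<phi> (ball x0 ((1 + 4 * \<delta>) * r)) < \<infinity> \<longrightarrow>
     0 < Lphi \<phi> x0 r \<and>
     Lphi \<phi> x0 r powr p \<le> C * r powr (p * (q - real DIM('a)) / q)
        * enn2real (Phi p q \<Omega> \<phi> (ball x0 ((1 + 4 * \<delta>) * r))) powr ((p - q) / q)
        * measure lebesgue (\<phi> ` ball x0 ((1 + 4 * \<delta>) * r))"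
proof -
  define n where "n = real DIM('a)"
  obtain M where M: "M \<ge> 0" "\<And>t. \<bar>tooth' t\<bar> \<le> M" using tooth'_bounded by metis
  obtain c where c: "c > 0" and osc: "\<And>(\<Omega>::'a set) F G x0 r L. continuous_on UNIV F \<Longrightarrow> has_weak_gradient \<Omega> F G \<Longrightarrow>
     0 < r \<Longrightarrow> 0 < L \<Longrightarrow> cball x0 ((1 + 2 * \<delta>) * r) \<subseteq> \<Omega> \<Longrightarrow>
     set_integrable lebesgue (ball x0 ((1 + 2 * \<delta>) * r)) (\<lambda>x. norm (G x) powr q) \<Longrightarrow>
     (\<And>t. r < t \<Longrightarrow> t < (1 + \<delta>) * r \<Longrightarrow> (\<exists>a b. dist x0 a = t \<and> dist x0 b = t \<and> L \<le> F a - F b)) \<Longrightarrow>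
     c * L powr q * r powr (n - q) \<le> (LINT x:ball x0 ((1 + 2 * \<delta>) * r)|lebesgue. norm (G x) powr q)"
  proof -
    from oscillation_bound[OF q(1,2) \<delta>] obtain c where "c > 0" and *: "\<forall>(\<Omega>::'a set) F G x0 r L.
     continuous_on UNIV F \<longrightarrow> has_weak_gradient \<Omega> F G \<longrightarrow> 0 < r \<longrightarrow> 0 < L \<longrightarrow>
     cball x0 ((1 + 2 * \<delta>) * r) \<subseteq> \<Omega> \<longrightarrow>
     set_integrable lebesgue (ball x0 ((1 + 2 * \<delta>) * r)) (\<lambda>x. norm (G x) powr q) \<longrightarrow>
     (\<forall>t. r < t \<and> t < (1 + \<delta>) * r \<longrightarrow> (\<exists>a b. dist x0 a = t \<and> dist x0 b = t \<and> L \<le> F a - F b)) \<longrightarrow>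
     c * L powr q * r powr (real DIM('a) - q) \<le> (LINT x:ball x0 ((1 + 2 * \<delta>) * r)|lebesgue. norm (G x) powr q)"
      by (elim exE conjE)
    show thesis
    proof (rule that[OF \<open>c > 0\<close>])
    qed (use * in \<open>simp add: n_def\<close>)
  qed
  have pq: "p > 0" "q > 0" using q by auto
  define C where "C = (2 / c) powr (p / q) * (M + 1) powr p"
  show ?thesis
  proof (intro exI[of _ C] conjI allI impI)
    show "C > 0" using c M by (simp add: C_def)
    fix x0 r
    assume r: "0 < r" and sub: "cball x0 ((1 + 4 * \<delta>) * r) \<subseteq> \<Omega>"
      and fin: "Phi p q \<Omega> \<phi> (ball x0 ((1 + 4 * \<delta>) * r)) < \<infinity>"
    define B where "B = ball x0 ((1 + 4 * \<delta>) * r)"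
    define E where "E = ball x0 ((1 + 2 * \<delta>) * r)"
    define K where "K = cball x0 ((1 + 2 * \<delta>) * r)"
    define L where "L = Lphi \<phi> x0 r"
    have cont: "continuous_on \<Omega> \<phi>" and inj: "inj_on \<phi> \<Omega>"
      using hom by (auto simp: homeomorphism_def intro: inj_on_inverseI)
    have rad: "r < (1 + 2 * \<delta>) * r" "(1 + 2 * \<delta>) * r < (1 + 4 * \<delta>) * r" "(1 + \<delta>) * r < (1 + 2 * \<delta>) * r"
      using r \<delta> by (auto simp: algebra_simps)
    have KB: "K \<subseteq> B" unfolding K_def B_def using rad by auto
    have BO: "B \<subseteq> \<Omega>" unfolding B_def using sub ball_subset_cball by blast
    have EK: "E \<subseteq> K" unfolding E_def K_def by (rule ball_subset_cball)
    have x0: "x0 \<in> K" unfolding K_def using r \<delta> by simp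
    have sphK: "sphere x0 r \<subseteq> K" unfolding K_def using rad by auto
    obtain y where y: "dist x0 y = r" "L = norm (\<phi> x0 - \<phi> y)"
      unfolding L_def using Lphi_attained[of x0 r \<phi>] r continuous_on_subset[OF cont] sphK KB BO by blast
    have yK: "y \<in> K" using sphK y(1) by auto
    have "x0 \<noteq> y" using y(1) r by auto
    then have "\<phi> x0 \<noteq> \<phi> y" using inj x0 yK KB BO unfolding inj_on_def by blast
    then have L: "L > 0" using y(2) by simp
    then show "0 < Lphi \<phi> x0 r" by (simp add: L_def)
    define e where "e = (1 / L) *\<^sub>R (\<phi> x0 - \<phi> y)"
    have e: "norm e = 1" using L y(2) by (simp add: e_def)
    have eL: "(\<phi> x0 - \<phi> y) \<bullet> e = L"
      using L y(2) by (simp add: e_def power2_norm_eq_inner[symmetric] power2_eq_square)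
    have cK: "compact (\<phi> ` K)" "\<phi> ` K \<subseteq> \<Omega>'"
      using hom KB BO unfolding K_def
      by (auto simp: homeomorphism_def intro!: compact_continuous_image intro: continuous_on_subset)
    then obtain \<zeta> where \<zeta>: "test_function \<Omega>' \<zeta>" "\<And>z. z \<in> \<phi> ` K \<Longrightarrow> \<zeta> z = 1"
      using smooth_cutoff_exists[OF cK(1) op(2) cK(2)] by metis
    \<comment> \<open>On \<open>\<phi> ` K\<close> this is the linear functional; the cutoff turns it into an element of the Sobolev space.\<close>
    define f0 where "f0 z = \<zeta> z * (z \<bullet> e)" for z
    have f0: "test_function \<Omega>' f0" unfolding f0_def using \<zeta>(1) smooth_inner by (rule test_function_mult_right)
    have f0K: "f0 (\<phi> x) = \<phi> x \<bullet> e" if "x \<in> K" for x using \<zeta>(2) that by (simp add: f0_def)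
    define G where "G = weak_gradient \<Omega> (f0 \<circ> \<phi>)"
    define F where "F x = (if x \<in> \<Omega> then f0 (\<phi> x) else 0)" for x
    have mem: "f0 \<circ> \<phi> \<in> L1 q \<Omega>" by (rule composition_in_L1[OF bco op(2) pq(1) f0])
    have F: "continuous_on UNIV F" "has_weak_gradient \<Omega> F G"
      unfolding F_def G_def
      by (rule continuous_composition_extended_by_0[OF hom op(1) f0],
          rule has_weak_gradient_cong[OF L1_has_weak_gradient[OF mem]]) simp
    have FK: "F x = \<phi> x \<bullet> e" if "x \<in> K" for x using f0K that KB BO by (auto simp: F_def)
    define J where "J = (LINT x:E|lebesgue. norm (G x) powr q)"
    have lower: "c * L powr q * r powr (n - q) \<le> J"
      unfolding J_def E_def
    proof (rule osc[OF F r L])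
      show "cball x0 ((1 + 2 * \<delta>) * r) \<subseteq> \<Omega>" using KB BO by (simp add: K_def)
      show "set_integrable lebesgue (ball x0 ((1 + 2 * \<delta>) * r)) (\<lambda>x. norm (G x) powr q)"
      proof (rule set_integrable_subset)
        show "set_integrable lebesgue \<Omega> (\<lambda>x. norm (G x) powr q)" using mem by (simp add: L1_def G_def)
        show "ball x0 ((1 + 2 * \<delta>) * r) \<subseteq> \<Omega>" using EK KB BO by (simp add: E_def)
      qed simp
      fix t assume t: "r < t" "t < (1 + \<delta>) * r"
      have tK: "cball x0 t \<subseteq> K" using t rad unfolding K_def by auto
      then have tO: "cball x0 t \<subseteq> \<Omega>" using KB BO by blast
      have t0: "t > 0" and e0: "e \<noteq> 0" and e0': "- e \<noteq> 0" using t r e by auto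
      have in_t: "x0 \<in> cball x0 t" "y \<in> cball x0 t" using t r y(1) by auto
      obtain a where a: "dist x0 a = t" "\<And>x. x \<in> cball x0 t \<Longrightarrow> \<phi> x \<bullet> e \<le> \<phi> a \<bullet> e"
        using maximum_on_sphere[OF hom op(2) t0 tO e0] by blast
      obtain b where b: "dist x0 b = t" "\<And>x. x \<in> cball x0 t \<Longrightarrow> \<phi> x \<bullet> (- e) \<le> \<phi> b \<bullet> (- e)"
        using maximum_on_sphere[OF hom op(2) t0 tO e0'] by blast
      have "L \<le> \<phi> a \<bullet> e - \<phi> b \<bullet> e"
        using a(2)[OF in_t(1)] b(2)[OF in_t(2)] eL by (simp add: inner_diff_left)
      moreover have "a \<in> K" "b \<in> K" using tK a(1) b(1) by auto
      ultimately show "\<exists>a b. dist x0 a = t \<and> dist x0 b = t \<and> L \<le> F a - F b"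
        using a(1) b(1) FK by metis
    qed
    define P where "P = enn2real (Phi p q \<Omega> \<phi> B)"
    define m where "m = measure lebesgue (\<phi> ` B)"
    have bdd: "bounded (\<phi> ` B)"
    proof (rule bounded_subset)
      show "bounded (\<phi> ` cball x0 ((1 + 4 * \<delta>) * r))"
        using continuous_on_subset[OF cont sub] by (intro compact_imp_bounded compact_continuous_image) auto
      show "\<phi> ` B \<subseteq> \<phi> ` cball x0 ((1 + 4 * \<delta>) * r)" unfolding B_def by (intro image_mono ball_subset_cball)
    qed
    have upper: "J \<le> 2 * (P powr ((p - q) / p) * ((M + 1) powr p * m) powr (q / p))"
      unfolding J_def G_def P_def m_def
      by (rule energy_bound_by_Phi[OF hom op bco pq(2) q(3) _ BO bdd _ KB _ EK _ f0])
         (use e f0K EK fin M(2) in \<open>auto simp: B_def K_def E_def\<close>)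
    have P0: "P \<ge> 0" and m0: "m \<ge> 0" by (simp_all add: P_def m_def)
    have "L powr q \<le> (2 / c) * r powr (q - n) * (P powr ((p - q) / p) * ((M + 1) powr p * m) powr (q / p))"
    proof -
      have "L powr q = c * L powr q * r powr (n - q) * (r powr (q - n) / c)"
        using c r by (simp add: powr_add[symmetric])
      also have "\<dots> \<le> J * (r powr (q - n) / c)"
        using lower c by (intro mult_right_mono) auto
      also have "\<dots> \<le> 2 * (P powr ((p - q) / p) * ((M + 1) powr p * m) powr (q / p)) * (r powr (q - n) / c)"
        using upper c by (intro mult_right_mono) auto
      finally show ?thesis by (simp add: mult_ac)
    qed
    then have "(L powr q) powr (p / q) \<le> ((2 / c) * r powr (q - n) * (P powr ((p - q) / p) * ((M + 1) powr p * m) powr (q / p))) powr (p / q)"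
      using pq by (intro powr_mono2) auto
    also have "\<dots> = (2 / c) powr (p / q) * (r powr (q - n)) powr (p / q) * ((P powr ((p - q) / p)) powr (p / q) * (((M + 1) powr p * m) powr (q / p)) powr (p / q))"
      using c by (simp only: powr_mult)
    also have "(r powr (q - n)) powr (p / q) = r powr (p * (q - n) / q)"
      by (simp add: powr_powr mult.commute)
    also have "(P powr ((p - q) / p)) powr (p / q) = P powr ((p - q) / q)"
      using pq by (simp add: powr_powr)
    also have "(((M + 1) powr p * m) powr (q / p)) powr (p / q) = (M + 1) powr p * m"
      using pq m0 by (simp add: powr_powr)
    also have "(L powr q) powr (p / q) = L powr p" using pq by (simp add: powr_powr)
    finally show "Lphi \<phi> x0 r powr p \<le> C * r powr (p * (q - real DIM('a)) / q)
        * enn2real (Phi p q \<Omega> \<phi> (ball x0 ((1 + 4 * \<delta>) * r))) powr ((p - q) / q)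
        * measure lebesgue (\<phi> ` ball x0 ((1 + 4 * \<delta>) * r))"
      unfolding L_def P_def m_def B_def C_def n_def by (simp add: mult_ac)
  qed
qed

text \<open>If \<open>Phi\<close> of the ball is infinite, the quotient is zero. Otherwise \<open>Lphi_bound\<close> applies with
  \<open>1 + 4 \<delta> = lam\<close>. As its left-hand side is positive, neither \<open>Phi\<close> of the ball nor the volume of the
  image vanishes, the quotient is a real number, and all powers of \<open>r\<close> cancel.\<close>

theorem theorem3p11:
  fixes \<Omega> \<Omega>' :: "'a::euclidean_space set" and \<phi> \<psi> :: "'a \<Rightarrow> 'a" and p q :: real
  assumes "open \<Omega>" "connected \<Omega>" "\<Omega> \<noteq> {}"
    and "open \<Omega>'" "connected \<Omega>'" "\<Omega>' \<noteq> {}"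
    and "1 \<le> q" "real DIM('a) - 1 < q" "q < real DIM('a)" "q < p"
    and "homeomorphism \<Omega> \<Omega>' \<phi> \<psi>"
    and "bounded_composition_operator p q \<Omega> \<Omega>' \<phi>"
  shows "\<forall>lam>1. \<exists>H::real. \<forall>x0\<in>\<Omega>.
           Limsup (at_right 0) (dilatation_quotient p q \<Omega> \<phi> lam x0) \<le> ennreal H"
proof (intro allI impI)
  fix lam :: real assume lam: "1 < lam"
  define n where "n = real DIM('a)"
  define \<delta> where "\<delta> = (lam - 1) / 4"
  have \<delta>: "\<delta> > 0" "1 + 4 * \<delta> = lam" using lam by (simp_all add: \<delta>_def field_simps)
  obtain C where C: "C > 0" and bound: "\<And>x0 r. 0 < r \<Longrightarrow> cball x0 (lam * r) \<subseteq> \<Omega> \<Longrightarrow>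
     Phi p q \<Omega> \<phi> (ball x0 (lam * r)) < \<infinity> \<Longrightarrow>
     0 < Lphi \<phi> x0 r \<and>
     Lphi \<phi> x0 r powr p \<le> C * r powr (p * (q - n) / q)
        * enn2real (Phi p q \<Omega> \<phi> (ball x0 (lam * r))) powr ((p - q) / q)
        * measure lebesgue (\<phi> ` ball x0 (lam * r))"
    using Lphi_bound[OF assms(1,4,7,8,10,11,12) \<delta>(1)] unfolding \<delta>(2) n_def by blast
  define a where "a = (p - q) / q"
  have a: "a > 0" using assms by (simp add: a_def)
  define H where "H = C * unit_ball_vol n powr a"
  show "\<exists>H::real. \<forall>x0\<in>\<Omega>. Limsup (at_right 0) (dilatation_quotient p q \<Omega> \<phi> lam x0) \<le> ennreal H"
  proof (intro exI[of _ H] ballI Limsup_bounded)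
    fix x0 assume "x0 \<in> \<Omega>"
    then obtain R where R: "R > 0" "cball x0 R \<subseteq> \<Omega>" using assms(1) open_contains_cball by metis
    have "\<forall>\<^sub>F r in at_right 0. r \<in> {0<..<R / lam}"
      using R lam by (intro eventually_at_right_real) simp
    then show "\<forall>\<^sub>F r in at_right 0. dilatation_quotient p q \<Omega> \<phi> lam x0 r \<le> ennreal H"
    proof eventually_elim
      case (elim r)
      then have r: "r > 0" "lam * r < R" using lam by (auto simp: field_simps)
      define B where "B = ball x0 (lam * r)"
      have cB: "cball x0 (lam * r) \<subseteq> \<Omega>" using R r by auto
      then have BO: "B \<subseteq> \<Omega>" unfolding B_def using ball_subset_cball by blast
      show "dilatation_quotient p q \<Omega> \<phi> lam x0 r \<le> ennreal H"
      proof (cases "Phi p q \<Omega> \<phi> B = \<infinity>")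
        case True
        then show ?thesis by (simp add: dilatation_quotient_def B_def ennpowr_def)
      next
        case False
        then have fin: "Phi p q \<Omega> \<phi> B < \<infinity>" by (simp add: less_top)
        define P m L where "P = enn2real (Phi p q \<Omega> \<phi> B)" and "m = measure lebesgue (\<phi> ` B)" and "L = Lphi \<phi> x0 r"
        have L: "L > 0" "L powr p \<le> C * r powr (p * (q - n) / q) * P powr a * m"
          using bound[OF r(1) cB] fin by (simp_all add: P_def m_def L_def B_def a_def)
        have "P \<ge> 0" "m \<ge> 0" by (simp_all add: P_def m_def)
        moreover have "P \<noteq> 0" "m \<noteq> 0" using L powr_gt_zero[of L p] by auto
        ultimately have pos: "P > 0" "m > 0" by simp_all
        have PhiP: "Phi p q \<Omega> \<phi> B = ennreal P" using fin by (simp add: P_def)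
        have "emeasure lebesgue (\<phi> ` B) \<noteq> \<infinity>"
          using pos(2) unfolding m_def measure_def by auto
        then have mm: "emeasure lebesgue (\<phi> ` B) = ennreal m"
          by (simp add: m_def emeasure_eq_ennreal_measure)
        define V where "V = unit_ball_vol n * r powr n"
        have V: "emeasure lebesgue (ball x0 r) = ennreal V" "V > 0"
          using r(1) emeasure_ball[of r x0] by (simp_all add: V_def n_def powr_realpow)
        have "dilatation_quotient p q \<Omega> \<phi> lam x0 r
            = ennreal (L powr p * r powr (n - p)) / ennreal m * ennpowr (ennreal V / ennreal P) a"
          by (simp add: dilatation_quotient_def L_def n_def a_def V mm[unfolded B_def] PhiP[unfolded B_def])
        also have "\<dots> = ennreal (L powr p * r powr (n - p) / m * (V / P) powr a)"
          using pos V(2) by (simp add: divide_ennreal ennpowr_def ennreal_mult'[symmetric])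
        also have "\<dots> \<le> ennreal H"
        proof (rule ennreal_leI)
          have "L powr p * r powr (n - p) / m * (V / P) powr a
              \<le> (C * r powr (p * (q - n) / q) * P powr a * m) * r powr (n - p) / m * (V / P) powr a"
            using L(2) pos by (intro mult_right_mono divide_right_mono) auto
          also have "\<dots> = H * (r powr (p * (q - n) / q) * r powr (n - p) * r powr (n * a))"
          proof -
            have "(V / P) powr a = unit_ball_vol n powr a * r powr (n * a) / P powr a"
              using pos r by (simp add: V_def powr_divide powr_mult powr_powr)
            then show ?thesis using pos by (simp add: H_def)
          qed
          also have "r powr (p * (q - n) / q) * r powr (n - p) * r powr (n * a) = r powr (p * (q - n) / q + (n - p) + n * a)"
            by (simp only: powr_add)
          also have "p * (q - n) / q + (n - p) + n * a = 0"
            using assms(7) by (simp add: a_def field_simps)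
          finally show "L powr p * r powr (n - p) / m * (V / P) powr a \<le> H" using r(1) by simp
        qed
        finally show ?thesis .
      qed
    qed
  qed
qed

end
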